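(* Let $n\ge2$, let $B$ be the unit ball of $\mathbb{R}^n$ and let $\alpha>0$. Let $G$ and $H$ be N-functions with $g=G'$, $h=H'$, such that for some constants $p^\pm,q^\pm\in(1,n)$ $$p^- G(t)\le t g(t)\le p^+ G(t),\qquad q^- H(t)\le t h(t)\le q^+H(t)\qquad\text{for all } t\ge 0,$$ and such that $q^-\ge (p^+)^*_\alpha$, where $$(p^+)^*_\alpha=\frac{np^+}{n-p^+}+\frac{\alpha p^+}{n-p^+}.$$ Then there is no solution $u\in L^\infty(B)\cap W_0^{1,G}(B)$ of the problem $$-\operatorname{div}\left(\frac{g(|\nabla u|)}{|\nabla u|}\nabla u\right)=|x|^\alpha h(u)\ \text{ in } B,\qquad u>0\ \text{ in } B,\qquad u=0\ \text{ on }\partial B.$$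
   Context: An N-function is a function $G:[0,\infty)\to\mathbb{R}$ of the form $G(t)=\int_0^t g(\tau)\,d\tau$, where $g$ is right-continuous on $[0,\infty)$, positive for $t>0$, non-decreasing, $g(0)=0$ and $\lim_{t\to\infty}g(t)=\infty$. One writes $g=G'$ and $h=H'$ for the derivatives of $G$ and $H$. $L^G(B)=\{u:\int_B G(|u|)dx<\infty\}$, $W^{1,G}(B)=\{u\in L^G(B):\int_B G(|\nabla u|)dx<\infty\}$ with the norm $\|u\|_{L^G(B)}+\|\nabla u\|_{L^G(B)}$, where $\|f\|_{L^G(B)}=\inf\{\lambda>0:\int_B G(|f|/\lambda)dx\le1\}$; $W_0^{1,G}(B)$ is the closure of $C_0^\infty(B)$ in $W^{1,G}(B)$. Solutions are weak solutions: $u\in W_0^{1,G}(B)$ with $u>0$ a.e. in $B$ and $$\int_B \frac{g(|\nabla u|)}{|\nabla u|}\nabla u\cdot\nabla v\,dx=\int_B|x|^\alpha h(u_+)v\,dx\quad\text{for every } v\in W_0^{1,G}(B),$$ where $u_+=\max\{u,0\}$ and the vector field is read as $0$ where $\nabla u=0$. *)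

theory Defs
  imports "HOL-Analysis.Analysis"
begin

(* G is the N-function with density g.  As g is right-continuous, it is the right derivative
   of G, so that G determines g on [0, oo); the values of both at negative arguments are
   irrelevant. *)
definition N_function :: "(real \<Rightarrow> real) \<Rightarrow> (real \<Rightarrow> real) \<Rightarrow> bool" where
  "N_function G g \<longleftrightarrow>
     (\<forall>t\<ge>0. continuous (at_right t) g) \<and>
     (\<forall>t>0. 0 < g t) \<and>
     mono_on {0..} g \<and>
     g 0 = 0 \<and>
     filterlim g at_top at_top \<and>
     (\<forall>t\<ge>0. G t = integral {0..t} g)"

fun C_k :: "nat \<Rightarrow> ('a::euclidean_space \<Rightarrow> real) \<Rightarrow> bool" where
  "C_k 0 f \<longleftrightarrow> continuous_on UNIV f"
| "C_k (Suc k) f \<longleftrightarrow>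
     (\<forall>x. f differentiable (at x)) \<and>
     (\<forall>i\<in>Basis. C_k k (\<lambda>x. frechet_derivative f (at x) i))"

definition test_functions :: "'a::euclidean_space set \<Rightarrow> ('a \<Rightarrow> real) set" where
  "test_functions \<Omega> =
     {\<phi>. (\<forall>k. C_k k \<phi>) \<and> compact (closure {x. \<phi> x \<noteq> 0}) \<and> closure {x. \<phi> x \<noteq> 0} \<subseteq> \<Omega>}"

(* Elements of function spaces are represented by functions on the whole space of which only
   the restriction to the domain matters; equality almost everywhere is not quotiented out. *)

definition locally_integrable :: "'a::euclidean_space set \<Rightarrow> ('a \<Rightarrow> 'b::euclidean_space) \<Rightarrow> bool" where
  "locally_integrable \<Omega> f \<longleftrightarrow> (\<forall>K. compact K \<and> K \<subseteq> \<Omega> \<longrightarrow> f absolutely_integrable_on K)"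

definition is_weak_gradient ::
    "'a::euclidean_space set \<Rightarrow> ('a \<Rightarrow> real) \<Rightarrow> ('a \<Rightarrow> 'a) \<Rightarrow> bool" where
  "is_weak_gradient \<Omega> u V \<longleftrightarrow>
     locally_integrable \<Omega> u \<and> locally_integrable \<Omega> V \<and>
     (\<forall>\<phi>\<in>test_functions \<Omega>. \<forall>i\<in>Basis.
        (LINT x|lebesgue_on \<Omega>. u x * frechet_derivative \<phi> (at x) i) =
        - (LINT x|lebesgue_on \<Omega>. (V x \<bullet> i) * \<phi> x))"

(* A weak gradient on an open set is unique up to null sets, so the choice is immaterial below. *)
definition weak_gradient :: "'a::euclidean_space set \<Rightarrow> ('a \<Rightarrow> real) \<Rightarrow> 'a \<Rightarrow> 'a" where
  "weak_gradient \<Omega> u = (SOME V. is_weak_gradient \<Omega> u V)"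

definition modular ::
    "(real \<Rightarrow> real) \<Rightarrow> 'a::euclidean_space set \<Rightarrow> ('a \<Rightarrow> 'b::euclidean_space) \<Rightarrow> ennreal" where
  "modular G \<Omega> f = (\<integral>\<^sup>+x. ennreal (G (norm (f x))) \<partial>lebesgue_on \<Omega>)"

definition Orlicz_class ::
    "(real \<Rightarrow> real) \<Rightarrow> 'a::euclidean_space set \<Rightarrow> ('a \<Rightarrow> 'b::euclidean_space) set" where
  "Orlicz_class G \<Omega> = {f \<in> borel_measurable (lebesgue_on \<Omega>). modular G \<Omega> f < \<infinity>}"

(* The set is nonempty for f and for the difference of f and f' when both lie in the Orlicz
   class of an N-function, by convexity. *)
definition Luxemburg_norm ::
    "(real \<Rightarrow> real) \<Rightarrow> 'a::euclidean_space set \<Rightarrow> ('a \<Rightarrow> 'b::euclidean_space) \<Rightarrow> real" where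
  "Luxemburg_norm G \<Omega> f = Inf {l. 0 < l \<and> modular G \<Omega> (\<lambda>x. f x /\<^sub>R l) \<le> 1}"

definition W1 :: "(real \<Rightarrow> real) \<Rightarrow> 'a::euclidean_space set \<Rightarrow> ('a \<Rightarrow> real) set" where
  "W1 G \<Omega> = {u \<in> Orlicz_class G \<Omega>.
     (\<exists>V. is_weak_gradient \<Omega> u V) \<and> weak_gradient \<Omega> u \<in> Orlicz_class G \<Omega>}"

definition W1_norm :: "(real \<Rightarrow> real) \<Rightarrow> 'a::euclidean_space set \<Rightarrow> ('a \<Rightarrow> real) \<Rightarrow> real" where
  "W1_norm G \<Omega> u = Luxemburg_norm G \<Omega> u + Luxemburg_norm G \<Omega> (weak_gradient \<Omega> u)"

definition W1_0 :: "(real \<Rightarrow> real) \<Rightarrow> 'a::euclidean_space set \<Rightarrow> ('a \<Rightarrow> real) set" where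
  "W1_0 G \<Omega> = {u \<in> W1 G \<Omega>. \<forall>\<epsilon>>0. \<exists>\<phi>\<in>test_functions \<Omega>. W1_norm G \<Omega> (\<lambda>x. u x - \<phi> x) < \<epsilon>}"

definition L_infty :: "'a::euclidean_space set \<Rightarrow> ('a \<Rightarrow> real) set" where
  "L_infty \<Omega> = {u \<in> borel_measurable (lebesgue_on \<Omega>). \<exists>M. AE x in lebesgue_on \<Omega>. \<bar>u x\<bar> \<le> M}"

(* The scalar g |xi| / |xi| is 0 for xi = 0, since division by 0 gives 0. *)
definition G_field :: "(real \<Rightarrow> real) \<Rightarrow> 'a::euclidean_space \<Rightarrow> 'a" where
  "G_field g \<xi> = (g (norm \<xi>) / norm \<xi>) *\<^sub>R \<xi>"

(* Weak solutions u of  - div (g(|Du|)/|Du| Du) = |x|^alpha h(u), u > 0 in Omega, u = 0 on the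
   boundary.  The two integrability conditions say that the integrals in the weak formulation
   exist, as the Lebesgue integral of a non-integrable function is 0 by convention.  They hold
   automatically if t g(t) <= p G(t) for all t >= 0, Omega is bounded and u is essentially
   bounded. *)
definition weak_solution ::
    "(real \<Rightarrow> real) \<Rightarrow> (real \<Rightarrow> real) \<Rightarrow> (real \<Rightarrow> real) \<Rightarrow> real \<Rightarrow> 'a::euclidean_space set
      \<Rightarrow> ('a \<Rightarrow> real) \<Rightarrow> bool" where
  "weak_solution G g h \<alpha> \<Omega> u \<longleftrightarrow>
     u \<in> W1_0 G \<Omega> \<and>
     (AE x in lebesgue_on \<Omega>. 0 < u x) \<and>
     (\<forall>v\<in>W1_0 G \<Omega>.
        integrable (lebesgue_on \<Omega>)
          (\<lambda>x. G_field g (weak_gradient \<Omega> u x) \<bullet> weak_gradient \<Omega> v x) \<and>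
        integrable (lebesgue_on \<Omega>)
          (\<lambda>x. norm x powr \<alpha> * h (max (u x) 0) * v x) \<and>
        (LINT x|lebesgue_on \<Omega>. G_field g (weak_gradient \<Omega> u x) \<bullet> weak_gradient \<Omega> v x) =
        (LINT x|lebesgue_on \<Omega>. norm x powr \<alpha> * h (max (u x) 0) * v x))"

definition critical_exponent :: "real \<Rightarrow> real \<Rightarrow> real \<Rightarrow> real" where
  "critical_exponent n \<alpha> p = n * p / (n - p) + \<alpha> * p / (n - p)"

end

theory Submission
  imports Defs
begin

text \<open>A solution \<open>u\<close> minimizes the convex functional \<open>v \<mapsto> \<integral> G(\<bar>\<nabla>v\<bar>) - \<integral> f v\<close> with \<open>f = \<bar>x\<bar>^\<alpha> h(u)\<close>, so no
  regularity is needed to compare it with its dilations \<open>u(t x)\<close>, \<open>t > 1\<close>, which vanish outside the ball of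
  radius \<open>1 / t\<close>. Let \<open>E = \<integral> G(\<bar>\<nabla>u\<bar>)\<close> and \<open>K = \<integral> \<bar>x\<bar>^\<alpha> H(u)\<close>. The dilation changes the energy by at most
  \<open>(p - n) E (t - 1)\<close> to first order, as \<open>\<tau> g(\<tau>) \<le> p G(\<tau>)\<close>, and \<open>\<integral> f u(t x)\<close> has derivative \<open>- (n + \<alpha>) K\<close>
  at \<open>t = 1\<close>. This gives the Pohozaev inequality \<open>(n - p) E \<le> (n + \<alpha>) K\<close>. Adding a small function supported on
  the ball that is constant inside and drops to \<open>0\<close> where \<open>u(t x)\<close> vanishes makes the inequality strict.
  Testing the equation with \<open>u\<close> gives \<open>q K \<le> p E\<close>, which contradicts strictness if
  \<open>q (n - p) \<ge> p (n + \<alpha>)\<close>.\<close>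

subsection \<open>Smooth functions\<close>

text \<open>Pohozaev's argument tests the equation with x . grad u, which need not be admissible for
  a solution that is only bounded with a weak gradient. Since x . grad u is the derivative of u(t x)
  at t = 1, comparing energies along dilations extracts the same information from admissible
  functions. Only t > 1 keeps the support inside the ball, so the comparison is one-sided and yields
  an inequality. In the critical case q (n - p) = p (n + \<alpha>) that inequality and the one from
  testing with u are compatible, which is why strictness has to be gained. It comes from g(0+) = 0:
  lifting the competitor on a fixed smaller ball by a ramp of small slope gains in proportion to the
  slope, while the ramp costs only G of the slope. A weak solution is reached only through test
  functions converging in Luxemburg norm, so for each fixed t the limit over the approximants is
  taken first, and the derivative at t = 1 afterwards.\<close>

lemma C_k_SucI:
  fixes f :: "'a::euclidean_space \<Rightarrow> real"
  assumes "\<And>x. (f has_derivative f' x) (at x)"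
    and "\<And>i. i \<in> Basis \<Longrightarrow> C_k k (\<lambda>x. f' x i)"
  shows "C_k (Suc k) f"
proof -
  have "frechet_derivative f (at x) = f' x" for x
    using frechet_derivative_at[OF assms(1)] by metis
  then show ?thesis
    using assms by (auto simp: differentiable_def)
qed

lemma C_k_Suc_has_derivative:
  assumes "C_k (Suc k) f"
  shows "(f has_derivative frechet_derivative f (at x)) (at x)"
  using assms frechet_derivative_works by auto

text \<open>The product and chain rules keep undifferentiated factors, whose order has to be
  lowered. The base case turns differentiability into continuity.\<close>

lemma C_k_lower: "C_k (Suc k) f \<Longrightarrow> C_k k f"
proof (induction k arbitrary: f)
  case 0
  then show ?case
    by (auto intro!: continuous_at_imp_continuous_on differentiable_imp_continuous_within)
next
  case (Suc k)
  then have "C_k k (\<lambda>x. frechet_derivative f (at x) i)" if "i \<in> Basis" for i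
    using that C_k.simps(2) by blast
  then show ?case
    using Suc.prems by simp
qed

lemma C_k_const: "C_k k (\<lambda>x. c)"
proof (induction k arbitrary: c)
  case (Suc k)
  then show ?case
    by (intro C_k_SucI[of _ "\<lambda>x h. 0"]) (auto intro!: derivative_eq_intros)
qed auto

lemma C_k_bounded_linear: "bounded_linear f \<Longrightarrow> C_k k f"
proof (cases k)
  case 0
  then show "bounded_linear f \<Longrightarrow> ?thesis"
    by (simp add: linear_continuous_on)
next
  case (Suc l)
  assume "bounded_linear f"
  then show ?thesis
    unfolding Suc by (intro C_k_SucI[of _ "\<lambda>x. f"]) (auto simp: bounded_linear_imp_has_derivative C_k_const)
qed

lemma C_k_add: "C_k k f \<Longrightarrow> C_k k g \<Longrightarrow> C_k k (\<lambda>x. f x + g x)"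
proof (induction k arbitrary: f g)
  case 0
  then show ?case
    by (auto intro: continuous_intros)
next
  case (Suc k)
  note f = C_k_Suc_has_derivative[OF Suc.prems(1)] and g = C_k_Suc_has_derivative[OF Suc.prems(2)]
  show ?case
    using Suc by (intro C_k_SucI[OF has_derivative_add[OF f g]]) auto
qed

lemma C_k_mult: "C_k k f \<Longrightarrow> C_k k g \<Longrightarrow> C_k k (\<lambda>x. f x * g x)"
proof (induction k arbitrary: f g)
  case 0
  then show ?case
    by (auto intro: continuous_intros)
next
  case (Suc k)
  note f = C_k_Suc_has_derivative[OF Suc.prems(1)] and g = C_k_Suc_has_derivative[OF Suc.prems(2)]
  have "C_k k f" "C_k k g"
    using Suc.prems C_k_lower by blast+
  then show ?case
    using Suc by (intro C_k_SucI[OF has_derivative_mult[OF f g]]) (auto intro!: C_k_add)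
qed

lemma C_k_diff: "C_k k f \<Longrightarrow> C_k k g \<Longrightarrow> C_k k (\<lambda>x. f x - g x)"
  using C_k_add[of k f "\<lambda>x. (- 1) * g x"] C_k_mult[of k "\<lambda>x. - 1" g] by (simp add: C_k_const)

lemma C_k_prod: "(\<And>i. i \<in> I \<Longrightarrow> C_k k (f i)) \<Longrightarrow> C_k k (\<lambda>x. \<Prod>i\<in>I. f i x)"
  by (induction I rule: infinite_finite_induct) (auto intro: C_k_mult C_k_const)

lemma C_k_sum: "(\<And>i. i \<in> I \<Longrightarrow> C_k k (f i)) \<Longrightarrow> C_k k (\<lambda>x. \<Sum>i\<in>I. f i x)"
  by (induction I rule: infinite_finite_induct) (auto intro: C_k_add C_k_const)

lemma C_k_compose:
  fixes F :: "real \<Rightarrow> real"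
  shows "C_k k F \<Longrightarrow> C_k k f \<Longrightarrow> C_k k (\<lambda>x. F (f x))"
proof (induction k arbitrary: F f)
  case 0
  then show ?case
    by (auto intro: continuous_on_compose2)
next
  case (Suc k)
  note f = C_k_Suc_has_derivative[OF Suc.prems(2)] and F = C_k_Suc_has_derivative[OF Suc.prems(1)]
  \<comment> \<open>A linear map of the reals is multiplication by its value at 1; this puts the
    chain rule into the product form that \<open>C_k_mult\<close> handles.\<close>
  have lin: "frechet_derivative F (at y) r = frechet_derivative F (at y) 1 * r" for y r
    using linear_cmul[OF has_derivative_linear[OF F], of y r 1] by simp
  have der: "((\<lambda>x. F (f x)) has_derivative
          (\<lambda>h. frechet_derivative F (at (f x)) 1 * frechet_derivative f (at x) h)) (at x)" for x
    using has_derivative_compose[OF f F, of x] by (simp only: lin[symmetric])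
  have "C_k k f"
    using Suc.prems C_k_lower by blast
  then show ?case
    using Suc by (intro C_k_SucI[OF der] C_k_mult) auto
qed

lemma C_k_scale:
  fixes f :: "'a::euclidean_space \<Rightarrow> real"
  shows "C_k k f \<Longrightarrow> C_k k (\<lambda>x. f (c *\<^sub>R x))"
proof (induction k arbitrary: f)
  case 0
  then show ?case
    by (auto intro!: continuous_on_compose2[of UNIV f] continuous_intros)
next
  case (Suc k)
  note f = C_k_Suc_has_derivative[OF Suc.prems(1)]
  have lin: "frechet_derivative f (at y) (c *\<^sub>R h) = c * frechet_derivative f (at y) h" for y h
    using linear_cmul[OF has_derivative_linear[OF f]] by simp
  have "((\<lambda>x. c *\<^sub>R x) has_derivative (\<lambda>h. c *\<^sub>R h)) (at x)" for x :: 'a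
    by (auto intro!: derivative_eq_intros)
  from has_derivative_compose[OF this f]
  have der: "((\<lambda>x. f (c *\<^sub>R x)) has_derivative (\<lambda>h. c * frechet_derivative f (at (c *\<^sub>R x)) h)) (at x)" for x
    by (simp only: lin)
  have "C_k k (\<lambda>x. frechet_derivative f (at (c *\<^sub>R x)) i)" if "i \<in> Basis" for i
    using Suc.IH[of "\<lambda>x. frechet_derivative f (at x) i"] Suc.prems that by simp
  then show ?case
    by (intro C_k_SucI[OF der] C_k_mult C_k_const)
qed

section \<open>Functions flat at the origin, bumps and a smooth step\<close>

definition flat_exp :: "real poly \<Rightarrow> real \<Rightarrow> real" where
  "flat_exp p t = (if t > 0 then poly p (1 / t) * exp (- 1 / t) else 0)"

lemma poly_times_exp_tendsto_0: "((\<lambda>s. poly p s * exp (- s)) \<longlongrightarrow> (0::real)) at_top"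
proof -
  have "((\<lambda>s. \<Sum>i\<le>degree p. coeff p i * (s ^ i / exp s)) \<longlongrightarrow> (0::real)) at_top"
    by (intro tendsto_null_sum tendsto_mult_right_zero tendsto_power_div_exp_0)
  then show ?thesis
    by (simp add: poly_altdef exp_minus sum_distrib_right divide_inverse mult.assoc)
qed

text \<open>With s = 1 / t this is the decay of a polynomial times exp (- s) at infinity.\<close>

lemma flat_exp_tendsto_0: "(flat_exp p \<longlongrightarrow> 0) (at 0)"
proof -
  have "LIM t at_right 0. inverse t :> (at_top :: real filter)"
    by (rule filterlim_inverse_at_top_right)
  from filterlim_compose[OF poly_times_exp_tendsto_0 this, of p]
  have *: "((\<lambda>t. poly p (inverse t) * exp (- inverse t)) \<longlongrightarrow> (0::real)) (at_right 0)" .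
  have "\<forall>\<^sub>F t in at_right 0. poly p (inverse t) * exp (- inverse t) = flat_exp p t"
    using eventually_at_right_less[of "0::real"]
    by eventually_elim (simp add: flat_exp_def divide_inverse)
  from Lim_transform_eventually[OF * this]
  have "(flat_exp p \<longlongrightarrow> 0) (at_right 0)" .
  moreover have "\<forall>\<^sub>F t in at_left 0. 0 = flat_exp p t"
    by (simp add: eventually_at_filter flat_exp_def)
  from Lim_transform_eventually[OF tendsto_const this]
  have "(flat_exp p \<longlongrightarrow> 0) (at_left 0)" .
  ultimately show ?thesis
    by (simp add: filterlim_split_at)
qed

text \<open>The family is closed under differentiation: with s = 1 / t the derivative of p(s) exp (-
  s) is s^2 (p - p')(s) exp (- s). Hence one induction over all polynomials at once gives
  smoothness, also at 0.\<close>

lemma flat_exp_has_derivative: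
  "(flat_exp p has_real_derivative flat_exp ([:0, 0, 1:] * (p - pderiv p)) t) (at t)"
proof -
  consider "t > 0" | "t < 0" | "t = 0" by linarith
  then show ?thesis
  proof cases
    case 1
    have "((\<lambda>t. poly p (1 / t) * exp (- 1 / t)) has_real_derivative
            flat_exp ([:0, 0, 1:] * (p - pderiv p)) t) (at t)"
      using 1 by (auto intro!: derivative_eq_intros poly_DERIV[THEN DERIV_chain2] simp: flat_exp_def field_simps power2_eq_square)
    then show ?thesis
      by (rule has_field_derivative_transform_within_open[where S = "{0<..}"]) (use 1 in \<open>auto simp: flat_exp_def\<close>)
  next
    case 2
    have "((\<lambda>t. 0) has_real_derivative flat_exp ([:0, 0, 1:] * (p - pderiv p)) t) (at t)"
      using 2 by (simp add: flat_exp_def)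
    then show ?thesis
      by (rule has_field_derivative_transform_within_open[where S = "{..<0}"]) (use 2 in \<open>auto simp: flat_exp_def\<close>)
  next
    case 3
    \<comment> \<open>At 0 the difference quotient stays in the family: dividing by s multiplies the
      polynomial by its variable.\<close>
    have "((\<lambda>s. (flat_exp p (0 + s) - flat_exp p 0) / s) \<longlongrightarrow> 0) (at 0)"
      by (rule Lim_transform_eventually[OF flat_exp_tendsto_0[of "[:0, 1:] * p"]])
        (auto simp: eventually_at_filter flat_exp_def)
    then show ?thesis
      using 3 by (simp add: DERIV_def flat_exp_def)
  qed
qed

lemma C_k_flat_exp: "C_k k (flat_exp p)"
proof (induction k arbitrary: p)
  case 0
  show ?case
    using DERIV_isCont[OF flat_exp_has_derivative] by (simp add: continuous_at_imp_continuous_on)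
next
  case (Suc k)
  show ?case
    using Suc by (intro C_k_SucI[OF flat_exp_has_derivative[unfolded has_field_derivative_def]]) auto
qed

abbreviation bump :: "real \<Rightarrow> real" where
  "bump \<equiv> flat_exp 1"

lemma bump_pos: "t > 0 \<Longrightarrow> bump t > 0"
  and bump_nonpos: "t \<le> 0 \<Longrightarrow> bump t = 0"
  and bump_nonneg: "bump t \<ge> 0"
  and bump_le_1: "bump t \<le> 1"
  by (auto simp: flat_exp_def)

lemma bump_scaled_tendsto_indicator:
  "(\<lambda>k. bump (real k * t)) \<longlonglongrightarrow> indicator {0<..} t"
proof (cases "t > 0")
  case True
  \<comment> \<open>The shift to \<open>Suc k\<close> avoids k = 0, where the value is
    \<open>bump 0 = 0\<close>.\<close>
  have "bump (real (Suc k) * t) = exp (- (1 / t) * inverse (real (Suc k)))" for k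
  proof -
    have "real (Suc k) * t > 0"
      using True by simp
    moreover have "- 1 / (real (Suc k) * t) = - (1 / t) * inverse (real (Suc k))"
      by (simp only: divide_inverse inverse_mult_distrib) simp
    ultimately show ?thesis
      by (simp only: flat_exp_def if_True poly_1 mult_1_left)
  qed
  moreover have "(\<lambda>k. exp (- (1 / t) * inverse (real (Suc k)))) \<longlonglongrightarrow> exp (- (1 / t) * 0)"
    by (intro tendsto_intros LIMSEQ_inverse_real_of_nat)
  ultimately have "(\<lambda>k. bump (real (Suc k) * t)) \<longlonglongrightarrow> 1"
    by simp
  then have "(\<lambda>k. bump (real k * t)) \<longlonglongrightarrow> 1"
    by (rule LIMSEQ_imp_Suc)
  then show ?thesis
    using True by simp
next
  case False
  then show ?thesis
    by (simp add: bump_nonpos mult_nonneg_nonpos)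
qed

text \<open>A primitive of a product of two bumps. It is normalized by slope at most 1 and not by
  height 1, because the slope is what the energy is charged for; the height is then some c > 0. The
  flat margins later give compact support in the open ball and constancy on a fixed smaller
  ball.\<close>

lemma smooth_step_exists:
  obtains \<sigma> \<sigma>' :: "real \<Rightarrow> real" and c where
    "\<And>k. C_k k \<sigma>" "\<And>t. t \<le> 1/4 \<Longrightarrow> \<sigma> t = 0" "\<And>t. t \<ge> 3/4 \<Longrightarrow> \<sigma> t = c"
    "c > 0" "\<And>t. \<sigma> t \<ge> 0" "\<And>t. (\<sigma> has_real_derivative \<sigma>' t) (at t)" "\<And>t. \<bar>\<sigma>' t\<bar> \<le> 1"
    "\<And>t. t \<notin> {1/4<..<3/4} \<Longrightarrow> \<sigma>' t = 0"
proof -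
  define b where "b t = bump (t - 1/4) * bump (3/4 - t)" for t :: real
  define \<sigma> where "\<sigma> t = integral {0..t} b" for t
  have Cb: "C_k k b" for k
    unfolding b_def by (intro C_k_mult C_k_compose[OF C_k_flat_exp] C_k_diff C_k_const C_k_bounded_linear bounded_linear_ident)
  have cont: "continuous_on S b" for S
    using Cb[of 0] continuous_on_subset by fastforce
  have int: "b integrable_on {s..t}" for s t
    using cont integrable_continuous_real by blast
  have b0: "b t = 0" if "t \<notin> {1/4<..<3/4}" for t
    using that by (auto simp: b_def bump_nonpos)
  have bnn: "b t \<ge> 0" for t
    by (simp add: b_def bump_nonneg)
  have b1: "\<bar>b t\<bar> \<le> 1" for t
    by (simp add: b_def abs_mult bump_nonneg bump_le_1 mult_le_one)
  have \<sigma>0: "\<sigma> t = 0" if "t \<le> 1/4" for t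
    using b0 that integral_cong[of "{0..t}" b "\<lambda>_. 0"] by (simp add: \<sigma>_def)
  have split: "\<sigma> t = \<sigma> s + integral {s..t} b" if "0 \<le> s" "s \<le> t" for s t
    unfolding \<sigma>_def using that int by (simp add: Henstock_Kurzweil_Integration.integral_combine)
  have der: "(\<sigma> has_real_derivative b t) (at t)" for t
  proof (cases "t > 0")
    case True
    have "(\<sigma> has_real_derivative b t) (at t within {0..t+1})"
      unfolding \<sigma>_def using True cont by (intro integral_has_real_derivative) auto
    moreover have "t \<in> interior {0..t+1}"
      using True by simp
    ultimately show ?thesis
      using at_within_interior by metis
  next
    case False
    have "((\<lambda>t. 0) has_real_derivative b t) (at t)"
      using False b0 by simp
    then show ?thesis
      by (rule has_field_derivative_transform_within_open[where S = "{..<1/4}"]) (use False \<sigma>0 in auto)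
  qed
  have "C_k k \<sigma>" for k
  proof -
    have "C_k (Suc k) \<sigma>"
      using Cb by (intro C_k_SucI[OF der[unfolded has_field_derivative_def]]) auto
    then show ?thesis
      by (rule C_k_lower)
  qed
  moreover have "\<sigma> t = \<sigma> (3/4)" if "t \<ge> 3/4" for t
    using split[of "3/4" t] that b0 integral_cong[of "{3/4..t}" b "\<lambda>_. 0"] by simp
  moreover have "\<sigma> (3/4) > 0"
  proof -
    \<comment> \<open>A continuous nonnegative function with integral 0 vanishes identically, but
      both factors of \<open>b\<close> are positive at 1/2.\<close>
    have "\<sigma> (3/4) \<noteq> 0"
    proof
      assume "\<sigma> (3/4) = 0"
      then have "(b has_integral 0) (cbox 0 (3/4))"
        using int by (simp add: \<sigma>_def has_integral_integrable_integral)
      then have "b (1/2) = 0"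
        using has_integral_0_cbox_imp_0[of 0 "3/4" b "1/2"] cont bnn by (auto simp: box_real)
      then show False
        using bump_pos[of "1/4"] by (simp add: b_def)
    qed
    moreover have "\<sigma> (3/4) \<ge> 0"
      unfolding \<sigma>_def by (simp add: Henstock_Kurzweil_Integration.integral_nonneg int bnn)
    ultimately show ?thesis by simp
  qed
  moreover have "\<sigma> t \<ge> 0" for t
    unfolding \<sigma>_def by (simp add: Henstock_Kurzweil_Integration.integral_nonneg int bnn)
  ultimately show thesis
    using that[of \<sigma> "\<sigma> (3/4)" b] \<sigma>0 der b1 b0 by blast
qed

subsection \<open>Gradients and test functions\<close>

definition grad :: "('a::euclidean_space \<Rightarrow> real) \<Rightarrow> 'a \<Rightarrow> 'a" where
  "grad f x = (\<Sum>i\<in>Basis. frechet_derivative f (at x) i *\<^sub>R i)"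

lemma grad_inner_Basis: "i \<in> Basis \<Longrightarrow> grad f x \<bullet> i = frechet_derivative f (at x) i"
  unfolding grad_def by (simp add: inner_sum_left_Basis)

lemma has_derivative_grad:
  assumes "f differentiable (at x)"
  shows "(f has_derivative (\<lambda>h. grad f x \<bullet> h)) (at x)"
proof -
  have f: "(f has_derivative frechet_derivative f (at x)) (at x)"
    using assms frechet_derivative_works by blast
  have "grad f x \<bullet> h = frechet_derivative f (at x) h" for h
  proof -
    have "frechet_derivative f (at x) (\<Sum>i\<in>Basis. (h \<bullet> i) *\<^sub>R i) = (\<Sum>i\<in>Basis. (h \<bullet> i) * frechet_derivative f (at x) i)"
      using has_derivative_linear[OF f] by (simp add: linear_sum linear_cmul)
    moreover have "grad f x \<bullet> h = (\<Sum>i\<in>Basis. (h \<bullet> i) * frechet_derivative f (at x) i)"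
      by (simp add: grad_def inner_sum_left inner_commute[of h] mult.commute)
    ultimately show ?thesis
      by (simp add: euclidean_representation)
  qed
  then show ?thesis
    using f by presburger
qed

lemma grad_eqI:
  assumes "(f has_derivative (\<lambda>h. v \<bullet> h)) (at x)"
  shows "grad f x = v"
proof -
  have "frechet_derivative f (at x) = (\<lambda>h. v \<bullet> h)"
    using frechet_derivative_at[OF assms] by simp
  then show ?thesis
    by (simp add: grad_def euclidean_representation)
qed

section \<open>Test functions\<close>

lemma test_functionsI:
  assumes "\<And>k. C_k k f" "compact S" "S \<subseteq> \<Omega>" "\<And>x. x \<notin> S \<Longrightarrow> f x = 0"
  shows "f \<in> test_functions \<Omega>"
proof -
  have "closure {x. f x \<noteq> 0} \<subseteq> S"
    using assms compact_imp_closed by (intro closure_minimal) auto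
  moreover from this have "compact (closure {x. f x \<noteq> 0})"
    using assms(2) by (meson bounded_subset closed_closure compact_eq_bounded_closed)
  ultimately show ?thesis
    using assms unfolding test_functions_def by blast
qed

lemma test_function_support:
  assumes "f \<in> test_functions \<Omega>"
  obtains S where "compact S" "S \<subseteq> \<Omega>" "\<And>x. x \<notin> S \<Longrightarrow> f x = 0" "\<And>x. x \<notin> S \<Longrightarrow> grad f x = 0"
proof -
  define S where "S = closure {x. f x \<noteq> 0}"
  have S: "compact S" "S \<subseteq> \<Omega>"
    using assms by (auto simp: test_functions_def S_def)
  have 0: "f x = 0" if "x \<notin> S" for x
    using that closure_subset[of "{x. f x \<noteq> 0}"] unfolding S_def by blast
  have "grad f x = 0" if "x \<notin> S" for x
  proof (rule grad_eqI)
    have "((\<lambda>x. 0) has_derivative (\<lambda>h. 0 \<bullet> h)) (at x)"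
      by simp
    moreover have "open (- S)" "x \<in> - S" "\<And>y. y \<in> - S \<Longrightarrow> 0 = f y"
      using that 0 S(1) by (simp_all add: compact_imp_closed open_Compl)
    ultimately show "(f has_derivative (\<lambda>h. 0 \<bullet> h)) (at x)"
      by (rule has_derivative_transform_within_open)
  qed
  then show thesis
    using that S 0 by blast
qed

lemma test_function_C_k: "f \<in> test_functions \<Omega> \<Longrightarrow> C_k k f"
  by (simp add: test_functions_def)

lemma test_function_differentiable: "f \<in> test_functions \<Omega> \<Longrightarrow> f differentiable (at x)"
  using test_function_C_k[of f \<Omega> 1] by simp

lemmas test_function_has_derivative = has_derivative_grad[OF test_function_differentiable]

lemma test_function_continuous: "f \<in> test_functions \<Omega> \<Longrightarrow> continuous_on S f"
  using test_function_C_k[of f \<Omega> 0] continuous_on_subset by fastforce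

lemma test_function_continuous_grad:
  assumes "f \<in> test_functions \<Omega>"
  shows "continuous_on S (grad f)"
proof -
  have "continuous_on UNIV (\<lambda>x. frechet_derivative f (at x) i)" if "i \<in> Basis" for i
    using test_function_C_k[OF assms, of "Suc 0"] that by simp
  then have "continuous_on UNIV (grad f)"
    unfolding grad_def[abs_def] by (intro continuous_intros) auto
  then show ?thesis
    using continuous_on_subset by blast
qed

lemma test_function_eq_0:
  assumes "f \<in> test_functions \<Omega>" "x \<notin> \<Omega>"
  shows "f x = 0" "grad f x = 0"
proof -
  obtain S where "S \<subseteq> \<Omega>" "\<And>x. x \<notin> S \<Longrightarrow> f x = 0" "\<And>x. x \<notin> S \<Longrightarrow> grad f x = 0"
    using test_function_support[OF assms(1)] by metis
  then show "f x = 0" "grad f x = 0"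
    using assms(2) by auto
qed

lemma compact_support_bounded:
  fixes f :: "'a::euclidean_space \<Rightarrow> 'b::euclidean_space"
  assumes "continuous_on UNIV f" "compact S" "\<And>x. x \<notin> S \<Longrightarrow> f x = 0"
  obtains C where "C \<ge> 0" "\<And>x. norm (f x) \<le> C"
proof -
  have "compact (f ` S)"
    using assms by (meson compact_continuous_image continuous_on_subset subset_UNIV)
  then obtain C where "\<And>x. x \<in> S \<Longrightarrow> norm (f x) \<le> C"
    using compact_imp_bounded bounded_iff by (metis imageI)
  then have "norm (f x) \<le> max C 0" for x
    using assms(3)[of x] by (cases "x \<in> S") (auto simp: le_max_iff_disj)
  then show ?thesis
    using that[of "max C 0"] by auto
qed

lemma test_function_bounded:
  assumes "f \<in> test_functions \<Omega>"
  obtains C where "C \<ge> 0" "\<And>x. \<bar>f x\<bar> \<le> C" "\<And>x. norm (grad f x) \<le> C"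
proof -
  obtain S where S: "compact S" "\<And>x. x \<notin> S \<Longrightarrow> f x = 0" "\<And>x. x \<notin> S \<Longrightarrow> grad f x = 0"
    using test_function_support[OF assms] by metis
  obtain C where C: "C \<ge> 0" "\<And>x. norm (f x) \<le> C"
    using compact_support_bounded[OF test_function_continuous[OF assms] S(1,2)] by blast
  obtain D where D: "D \<ge> 0" "\<And>x. norm (grad f x) \<le> D"
    using compact_support_bounded[OF test_function_continuous_grad[OF assms] S(1,3)] by blast
  show ?thesis
    using that[of "max C D"] C D by (auto simp: le_max_iff_disj)
qed

lemma test_functions_diff:
  assumes "f \<in> test_functions \<Omega>" "g \<in> test_functions \<Omega>"
  shows "(\<lambda>x. f x - g x) \<in> test_functions \<Omega>"
proof -
  obtain S where S: "compact S" "S \<subseteq> \<Omega>" "\<And>x. x \<notin> S \<Longrightarrow> f x = 0"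
    using test_function_support[OF assms(1)] by metis
  obtain T where T: "compact T" "T \<subseteq> \<Omega>" "\<And>x. x \<notin> T \<Longrightarrow> g x = 0"
    using test_function_support[OF assms(2)] by metis
  show ?thesis
  proof (rule test_functionsI[of _ "S \<union> T"])
    show "C_k k (\<lambda>x. f x - g x)" for k
      by (intro C_k_diff test_function_C_k[OF assms(1)] test_function_C_k[OF assms(2)])
  qed (use S T in auto)
qed

lemma test_functions_0: "(\<lambda>x. 0) \<in> test_functions \<Omega>"
  by (intro test_functionsI[of _ "{}"] C_k_const) auto

lemma test_functions_add:
  assumes "f \<in> test_functions \<Omega>" "g \<in> test_functions \<Omega>"
  shows "(\<lambda>x. f x + g x) \<in> test_functions \<Omega>"
  using test_functions_diff[OF assms(1) test_functions_diff[OF test_functions_0 assms(2)]] by simp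

lemma test_functions_mult:
  assumes "f \<in> test_functions \<Omega>" "g \<in> test_functions \<Omega>"
  shows "(\<lambda>x. f x * g x) \<in> test_functions \<Omega>"
proof -
  obtain S where S: "compact S" "S \<subseteq> \<Omega>" "\<And>x. x \<notin> S \<Longrightarrow> f x = 0"
    using test_function_support[OF assms(1)] by metis
  show ?thesis
  proof (rule test_functionsI[of _ S])
    show "C_k k (\<lambda>x. f x * g x)" for k
      by (intro C_k_mult test_function_C_k[OF assms(1)] test_function_C_k[OF assms(2)])
  qed (use S in auto)
qed

text \<open>The support shrinks from S to S / c, which stays in the ball as the ball is star-shaped
  about 0.\<close>

lemma test_functions_dilate:
  fixes f :: "'a::euclidean_space \<Rightarrow> real"
  assumes "f \<in> test_functions (ball 0 1)" "c \<ge> 1"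
  shows "(\<lambda>x. f (c *\<^sub>R x)) \<in> test_functions (ball 0 1)"
proof -
  obtain S where S: "compact S" "S \<subseteq> ball 0 1" "\<And>x. x \<notin> S \<Longrightarrow> f x = 0"
    using test_function_support[OF assms(1)] by metis
  show ?thesis
  proof (rule test_functionsI[of _ "(\<lambda>x. x /\<^sub>R c) ` S"])
    show "C_k k (\<lambda>x. f (c *\<^sub>R x))" for k
      by (intro C_k_scale test_function_C_k[OF assms(1)])
    show "compact ((\<lambda>x. x /\<^sub>R c) ` S)"
      using S(1) by (rule compact_scaling)
    show "(\<lambda>x. x /\<^sub>R c) ` S \<subseteq> ball 0 1"
      using S(2) assms(2) by (force simp: field_simps)
    show "f (c *\<^sub>R x) = 0" if "x \<notin> (\<lambda>x. x /\<^sub>R c) ` S" for x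
    proof (rule S(3))
      show "c *\<^sub>R x \<notin> S"
        using that assms(2) by (auto simp: image_iff)
    qed
  qed
qed

lemma grad_add:
  assumes "f differentiable (at x)" "g differentiable (at x)"
  shows "grad (\<lambda>x. f x + g x) x = grad f x + grad g x"
  using has_derivative_add[OF has_derivative_grad[OF assms(1)] has_derivative_grad[OF assms(2)]]
  by (intro grad_eqI) (simp add: inner_add_left)

lemma grad_dilate:
  assumes "f differentiable (at (c *\<^sub>R x))"
  shows "grad (\<lambda>x. f (c *\<^sub>R x)) x = c *\<^sub>R grad f (c *\<^sub>R x)"
proof (rule grad_eqI)
  have "((\<lambda>x. c *\<^sub>R x) has_derivative (\<lambda>h. c *\<^sub>R h)) (at x)"
    by (auto intro!: derivative_eq_intros)
  from has_derivative_compose[OF this has_derivative_grad[OF assms]]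
  show "((\<lambda>x. f (c *\<^sub>R x)) has_derivative (\<lambda>h. (c *\<^sub>R grad f (c *\<^sub>R x)) \<bullet> h)) (at x)"
    by simp
qed

subsection \<open>Integration\<close>

text \<open>The mean value inequality bounds every difference quotient by \<open>B\<close>, so
  dominated convergence applies along each sequence tending to \<open>t0\<close>.\<close>

lemma has_derivative_integral_dominated:
  fixes f :: "real \<Rightarrow> 'b \<Rightarrow> real"
  assumes t0: "t0 \<in> {a<..<b}"
    and int: "\<And>t. t \<in> {a<..<b} \<Longrightarrow> integrable M (f t)"
    and der: "\<And>x t. x \<in> space M \<Longrightarrow> t \<in> {a<..<b} \<Longrightarrow> ((\<lambda>t. f t x) has_real_derivative f' t x) (at t)"
    and bound: "\<And>x t. x \<in> space M \<Longrightarrow> t \<in> {a<..<b} \<Longrightarrow> \<bar>f' t x\<bar> \<le> B x"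
    and B: "integrable M B"
  shows "((\<lambda>t. \<integral>x. f t x \<partial>M) has_real_derivative (\<integral>x. f' t0 x \<partial>M)) (at t0)"
proof -
  have lip: "\<bar>f t x - f t0 x\<bar> \<le> B x * \<bar>t - t0\<bar>" if "x \<in> space M" "t \<in> {a<..<b}" for t x
    using field_differentiable_bound[of "{a<..<b}" "\<lambda>t. f t x" "\<lambda>t. f' t x" "B x" t t0]
      der bound that t0 by (auto intro: has_field_derivative_at_within)
  have "((\<lambda>t. ((\<integral>x. f t x \<partial>M) - (\<integral>x. f t0 x \<partial>M)) / (t - t0)) \<longlongrightarrow> (\<integral>x. f' t0 x \<partial>M)) (at t0 within {a<..<b})"
    unfolding tendsto_at_iff_sequentially comp_def
  proof (intro allI impI)
    fix X :: "nat \<Rightarrow> real"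
    assume X: "\<forall>i. X i \<in> {a<..<b} - {t0}" and lim: "X \<longlonglongrightarrow> t0"
    let ?q = "\<lambda>i x. (f (X i) x - f t0 x) / (X i - t0)"
    have q_lim: "(\<lambda>i. ?q i x) \<longlonglongrightarrow> f' t0 x" if "x \<in> space M" for x
    proof -
      have "((\<lambda>t. (f t x - f t0 x) / (t - t0)) \<longlongrightarrow> f' t0 x) (at t0)"
        using der[OF that t0] by (simp add: has_field_derivative_iff)
      then show ?thesis
        using X lim unfolding tendsto_at_iff_sequentially comp_def by blast
    qed
    have q_meas: "?q i \<in> borel_measurable M" for i
      using int[of "X i"] int[OF t0] X by (intro borel_measurable_divide borel_measurable_diff) auto
    have "(\<lambda>i. \<integral>x. ?q i x \<partial>M) \<longlonglongrightarrow> (\<integral>x. f' t0 x \<partial>M)"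
    proof (rule integral_dominated_convergence[OF _ q_meas B])
      show "f' t0 \<in> borel_measurable M"
        by (rule borel_measurable_LIMSEQ_real[OF q_lim q_meas])
      show "AE x in M. (\<lambda>i. ?q i x) \<longlonglongrightarrow> f' t0 x"
        using q_lim by simp
      show "AE x in M. norm (?q i x) \<le> B x" for i
        using lip[of _ "X i"] X by (intro AE_I2) (auto simp: abs_divide divide_le_eq)
    qed
    moreover have "(\<integral>x. ?q i x \<partial>M) = ((\<integral>x. f (X i) x \<partial>M) - (\<integral>x. f t0 x \<partial>M)) / (X i - t0)" for i
    proof -
      have "integrable M (f (X i))"
        using X int by blast
      then show ?thesis
        by (simp only: integral_divide_zero Bochner_Integration.integral_diff int[OF t0])
    qed
    ultimately show "(\<lambda>i. ((\<integral>x. f (X i) x \<partial>M) - (\<integral>x. f t0 x \<partial>M)) / (X i - t0)) \<longlonglongrightarrow> (\<integral>x. f' t0 x \<partial>M)"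
      by (simp only:)
  qed
  then show ?thesis
    using t0 at_within_open[of t0 "{a<..<b}"] by (simp add: has_field_derivative_iff)
qed

section \<open>Change of variables under translations and dilations\<close>

lemma lebesgue_eq_density_affine:
  fixes t :: "'a::euclidean_space"
  assumes "c > 0"
  shows "lebesgue = density (distr lebesgue lebesgue (\<lambda>x. t + c *\<^sub>R x)) (\<lambda>_. ennreal (c ^ DIM('a)))"
    and "(\<lambda>x. t + c *\<^sub>R x) \<in> lebesgue \<rightarrow>\<^sub>M lebesgue"
proof -
  have *: "(\<Sum>j\<in>Basis. (c * (x \<bullet> j)) *\<^sub>R j) = c *\<^sub>R x" for x :: 'a
    by (metis (no_types, lifting) euclidean_representation inner_scaleR_left sum.cong)
  show "lebesgue = density (distr lebesgue lebesgue (\<lambda>x. t + c *\<^sub>R x)) (\<lambda>_. ennreal (c ^ DIM('a)))"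
    using lebesgue_affine_euclidean[of "\<lambda>_. c" t] assms by (simp add: *)
  show "(\<lambda>x. t + c *\<^sub>R x) \<in> lebesgue \<rightarrow>\<^sub>M lebesgue"
    using lebesgue_affine_measurable[of "\<lambda>_. c" t] assms by (simp add: *)
qed

lemma lebesgue_integral_affine:
  fixes t :: "'a::euclidean_space" and f :: "'a \<Rightarrow> real"
  assumes f: "integrable lebesgue f" and c: "c > 0"
  shows "integrable lebesgue (\<lambda>x. f (t + c *\<^sub>R x))"
    and "(\<integral>x. f (t + c *\<^sub>R x) \<partial>lebesgue) = (\<integral>x. f x \<partial>lebesgue) / c ^ DIM('a)"
proof -
  have [measurable]: "f \<in> borel_measurable lebesgue"
    using f by simp
  let ?T = "\<lambda>x. t + c *\<^sub>R x"
  note T[measurable] = lebesgue_eq_density_affine(2)[OF c, of t]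
  let ?D = "density (distr lebesgue lebesgue ?T) (\<lambda>_. ennreal (c ^ DIM('a)))"
  have D: "lebesgue = ?D"
    by (rule lebesgue_eq_density_affine(1)[OF c])
  have "integrable ?D f"
    using f D by simp
  then have 1: "integrable (distr lebesgue lebesgue ?T) (\<lambda>x. c ^ DIM('a) *\<^sub>R f x)"
    using c by (subst (asm) integrable_density) auto
  then have "integrable lebesgue (\<lambda>x. c ^ DIM('a) *\<^sub>R f (?T x))"
    by (rule integrable_distr[OF T])
  then show "integrable lebesgue (\<lambda>x. f (?T x))"
    using c by simp
  have "(\<integral>x. f x \<partial>lebesgue) = (\<integral>x. f x \<partial>?D)"
    using D by simp
  also have "\<dots> = (\<integral>x. c ^ DIM('a) *\<^sub>R f x \<partial>distr lebesgue lebesgue ?T)"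
    using c by (intro integral_density) auto
  also have "\<dots> = (\<integral>x. c ^ DIM('a) *\<^sub>R f (?T x) \<partial>lebesgue)"
    by (rule integral_distr) auto
  finally show "(\<integral>x. f (?T x) \<partial>lebesgue) = (\<integral>x. f x \<partial>lebesgue) / c ^ DIM('a)"
    using c by (simp add: field_simps)
qed

lemma lebesgue_integral_dilate:
  fixes f :: "'a::euclidean_space \<Rightarrow> real"
  assumes "integrable lebesgue f" "c > 0"
  shows "integrable lebesgue (\<lambda>x. f (c *\<^sub>R x))"
    and "(\<integral>x. f (c *\<^sub>R x) \<partial>lebesgue) = (\<integral>x. f x \<partial>lebesgue) / c ^ DIM('a)"
  using lebesgue_integral_affine[OF assms, of 0] by simp_all

text \<open>With functions extended by 0 all integrals can be taken over the whole space, on which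
  translations and dilations act.\<close>

lemma lint_lebesgue_on:
  fixes f :: "'a::euclidean_space \<Rightarrow> real"
  assumes "\<Omega> \<in> sets lebesgue" "\<And>x. x \<notin> \<Omega> \<Longrightarrow> f x = 0"
  shows "(LINT x|lebesgue_on \<Omega>. f x) = (LINT x|lebesgue. f x)"
    and "integrable (lebesgue_on \<Omega>) f \<longleftrightarrow> integrable lebesgue f"
proof -
  have "(\<lambda>x. indicator \<Omega> x *\<^sub>R f x) = f"
    using assms(2) by (fastforce simp: indicator_def)
  then show "(LINT x|lebesgue_on \<Omega>. f x) = (LINT x|lebesgue. f x)"
    "integrable (lebesgue_on \<Omega>) f \<longleftrightarrow> integrable lebesgue f"
    using assms(1) integral_restrict_space[of \<Omega> lebesgue f] integrable_restrict_space[of \<Omega> lebesgue f] by auto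
qed

lemma integrable_bounded_compact_support:
  fixes f :: "'a::euclidean_space \<Rightarrow> real"
  assumes "f \<in> borel_measurable lebesgue" "\<And>x. \<bar>f x\<bar> \<le> C" "compact S" "\<And>x. x \<notin> S \<Longrightarrow> f x = 0"
  shows "integrable lebesgue f"
proof (rule integrableI_bounded_set[of S _ _ C])
  show "S \<in> sets lebesgue" "emeasure lebesgue S < \<infinity>"
    using lmeasurable_compact[OF assms(3)] unfolding fmeasurable_def infinity_ennreal_def by blast+
qed (use assms in auto)

lemma continuous_imp_lebesgue_measurable:
  fixes f :: "'a::euclidean_space \<Rightarrow> 'b::euclidean_space"
  shows "continuous_on UNIV f \<Longrightarrow> f \<in> borel_measurable lebesgue"
  by (intro measurable_completion) (simp add: borel_measurable_continuous_onI)

text \<open>The integral of f(x + t v) does not depend on t by translation invariance, and its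
  derivative at t = 0 is the integral in question.\<close>

lemma integral_partial_derivative_eq_0:
  fixes f :: "'a::euclidean_space \<Rightarrow> real"
  assumes f: "f \<in> test_functions UNIV"
  shows "(\<integral>x. grad f x \<bullet> v \<partial>lebesgue) = 0"
proof -
  obtain S where S: "compact S" "\<And>x. x \<notin> S \<Longrightarrow> f x = 0" "\<And>x. x \<notin> S \<Longrightarrow> grad f x = 0"
    using test_function_support[OF f] by metis
  obtain C where C: "C \<ge> 0" "\<And>x. \<bar>f x\<bar> \<le> C" "\<And>x. norm (grad f x) \<le> C"
    using test_function_bounded[OF f] by metis
  \<comment> \<open>\<open>T\<close> is the support swept along v for parameters in [-1, 1]; it
    carries one dominating function for all t in the interval.\<close>
  define T where "T = (\<lambda>(s, t). s - t *\<^sub>R v) ` (S \<times> {-1..1})"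
  have T: "compact T"
    unfolding T_def using S(1)
    by (intro compact_continuous_image compact_Times) (auto intro!: continuous_intros simp: case_prod_beta)
  have T0: "grad f (x + t *\<^sub>R v) = 0" if "x \<notin> T" "t \<in> {-1<..<1}" for x t
  proof (rule S(3), rule notI)
    assume "x + t *\<^sub>R v \<in> S"
    then have "x \<in> T"
      unfolding T_def using that(2) by (intro image_eqI[of _ _ "(x + t *\<^sub>R v, t)"]) auto
    then show False
      using that(1) by simp
  qed
  have meas: "f \<in> borel_measurable lebesgue"
    by (intro continuous_imp_lebesgue_measurable test_function_continuous[OF f])
  have int: "integrable lebesgue f"
    by (rule integrable_bounded_compact_support[OF meas C(2) S(1,2)])
  have tr: "integrable lebesgue (\<lambda>x. f (x + t *\<^sub>R v))" "(\<integral>x. f (x + t *\<^sub>R v) \<partial>lebesgue) = (\<integral>x. f x \<partial>lebesgue)" for t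
    using lebesgue_integral_affine[OF int, of 1 "t *\<^sub>R v"] by (simp_all add: add.commute)
  have "((\<lambda>t. \<integral>x. f (x + t *\<^sub>R v) \<partial>lebesgue) has_real_derivative (\<integral>x. grad f (x + 0 *\<^sub>R v) \<bullet> v \<partial>lebesgue)) (at 0)"
  proof (rule has_derivative_integral_dominated[where a = "-1" and b = 1 and B = "\<lambda>x. indicator T x * (C * norm v)"])
    show "((\<lambda>t. f (x + t *\<^sub>R v)) has_real_derivative grad f (x + t *\<^sub>R v) \<bullet> v) (at t)" for x t
    proof -
      have "((\<lambda>t. x + t *\<^sub>R v) has_derivative (\<lambda>h. h *\<^sub>R v)) (at t)"
        by (auto intro!: derivative_eq_intros)
      from has_derivative_compose[OF this test_function_has_derivative[OF f]]
      show ?thesis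
        by (simp add: has_field_derivative_def mult_commute_abs)
    qed
    show "\<bar>grad f (x + t *\<^sub>R v) \<bullet> v\<bar> \<le> indicator T x * (C * norm v)" if "t \<in> {-1<..<1}" for x t
    proof (cases "x \<in> T")
      case True
      have "\<bar>grad f (x + t *\<^sub>R v) \<bullet> v\<bar> \<le> norm (grad f (x + t *\<^sub>R v)) * norm v"
        by (rule Cauchy_Schwarz_ineq2)
      also have "\<dots> \<le> C * norm v"
        by (intro mult_right_mono C(3)) simp
      finally show ?thesis
        using True by simp
    qed (use T0 that in simp)
    have [measurable]: "T \<in> sets lebesgue"
      using T by (simp add: lmeasurable_compact fmeasurableD)
    show "integrable lebesgue (\<lambda>x. indicator T x * (C * norm v))"
      using T by (intro integrable_bounded_compact_support[of _ "C * norm v" T])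
        (auto simp: C(1) split: split_indicator)
  qed (use tr in auto)
  then have "((\<lambda>t::real. \<integral>x. f x \<partial>lebesgue) has_real_derivative (\<integral>x. grad f x \<bullet> v \<partial>lebesgue)) (at 0)"
    by (simp only: tr(2)) simp
  then show ?thesis
    using DERIV_unique DERIV_const by blast
qed

subsection \<open>Weak gradients\<close>

lemma integrable_mult_compact_support:
  fixes f \<phi> :: "'a::euclidean_space \<Rightarrow> real"
  assumes f: "locally_integrable \<Omega> f" and \<phi>: "continuous_on UNIV \<phi>"
    and S: "compact S" "S \<subseteq> \<Omega>" "\<And>x. x \<notin> S \<Longrightarrow> \<phi> x = 0"
  shows "integrable lebesgue (\<lambda>x. f x * \<phi> x)"
proof -
  obtain C where C: "C \<ge> 0" "\<And>x. norm (\<phi> x) \<le> C"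
    using compact_support_bounded[OF \<phi> S(1,3)] by blast
  have int: "integrable lebesgue (\<lambda>x. indicator S x *\<^sub>R f x)"
    using f S(1,2) by (simp add: locally_integrable_def set_integrable_def)
  have [measurable]: "\<phi> \<in> borel_measurable lebesgue"
    by (rule continuous_imp_lebesgue_measurable[OF \<phi>])
  have "integrable lebesgue (\<lambda>x. indicator S x *\<^sub>R f x * \<phi> x)"
  proof (rule Bochner_Integration.integrable_bound)
    show "integrable lebesgue (\<lambda>x. C * (indicator S x *\<^sub>R f x))"
      using int by (intro integrable_mult_right)
    show "(\<lambda>x. indicator S x *\<^sub>R f x * \<phi> x) \<in> borel_measurable lebesgue"
      using int by (intro borel_measurable_times) auto
    show "AE x in lebesgue. norm (indicator S x *\<^sub>R f x * \<phi> x) \<le> norm (C * (indicator S x *\<^sub>R f x))"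
      using C by (intro AE_I2) (auto simp: abs_mult mult.commute[of C] intro!: mult_left_mono)
  qed
  moreover have "(\<lambda>x. indicator S x *\<^sub>R f x * \<phi> x) = (\<lambda>x. f x * \<phi> x)"
    using S(3) by (fastforce simp: indicator_def)
  ultimately show ?thesis
    by simp
qed

lemma integrable_mult_test_function:
  fixes f \<phi> :: "'a::euclidean_space \<Rightarrow> real"
  assumes "locally_integrable \<Omega> f" "\<phi> \<in> test_functions \<Omega>"
  shows "integrable lebesgue (\<lambda>x. f x * \<phi> x)"
    and "i \<in> Basis \<Longrightarrow> integrable lebesgue (\<lambda>x. f x * frechet_derivative \<phi> (at x) i)"
proof -
  obtain S where S: "compact S" "S \<subseteq> \<Omega>" "\<And>x. x \<notin> S \<Longrightarrow> \<phi> x = 0" "\<And>x. x \<notin> S \<Longrightarrow> grad \<phi> x = 0"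
    using test_function_support[OF assms(2)] by metis
  show "integrable lebesgue (\<lambda>x. f x * \<phi> x)"
    by (rule integrable_mult_compact_support[OF assms(1) test_function_continuous[OF assms(2)] S(1-3)])
  assume i: "i \<in> Basis"
  have "continuous_on UNIV (\<lambda>x. grad \<phi> x \<bullet> i)"
    by (intro continuous_intros test_function_continuous_grad[OF assms(2)])
  then have "integrable lebesgue (\<lambda>x. f x * (grad \<phi> x \<bullet> i))"
    by (rule integrable_mult_compact_support[OF assms(1) _ S(1,2)]) (simp add: S(4))
  then show "integrable lebesgue (\<lambda>x. f x * frechet_derivative \<phi> (at x) i)"
    using i by (simp add: grad_inner_Basis)
qed

text \<open>Products of bumps in the coordinates converge to the indicator of a box.\<close>

lemma integral_box_eq_0:
  fixes f :: "'a::euclidean_space \<Rightarrow> real"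
  assumes f: "locally_integrable \<Omega> f" and box: "cbox a b \<subseteq> \<Omega>"
    and 0: "\<And>\<phi>. \<phi> \<in> test_functions \<Omega> \<Longrightarrow> (\<integral>x. f x * \<phi> x \<partial>lebesgue) = 0"
  shows "integral (cbox a b) f = 0"
proof -
  define \<phi> where "\<phi> k x = (\<Prod>i\<in>Basis. bump (real k * ((x - a) \<bullet> i)) * bump (real k * ((b - x) \<bullet> i)))"
    for k :: nat and x
  have abs: "f absolutely_integrable_on cbox a b"
    using f box by (auto simp: locally_integrable_def)
  then have int: "integrable lebesgue (\<lambda>x. indicator (cbox a b) x *\<^sub>R f x)"
    by (simp add: set_integrable_def)
  have out: "\<phi> k x = 0" if "x \<notin> cbox a b" for k x
  proof -
    obtain i where i: "i \<in> Basis" "(x - a) \<bullet> i < 0 \<or> (b - x) \<bullet> i < 0"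
      using \<open>x \<notin> cbox a b\<close> by (auto simp: mem_box inner_diff_left not_le)
    then have "bump (real k * ((x - a) \<bullet> i)) * bump (real k * ((b - x) \<bullet> i)) = 0"
      by (auto intro!: bump_nonpos mult_nonneg_nonpos)
    then show ?thesis
      using i(1) unfolding \<phi>_def by (intro prod_zero) auto
  qed
  have smooth: "C_k m (\<phi> k)" for m k
  proof -
    have "C_k m (\<lambda>x. (x - a) \<bullet> i)" "C_k m (\<lambda>x. (b - x) \<bullet> i)" for i
      by (simp_all only: inner_diff_left)
        (intro C_k_diff C_k_const C_k_bounded_linear bounded_linear_inner_left)+
    then show ?thesis
      unfolding \<phi>_def by (intro C_k_prod C_k_mult C_k_compose[OF C_k_flat_exp] C_k_const) auto
  qed
  have test: "\<phi> k \<in> test_functions \<Omega>" for k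
    by (rule test_functionsI[of _ "cbox a b"]) (use smooth out box in auto)
  have \<phi>01: "0 \<le> \<phi> k x" "\<phi> k x \<le> 1" for k x
    unfolding \<phi>_def by (auto intro!: prod_nonneg prod_le_1 mult_le_one simp: bump_nonneg bump_le_1)
  have lim: "(\<lambda>k. \<phi> k x) \<longlonglongrightarrow> indicator (box a b) x" for x
  proof -
    have "(\<lambda>k. \<phi> k x) \<longlonglongrightarrow> (\<Prod>i\<in>Basis. indicator {0<..} ((x - a) \<bullet> i) * indicator {0<..} ((b - x) \<bullet> i))"
      unfolding \<phi>_def by (intro tendsto_prod tendsto_mult bump_scaled_tendsto_indicator)
    also have "(\<Prod>i\<in>Basis. indicator {0<..} ((x - a) \<bullet> i) * indicator {0<..} ((b - x) \<bullet> i)) = (indicator (box a b) x :: real)"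
    proof (cases "x \<in> box a b")
      case True
      then show ?thesis
        by (auto simp: mem_box inner_diff_left intro!: prod.neutral)
    next
      case False
      then obtain i where "i \<in> Basis" "\<not> (0 < (x - a) \<bullet> i \<and> 0 < (b - x) \<bullet> i)"
        by (auto simp: mem_box inner_diff_left)
      then have "\<exists>i\<in>Basis. indicator {0<..} ((x - a) \<bullet> i) * indicator {0<..} ((b - x) \<bullet> i) = (0::real)"
        by (intro bexI[of _ i]) (auto simp: indicator_def)
      then have "(\<Prod>i\<in>Basis. indicator {0<..} ((x - a) \<bullet> i) * indicator {0<..} ((b - x) \<bullet> i)) = (0::real)"
        by (intro prod_zero) auto
      then show ?thesis
        using False by simp
    qed
    finally show ?thesis .
  qed
  have "(\<lambda>k. \<integral>x. f x * \<phi> k x \<partial>lebesgue) \<longlonglongrightarrow> (\<integral>x. indicator (box a b) x *\<^sub>R f x \<partial>lebesgue)"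
  proof (rule integral_dominated_convergence[where w = "\<lambda>x. norm (indicator (cbox a b) x *\<^sub>R f x)"])
    have "set_integrable lebesgue (box a b) f"
      using abs by (rule set_integrable_subset) (auto simp: box_subset_cbox)
    then show "(\<lambda>x. indicator (box a b) x *\<^sub>R f x) \<in> borel_measurable lebesgue"
      unfolding set_integrable_def by blast
    show "(\<lambda>x. f x * \<phi> k x) \<in> borel_measurable lebesgue" for k
      using integrable_mult_test_function(1)[OF f test[of k]] by blast
    show "AE x in lebesgue. (\<lambda>k. f x * \<phi> k x) \<longlonglongrightarrow> indicator (box a b) x *\<^sub>R f x"
      using tendsto_mult[OF tendsto_const lim] by (simp add: mult.commute)
    show "AE x in lebesgue. norm (f x * \<phi> k x) \<le> norm (indicator (cbox a b) x *\<^sub>R f x)" for k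
    proof (rule AE_I2)
      fix x
      show "norm (f x * \<phi> k x) \<le> norm (indicator (cbox a b) x *\<^sub>R f x)"
      proof (cases "x \<in> cbox a b")
        case True
        then show ?thesis
          using mult_left_mono[OF \<phi>01(2)[of k x] abs_ge_zero[of "f x"]] \<phi>01(1)[of k x] by (simp add: abs_mult)
      qed (simp add: out)
    qed
    show "integrable lebesgue (\<lambda>x. norm (indicator (cbox a b) x *\<^sub>R f x))"
      using int by (rule integrable_norm)
  qed
  then have "(LINT x:box a b|lebesgue. f x) = 0"
    using 0[OF test] by (simp add: set_lebesgue_integral_def LIMSEQ_const_iff)
  \<comment> \<open>The faces, on which the bumps vanish, form a null set, so the open box can be
    exchanged for the closed one.\<close>
  moreover have "(LINT x:box a b|lebesgue. f x) = integral (box a b) f"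
    by (rule set_lebesgue_integral_eq_integral(2), rule set_integrable_subset[OF abs])
      (auto simp: box_subset_cbox)
  ultimately show ?thesis
    by (simp add: integral_open_interval)
qed

text \<open>By Lebesgue's differentiation theorem f is almost everywhere the limit of its averages
  over cubes shrinking to the point, and \<open>integral_box_eq_0\<close> makes all these averages
  0.\<close>

lemma du_Bois_Reymond:
  fixes f :: "'a::euclidean_space \<Rightarrow> real"
  assumes \<Omega>: "open \<Omega>" and f: "locally_integrable \<Omega> f"
    and 0: "\<And>\<phi>. \<phi> \<in> test_functions \<Omega> \<Longrightarrow> (\<integral>x. f x * \<phi> x \<partial>lebesgue) = 0"
  shows "negligible {x \<in> \<Omega>. f x \<noteq> 0}"
proof (subst locally_negligible_alt, clarify)
  fix c assume c: "c \<in> \<Omega>" "f c \<noteq> 0"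
  then obtain r where r: "r > 0" "cball c r \<subseteq> \<Omega>"
    using \<Omega> open_contains_cball by blast
  \<comment> \<open>The differentiation theorem asks for integrability on every box; cutting f off
    at a closed ball inside \<Omega> provides it, and the claim is local.\<close>
  define g where "g x = (if x \<in> cball c r then f x else 0)" for x
  have "f absolutely_integrable_on cball c r"
    using f r by (auto simp: locally_integrable_def)
  then have "f integrable_on cball c r"
    using set_lebesgue_integral_eq_integral(1) by blast
  then have "g integrable_on UNIV"
    unfolding g_def[abs_def] by (simp only: integrable_restrict_UNIV)
  then have "g integrable_on cbox a b" for a b
    by (rule integrable_on_subcbox) simp
  then obtain N where N: "negligible N"
    "\<And>x e. x \<notin> N \<Longrightarrow> 0 < e \<Longrightarrow> \<exists>d>0. \<forall>h. 0 < h \<and> h < d \<longrightarrow>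
       norm (integral (cbox x (x + h *\<^sub>R One)) g /\<^sub>R h ^ DIM('a) - g x) < e"
    using integrable_ccontinuous_explicit[of g] by blast
  have "f x = 0" if x: "x \<in> ball c r" "x \<notin> N" for x
  proof (rule ccontr)
    assume fx: "f x \<noteq> 0"
    obtain d where d: "d > 0" "\<And>h. 0 < h \<Longrightarrow> h < d \<Longrightarrow>
        norm (integral (cbox x (x + h *\<^sub>R One)) g /\<^sub>R h ^ DIM('a) - g x) < \<bar>f x\<bar>"
      using N(2)[OF x(2), of "\<bar>f x\<bar>"] fx by auto
    have pos: "r - dist c x > 0"
      using x(1) by simp
    \<comment> \<open>The second bound keeps the cube inside the ball: its points differ from x by
      at most n h in the l1 norm, hence in the Euclidean norm.\<close>
    define h where "h = min (d / 2) ((r - dist c x) / DIM('a))"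
    have h: "0 < h" "h < d"
      using d(1) pos by (auto simp: h_def)
    have "h \<le> (r - dist c x) / DIM('a)"
      by (simp add: h_def)
    then have hr: "DIM('a) * h \<le> r - dist c x"
      by (simp add: field_simps)
    have sub: "cbox x (x + h *\<^sub>R One) \<subseteq> cball c r"
    proof
      fix y assume y: "y \<in> cbox x (x + h *\<^sub>R One)"
      have "norm (y - x) \<le> (\<Sum>i\<in>Basis. \<bar>(y - x) \<bullet> i\<bar>)"
        by (rule norm_le_l1)
      also have "\<dots> \<le> (\<Sum>i\<in>(Basis::'a set). h)"
        using y by (intro sum_mono) (auto simp: mem_box inner_diff_left inner_add_left)
      finally have "dist x y \<le> r - dist c x"
        using hr by (simp add: dist_norm norm_minus_commute)
      then show "y \<in> cball c r"
        using dist_triangle[of c y x] by simp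
    qed
    have "integral (cbox x (x + h *\<^sub>R One)) g = integral (cbox x (x + h *\<^sub>R One)) f"
      using sub by (intro integral_cong) (auto simp: g_def)
    also have "\<dots> = 0"
      using integral_box_eq_0[OF f _ 0] sub r(2) by blast
    finally show False
      using d(2)[OF h(1,2)] x(1) by (simp add: g_def)
  qed
  then have "{x \<in> \<Omega>. f x \<noteq> 0} \<inter> ball c r \<subseteq> N"
    by blast
  then show "\<exists>U. openin (top_of_set {x \<in> \<Omega>. f x \<noteq> 0}) U \<and> c \<in> U \<and> negligible U"
    using c r N(1) by (intro exI[of _ "{x \<in> \<Omega>. f x \<noteq> 0} \<inter> ball c r"])
      (auto intro: negligible_subset openin_open_Int)
qed

lemma locally_integrable_inner:
  fixes V :: "'a::euclidean_space \<Rightarrow> 'b::euclidean_space"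
  assumes "locally_integrable \<Omega> V"
  shows "locally_integrable \<Omega> (\<lambda>x. V x \<bullet> v)"
  unfolding locally_integrable_def
proof (intro allI impI)
  fix K assume "compact K \<and> K \<subseteq> \<Omega>"
  then have "V absolutely_integrable_on K"
    using assms by (simp add: locally_integrable_def)
  then have "((\<lambda>w. w \<bullet> v) \<circ> V) absolutely_integrable_on K"
    by (rule absolutely_integrable_linear) (rule bounded_linear_inner_left)
  then show "(\<lambda>x. V x \<bullet> v) absolutely_integrable_on K"
    by (simp add: o_def)
qed

lemma locally_integrable_diff:
  fixes V W :: "'a::euclidean_space \<Rightarrow> 'b::euclidean_space"
  assumes "locally_integrable \<Omega> V" "locally_integrable \<Omega> W"
  shows "locally_integrable \<Omega> (\<lambda>x. V x - W x)"
  using assms by (auto simp: locally_integrable_def)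

lemma continuous_imp_locally_integrable:
  fixes V :: "'a::euclidean_space \<Rightarrow> 'b::euclidean_space"
  assumes "continuous_on UNIV V"
  shows "locally_integrable \<Omega> V"
  unfolding locally_integrable_def
proof (intro allI impI)
  fix K assume K: "compact K \<and> K \<subseteq> \<Omega>"
  then obtain a where a: "K \<subseteq> cbox (- a) a"
    using bounded_subset_cbox_symmetric compact_imp_bounded by metis
  have "V absolutely_integrable_on cbox (- a) a"
    using assms by (intro absolutely_integrable_continuous) (blast intro: continuous_on_subset)
  then show "V absolutely_integrable_on K"
    using K a by (auto intro: set_integrable_subset simp: lmeasurable_compact fmeasurableD)
qed

text \<open>\<open>du_Bois_Reymond\<close> applied to each coordinate of the difference. This makes
  the choice in \<open>weak_gradient\<close> usable: any explicit weak gradient agrees with the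
  chosen one almost everywhere.\<close>

lemma is_weak_gradient_unique:
  fixes u :: "'a::euclidean_space \<Rightarrow> real"
  assumes \<Omega>: "open \<Omega>" and V: "is_weak_gradient \<Omega> u V" and W: "is_weak_gradient \<Omega> u W"
  shows "AE x in lebesgue_on \<Omega>. V x = W x"
proof -
  have \<Omega>': "\<Omega> \<in> sets lebesgue"
    using \<Omega> by (simp add: borel_open)
  have li: "locally_integrable \<Omega> V" "locally_integrable \<Omega> W"
    using V W by (auto simp: is_weak_gradient_def)
  have neg: "negligible {x \<in> \<Omega>. V x \<bullet> i - W x \<bullet> i \<noteq> 0}" if i: "i \<in> Basis" for i
  proof (rule du_Bois_Reymond[OF \<Omega> locally_integrable_diff[OF li[THEN locally_integrable_inner]]])
    fix \<phi> assume \<phi>: "\<phi> \<in> test_functions \<Omega>"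
    have "(LINT x|lebesgue_on \<Omega>. u x * frechet_derivative \<phi> (at x) i) = - (LINT x|lebesgue_on \<Omega>. (V x \<bullet> i) * \<phi> x)"
      "(LINT x|lebesgue_on \<Omega>. u x * frechet_derivative \<phi> (at x) i) = - (LINT x|lebesgue_on \<Omega>. (W x \<bullet> i) * \<phi> x)"
      using V W \<phi> i by (auto simp: is_weak_gradient_def)
    then have "(\<integral>x. (V x \<bullet> i) * \<phi> x \<partial>lebesgue) = (\<integral>x. (W x \<bullet> i) * \<phi> x \<partial>lebesgue)"
      using test_function_eq_0(1)[OF \<phi>] lint_lebesgue_on(1)[OF \<Omega>', of "\<lambda>x. (V x \<bullet> i) * \<phi> x"]
        lint_lebesgue_on(1)[OF \<Omega>', of "\<lambda>x. (W x \<bullet> i) * \<phi> x"] by simp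
    then show "(\<integral>x. (V x \<bullet> i - W x \<bullet> i) * \<phi> x \<partial>lebesgue) = 0"
      using integrable_mult_test_function(1)[OF li(1)[THEN locally_integrable_inner] \<phi>, of i]
        integrable_mult_test_function(1)[OF li(2)[THEN locally_integrable_inner] \<phi>, of i]
      by (simp add: left_diff_distrib)
  qed
  have "{x \<in> \<Omega>. V x \<noteq> W x} \<subseteq> (\<Union>i\<in>Basis. {x \<in> \<Omega>. V x \<bullet> i - W x \<bullet> i \<noteq> 0})"
    by (auto simp: euclidean_eq_iff[where 'a='a])
  moreover have "negligible (\<Union>i\<in>Basis. {x \<in> \<Omega>. V x \<bullet> i - W x \<bullet> i \<noteq> 0})"
    using neg by (intro negligible_Union) auto
  ultimately have "negligible {x \<in> \<Omega>. V x \<noteq> W x}"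
    using negligible_subset by blast
  then have "AE x in lebesgue. x \<notin> {x \<in> \<Omega>. V x \<noteq> W x}"
    using AE_not_in negligible_iff_null_sets by blast
  then show ?thesis
    using \<Omega>' by (subst AE_restrict_space_iff) (auto elim: eventually_mono)
qed

lemma is_weak_gradient_weak_gradient:
  "is_weak_gradient \<Omega> u V \<Longrightarrow> is_weak_gradient \<Omega> u (weak_gradient \<Omega> u)"
  unfolding weak_gradient_def using someI[of "is_weak_gradient \<Omega> u" V] by simp

text \<open>Integration by parts: the product of two test functions is a test function, so its
  partial derivatives have integral 0.\<close>

lemma is_weak_gradient_test_function:
  fixes \<phi> :: "'a::euclidean_space \<Rightarrow> real"
  assumes \<Omega>: "\<Omega> \<in> sets lebesgue" and \<phi>: "\<phi> \<in> test_functions \<Omega>"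
  shows "is_weak_gradient \<Omega> \<phi> (grad \<phi>)"
  unfolding is_weak_gradient_def
proof (intro conjI ballI)
  show li: "locally_integrable \<Omega> \<phi>" "locally_integrable \<Omega> (grad \<phi>)"
    by (intro continuous_imp_locally_integrable test_function_continuous[OF \<phi>] test_function_continuous_grad[OF \<phi>])+
  fix \<psi> and i :: 'a assume \<psi>: "\<psi> \<in> test_functions \<Omega>" and i: "i \<in> Basis"
  have "(\<lambda>x. \<phi> x * \<psi> x) \<in> test_functions \<Omega>"
    by (rule test_functions_mult[OF \<phi> \<psi>])
  then have test: "(\<lambda>x. \<phi> x * \<psi> x) \<in> test_functions UNIV"
    by (auto simp: test_functions_def)
  have grad: "grad (\<lambda>x. \<phi> x * \<psi> x) x = \<phi> x *\<^sub>R grad \<psi> x + \<psi> x *\<^sub>R grad \<phi> x" for x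
    using has_derivative_mult[OF test_function_has_derivative[OF \<phi>, of x] test_function_has_derivative[OF \<psi>, of x]]
    by (intro grad_eqI) (simp add: inner_add_left mult.commute)
  have "(\<integral>x. \<phi> x * frechet_derivative \<psi> (at x) i + (grad \<phi> x \<bullet> i) * \<psi> x \<partial>lebesgue) = 0"
    using integral_partial_derivative_eq_0[OF test, of i] i by (simp add: grad inner_add_left grad_inner_Basis mult.commute)
  then have "(\<integral>x. \<phi> x * frechet_derivative \<psi> (at x) i \<partial>lebesgue) = - (\<integral>x. (grad \<phi> x \<bullet> i) * \<psi> x \<partial>lebesgue)"
    using integrable_mult_test_function(2)[OF li(1) \<psi> i]
      integrable_mult_test_function(1)[OF locally_integrable_inner[OF li(2)] \<psi>, of i] by simp
  then show "(LINT x|lebesgue_on \<Omega>. \<phi> x * frechet_derivative \<psi> (at x) i) =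
      - (LINT x|lebesgue_on \<Omega>. (grad \<phi> x \<bullet> i) * \<psi> x)"
    using test_function_eq_0[OF \<phi>] lint_lebesgue_on(1)[OF \<Omega>, of "\<lambda>x. \<phi> x * frechet_derivative \<psi> (at x) i"]
      lint_lebesgue_on(1)[OF \<Omega>, of "\<lambda>x. (grad \<phi> x \<bullet> i) * \<psi> x"] by simp
qed

lemma is_weak_gradient_diff:
  fixes u v :: "'a::euclidean_space \<Rightarrow> real"
  assumes \<Omega>: "\<Omega> \<in> sets lebesgue" and u: "is_weak_gradient \<Omega> u V" and v: "is_weak_gradient \<Omega> v W"
  shows "is_weak_gradient \<Omega> (\<lambda>x. u x - v x) (\<lambda>x. V x - W x)"
  unfolding is_weak_gradient_def
proof (intro conjI ballI)
  have li: "locally_integrable \<Omega> u" "locally_integrable \<Omega> V" "locally_integrable \<Omega> v" "locally_integrable \<Omega> W"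
    using u v by (auto simp: is_weak_gradient_def)
  show "locally_integrable \<Omega> (\<lambda>x. u x - v x)" "locally_integrable \<Omega> (\<lambda>x. V x - W x)"
    by (intro locally_integrable_diff li)+
  fix \<psi> and i :: 'a assume \<psi>: "\<psi> \<in> test_functions \<Omega>" and i: "i \<in> Basis"
  have 0: "\<psi> x = 0" "frechet_derivative \<psi> (at x) i = 0" if "x \<notin> \<Omega>" for x
    using test_function_eq_0[OF \<psi> that] grad_inner_Basis[OF i, of \<psi> x] by simp_all
  have eq: "(LINT x|lebesgue_on \<Omega>. f x * frechet_derivative \<psi> (at x) i) = (\<integral>x. f x * frechet_derivative \<psi> (at x) i \<partial>lebesgue)"
    "(LINT x|lebesgue_on \<Omega>. f x * \<psi> x) = (\<integral>x. f x * \<psi> x \<partial>lebesgue)" for f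
    by (intro lint_lebesgue_on(1) \<Omega>; simp add: 0)+
  note int = integrable_mult_test_function(2)[OF li(1) \<psi> i] integrable_mult_test_function(2)[OF li(3) \<psi> i]
    integrable_mult_test_function(1)[OF locally_integrable_inner[OF li(2)] \<psi>, of i]
    integrable_mult_test_function(1)[OF locally_integrable_inner[OF li(4)] \<psi>, of i]
  have "(LINT x|lebesgue_on \<Omega>. u x * frechet_derivative \<psi> (at x) i) = - (LINT x|lebesgue_on \<Omega>. (V x \<bullet> i) * \<psi> x)"
    "(LINT x|lebesgue_on \<Omega>. v x * frechet_derivative \<psi> (at x) i) = - (LINT x|lebesgue_on \<Omega>. (W x \<bullet> i) * \<psi> x)"
    using u v \<psi> i by (auto simp: is_weak_gradient_def)
  then show "(LINT x|lebesgue_on \<Omega>. (u x - v x) * frechet_derivative \<psi> (at x) i) =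
      - (LINT x|lebesgue_on \<Omega>. ((V x - W x) \<bullet> i) * \<psi> x)"
    unfolding eq using int by (simp add: left_diff_distrib inner_diff_left)
qed

lemma weak_gradient_test_function:
  assumes "open \<Omega>" "\<phi> \<in> test_functions \<Omega>"
  shows "AE x in lebesgue_on \<Omega>. weak_gradient \<Omega> \<phi> x = grad \<phi> x"
proof -
  have "is_weak_gradient \<Omega> \<phi> (grad \<phi>)"
    using assms by (intro is_weak_gradient_test_function) (auto simp: borel_open)
  then show ?thesis
    using is_weak_gradient_unique[OF assms(1)] is_weak_gradient_weak_gradient by blast
qed

lemma weak_gradient_diff_test_function:
  assumes "open \<Omega>" "is_weak_gradient \<Omega> u V" "\<phi> \<in> test_functions \<Omega>"
  shows "AE x in lebesgue_on \<Omega>. weak_gradient \<Omega> (\<lambda>x. u x - \<phi> x) x = V x - grad \<phi> x"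
proof -
  have "is_weak_gradient \<Omega> (\<lambda>x. u x - \<phi> x) (\<lambda>x. V x - grad \<phi> x)"
    using assms by (intro is_weak_gradient_diff is_weak_gradient_test_function) (auto simp: borel_open)
  then show ?thesis
    using is_weak_gradient_unique[OF assms(1)] is_weak_gradient_weak_gradient by blast
qed

subsection \<open>N-functions and Orlicz classes\<close>

locale N_func =
  fixes G g :: "real \<Rightarrow> real"
  assumes N_function: "N_function G g"
begin

lemma density_mono: "0 \<le> s \<Longrightarrow> s \<le> t \<Longrightarrow> g s \<le> g t"
  using N_function unfolding N_function_def mono_on_def by auto

lemma density_0: "g 0 = 0"
  using N_function by (simp add: N_function_def)

lemma density_pos: "t > 0 \<Longrightarrow> g t > 0"
  using N_function by (simp add: N_function_def)

lemma density_nonneg: "t \<ge> 0 \<Longrightarrow> g t \<ge> 0"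
  using density_mono[of 0 t] density_0 by simp

lemma density_tendsto_0: "(g \<longlongrightarrow> 0) (at_right 0)"
  using N_function density_0 unfolding N_function_def continuous_within by auto

lemma density_integrable: "0 \<le> a \<Longrightarrow> g integrable_on {a..b}"
  using density_mono by (intro integrable_on_mono_on) (auto simp: mono_on_def)

lemma increment: "0 \<le> a \<Longrightarrow> a \<le> b \<Longrightarrow> G b - G a = integral {a..b} g"
  using N_function Henstock_Kurzweil_Integration.integral_combine[OF _ _ density_integrable, of 0 a b]
  by (simp add: N_function_def algebra_simps)

text \<open>Integration of the monotone \<open>g\<close> between a and b. This inequality stands in
  for differentiating G, which can fail at jumps of g. Convexity, the comparison of energies and the
  treatment of \<open>J\<close> all rest on it.\<close>

lemma subgradient:
  assumes "0 \<le> a" "0 \<le> b"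
  shows "G a + g a * (b - a) \<le> G b"
proof (cases "a \<le> b")
  case True
  have "integral {a..b} (\<lambda>_. g a) \<le> integral {a..b} g"
    using assms density_mono by (intro integral_le density_integrable) auto
  then show ?thesis
    using increment[of a b] assms True by (simp add: mult.commute)
next
  case False
  have "integral {b..a} g \<le> integral {b..a} (\<lambda>_. g a)"
    using assms density_mono by (intro integral_le density_integrable) auto
  then show ?thesis
    using increment[of b a] assms False by (simp add: algebra_simps)
qed

lemma at_0: "G 0 = 0"
  using N_function by (simp add: N_function_def)

lemma G_mono: "0 \<le> a \<Longrightarrow> a \<le> b \<Longrightarrow> G a \<le> G b"
  using subgradient[of a b] density_nonneg[of a] by (smt (verit) mult_nonneg_nonneg)

lemma nonneg: "0 \<le> t \<Longrightarrow> 0 \<le> G t"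
  using G_mono[of 0 t] at_0 by simp

lemma le_mult_density: "0 \<le> t \<Longrightarrow> G t \<le> t * g t"
  using subgradient[of t 0] at_0 by (simp add: algebra_simps)

lemma convex:
  assumes "0 \<le> a" "0 \<le> b" "0 \<le> \<theta>" "\<theta> \<le> 1"
  shows "G ((1 - \<theta>) * a + \<theta> * b) \<le> (1 - \<theta>) * G a + \<theta> * G b"
proof -
  \<comment> \<open>Both subgradient inequalities are taken at the intermediate point, where their
    linear terms cancel on averaging.\<close>
  define c where "c = (1 - \<theta>) * a + \<theta> * b"
  have c: "c \<ge> 0"
    using assms by (simp add: c_def)
  have "(1 - \<theta>) * (G c + g c * (a - c)) \<le> (1 - \<theta>) * G a" "\<theta> * (G c + g c * (b - c)) \<le> \<theta> * G b"
    using assms c by (auto intro!: mult_left_mono subgradient)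
  moreover have "(1 - \<theta>) * (G c + g c * (a - c)) + \<theta> * (G c + g c * (b - c)) = G c"
    unfolding c_def by (simp add: algebra_simps)
  ultimately show ?thesis
    unfolding c_def by linarith
qed

lemma scale_le: "0 \<le> t \<Longrightarrow> 0 \<le> s \<Longrightarrow> s \<le> 1 \<Longrightarrow> G (s * t) \<le> s * G t"
  using convex[of 0 t s] at_0 by simp

text \<open>Linear growth at infinity, from the subgradient at 1; it is what bounds L1 norms by
  modulars.\<close>

lemma linear_le: "0 \<le> t \<Longrightarrow> g 1 * (t - 1) \<le> G t"
  using subgradient[of 1 t] nonneg[of 1] by simp

text \<open>The subgradient at t, evaluated at the smaller point r t. Read with r = 1 / s, it bounds
  G(s a) by G(a) / (1 - p (1 - 1 / s)), which has the same derivative p at s = 1 as the sharper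
  factor s^p; nothing beyond first order is used later.\<close>

lemma dilate_le:
  assumes p: "t * g t \<le> p * G t" and t: "0 \<le> t" and r: "0 \<le> r" "r \<le> 1"
  shows "(1 - p * (1 - r)) * G t \<le> G (r * t)"
proof -
  have "(1 - r) * (t * g t) \<le> (1 - r) * (p * G t)"
    using p r by (intro mult_left_mono) auto
  then show ?thesis
    using subgradient[of t "r * t"] t r by (simp add: algebra_simps)
qed

text \<open>G is monotone on [0, oo) but arbitrary below 0. Precomposing with \<open>max t 0\<close>
  gives a function that is monotone on the whole line and hence Borel.\<close>

lemma measurable_norm:
  fixes f :: "'b \<Rightarrow> 'c::euclidean_space"
  assumes [measurable]: "f \<in> borel_measurable M"
  shows "(\<lambda>x. G (norm (f x))) \<in> borel_measurable M"
proof -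
  have "mono (\<lambda>t. G (max t 0))"
    by (auto intro!: monoI G_mono)
  then have [measurable]: "(\<lambda>t. G (max t 0)) \<in> borel_measurable borel"
    by (rule borel_measurable_mono)
  have "(\<lambda>x. G (max (norm (f x)) 0)) \<in> borel_measurable M"
    by measurable
  then show ?thesis
    by simp
qed

lemma measurable_density:
  fixes f :: "'b \<Rightarrow> 'c::euclidean_space"
  assumes [measurable]: "f \<in> borel_measurable M"
  shows "(\<lambda>x. g (norm (f x))) \<in> borel_measurable M"
proof -
  have "mono (\<lambda>t. g (max t 0))"
    by (auto intro!: monoI density_mono)
  then have [measurable]: "(\<lambda>t. g (max t 0)) \<in> borel_measurable borel"
    by (rule borel_measurable_mono)
  have "(\<lambda>x. g (max (norm (f x)) 0)) \<in> borel_measurable M"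
    by measurable
  then show ?thesis
    by simp
qed

section \<open>Modulars and the Luxemburg norm\<close>

lemma modular_scale_le:
  fixes f :: "'a::euclidean_space \<Rightarrow> 'b::euclidean_space"
  assumes f: "f \<in> borel_measurable (lebesgue_on \<Omega>)" and s: "0 \<le> s" "s \<le> 1"
  shows "modular G \<Omega> (\<lambda>x. s *\<^sub>R f x) \<le> ennreal s * modular G \<Omega> f"
proof -
  have [measurable]: "(\<lambda>x. G (norm (f x))) \<in> borel_measurable (lebesgue_on \<Omega>)"
    by (rule measurable_norm[OF f])
  have "modular G \<Omega> (\<lambda>x. s *\<^sub>R f x) \<le> (\<integral>\<^sup>+x. ennreal s * ennreal (G (norm (f x))) \<partial>lebesgue_on \<Omega>)"
    unfolding modular_def using s scale_le nonneg
    by (intro nn_integral_mono) (auto simp: ennreal_mult[symmetric] intro!: ennreal_leI)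
  also have "\<dots> = ennreal s * modular G \<Omega> f"
    unfolding modular_def by (rule nn_integral_cmult) measurable
  finally show ?thesis .
qed

text \<open>The factor 1/2 places the argument below the midpoint of the two norms, where convexity
  applies.\<close>

lemma modular_half_diff_finite:
  fixes f f' :: "'a::euclidean_space \<Rightarrow> 'b::euclidean_space"
  assumes f: "f \<in> Orlicz_class G \<Omega>" "f' \<in> Orlicz_class G \<Omega>"
  shows "modular G \<Omega> (\<lambda>x. (1 / 2) *\<^sub>R (f x - f' x)) < \<infinity>"
proof -
  have [measurable]: "f \<in> borel_measurable (lebesgue_on \<Omega>)" "f' \<in> borel_measurable (lebesgue_on \<Omega>)"
    using f by (auto simp: Orlicz_class_def)
  note [measurable] = measurable_norm
  have *: "G (norm ((1 / 2) *\<^sub>R (f x - f' x))) \<le> G (norm (f x)) + G (norm (f' x))" for x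
  proof -
    have "norm ((1 / 2) *\<^sub>R (f x - f' x)) \<le> (1 - 1/2) * norm (f x) + 1/2 * norm (f' x)"
      using norm_triangle_ineq4[of "f x" "f' x"] by simp
    then have "G (norm ((1 / 2) *\<^sub>R (f x - f' x))) \<le> G ((1 - 1/2) * norm (f x) + 1/2 * norm (f' x))"
      by (intro G_mono) auto
    also have "\<dots> \<le> (1 - 1/2) * G (norm (f x)) + 1/2 * G (norm (f' x))"
      by (intro convex) auto
    finally show ?thesis
      using nonneg[of "norm (f x)"] nonneg[of "norm (f' x)"] by simp
  qed
  have "modular G \<Omega> (\<lambda>x. (1 / 2) *\<^sub>R (f x - f' x)) \<le>
      (\<integral>\<^sup>+x. ennreal (G (norm (f x))) + ennreal (G (norm (f' x))) \<partial>lebesgue_on \<Omega>)"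
    unfolding modular_def using * nonneg
    by (intro nn_integral_mono) (auto simp: ennreal_plus[symmetric] simp del: ennreal_plus intro!: ennreal_leI)
  also have "\<dots> = modular G \<Omega> f + modular G \<Omega> f'"
    unfolding modular_def by (rule nn_integral_add) (intro measurable_compose[OF _ measurable_ennreal] measurable_norm; simp)+
  also have "\<dots> < \<infinity>"
    using f by (simp add: Orlicz_class_def ennreal_add_less_top)
  finally show ?thesis .
qed

text \<open>One scale with finite modular makes the set under the infimum nonempty. This has to be
  secured first, because \<open>Inf\<close> of the empty set of reals carries no
  information.\<close>

lemma Luxemburg_norm_finite_modular:
  fixes f :: "'a::euclidean_space \<Rightarrow> 'b::euclidean_space"
  assumes "f \<in> borel_measurable (lebesgue_on \<Omega>)" "0 < c" "modular G \<Omega> (\<lambda>x. c *\<^sub>R f x) < \<infinity>"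
  shows "0 \<le> Luxemburg_norm G \<Omega> f"
    and "Luxemburg_norm G \<Omega> f < \<epsilon> \<Longrightarrow> \<exists>l. 0 < l \<and> l < \<epsilon> \<and> modular G \<Omega> (\<lambda>x. f x /\<^sub>R l) \<le> 1"
proof -
  let ?L = "{l. 0 < l \<and> modular G \<Omega> (\<lambda>x. f x /\<^sub>R l) \<le> 1}"
  obtain m where m: "modular G \<Omega> (\<lambda>x. c *\<^sub>R f x) = ennreal m" "m \<ge> 0"
    using assms(3) by (cases "modular G \<Omega> (\<lambda>x. c *\<^sub>R f x)") auto
  \<comment> \<open>Scaling by s <= 1 scales the modular by at most s, and s m <= 1; so 1 / (s c) is
    an admissible value in the infimum.\<close>
  define s where "s = 1 / (m + 1)"
  have s: "0 < s" "s \<le> 1" "s * m \<le> 1"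
    using m(2) by (auto simp: s_def field_simps)
  have "modular G \<Omega> (\<lambda>x. s *\<^sub>R (c *\<^sub>R f x)) \<le> ennreal s * ennreal m"
    using modular_scale_le[of "\<lambda>x. c *\<^sub>R f x" \<Omega> s] assms(1) s m(1) by simp
  also have "\<dots> = ennreal (s * m)"
    using s m(2) by (simp add: ennreal_mult)
  also have "\<dots> \<le> 1"
    using s by simp
  finally have "1 / (s * c) \<in> ?L"
    using s assms(2) by simp
  then have ne: "?L \<noteq> {}"
    by blast
  show "0 \<le> Luxemburg_norm G \<Omega> f"
    unfolding Luxemburg_norm_def using ne by (intro cInf_greatest) auto
  show "\<exists>l. 0 < l \<and> l < \<epsilon> \<and> modular G \<Omega> (\<lambda>x. f x /\<^sub>R l) \<le> 1" if "Luxemburg_norm G \<Omega> f < \<epsilon>"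
    using cInf_lessD[OF ne that[unfolded Luxemburg_norm_def]] by blast
qed

text \<open>\<open>linear_le\<close> at |f| / l gives |f| <= l + (l / g 1) G(|f| / l), and the last
  term integrates to at most l / g 1. As the bound is proportional to l, Luxemburg convergence
  implies L1 convergence.\<close>

lemma modular_le_1_imp_L1:
  fixes f :: "'a::euclidean_space \<Rightarrow> 'b::euclidean_space"
  assumes \<Omega>: "\<Omega> \<in> lmeasurable" and f: "f \<in> borel_measurable (lebesgue_on \<Omega>)"
    and l: "l > 0" "modular G \<Omega> (\<lambda>x. f x /\<^sub>R l) \<le> 1"
  shows "integrable (lebesgue_on \<Omega>) (\<lambda>x. norm (f x))"
    and "(LINT x|lebesgue_on \<Omega>. norm (f x)) \<le> l * (measure lebesgue \<Omega> + 1 / g 1)"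
proof -
  have g1: "g 1 > 0"
    by (rule density_pos) simp
  have [measurable]: "f \<in> borel_measurable (lebesgue_on \<Omega>)"
    by (rule f)
  have [measurable]: "(\<lambda>x. G (norm (f x /\<^sub>R l))) \<in> borel_measurable (lebesgue_on \<Omega>)"
    by (rule measurable_norm) measurable
  have \<Omega>': "\<Omega> \<in> sets lebesgue" "emeasure lebesgue \<Omega> = ennreal (measure lebesgue \<Omega>)"
    using \<Omega> by (auto simp: fmeasurableD emeasure_eq_measure2)
  have *: "norm (f x) \<le> l + l / g 1 * G (norm (f x /\<^sub>R l))" for x
  proof -
    have "l / g 1 * (g 1 * (norm (f x /\<^sub>R l) - 1)) \<le> l / g 1 * G (norm (f x /\<^sub>R l))"
      using l g1 by (intro mult_left_mono linear_le) auto
    moreover have "l / g 1 * (g 1 * (norm (f x /\<^sub>R l) - 1)) = norm (f x) - l"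
      using l g1 by (simp add: field_simps)
    ultimately show ?thesis
      by linarith
  qed
  have m: "(\<lambda>x. ennreal (G (norm (f x /\<^sub>R l)))) \<in> borel_measurable (lebesgue_on \<Omega>)"
    by measurable
  have "(\<integral>\<^sup>+x. ennreal (norm (f x)) \<partial>lebesgue_on \<Omega>) \<le>
      (\<integral>\<^sup>+x. ennreal l + ennreal (l / g 1) * ennreal (G (norm (f x /\<^sub>R l))) \<partial>lebesgue_on \<Omega>)"
    using * l g1 nonneg
    by (intro nn_integral_mono) (auto simp: ennreal_mult[symmetric] ennreal_plus[symmetric] simp del: ennreal_plus intro!: ennreal_leI)
  also have "\<dots> = ennreal l * emeasure lebesgue \<Omega> + ennreal (l / g 1) * modular G \<Omega> (\<lambda>x. f x /\<^sub>R l)"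
    unfolding modular_def using \<Omega>'(1) m
    by (subst nn_integral_add) (auto simp: nn_integral_cmult emeasure_restrict_space simp del: norm_scaleR)
  also have "\<dots> \<le> ennreal l * ennreal (measure lebesgue \<Omega>) + ennreal (l / g 1) * 1"
    using l(2) \<Omega>'(2) by (intro add_mono mult_left_mono) auto
  also have "\<dots> = ennreal (l * (measure lebesgue \<Omega> + 1 / g 1))"
    using l g1 by (simp add: ennreal_mult[symmetric] ennreal_plus[symmetric] distrib_left del: ennreal_plus)
  finally have le: "(\<integral>\<^sup>+x. ennreal (norm (f x)) \<partial>lebesgue_on \<Omega>) \<le> ennreal (l * (measure lebesgue \<Omega> + 1 / g 1))" .
  show int: "integrable (lebesgue_on \<Omega>) (\<lambda>x. norm (f x))"
    using le by (intro integrableI_bounded) (auto simp: le_less_trans[OF _ ennreal_less_top])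
  have "ennreal (LINT x|lebesgue_on \<Omega>. norm (f x)) = (\<integral>\<^sup>+x. ennreal (norm (f x)) \<partial>lebesgue_on \<Omega>)"
    by (rule nn_integral_eq_integral[symmetric, OF int]) simp
  then have "ennreal (LINT x|lebesgue_on \<Omega>. norm (f x)) \<le> ennreal (l * (measure lebesgue \<Omega> + 1 / g 1))"
    using le by simp
  then show "(LINT x|lebesgue_on \<Omega>. norm (f x)) \<le> l * (measure lebesgue \<Omega> + 1 / g 1)"
    using l g1 by (subst (asm) ennreal_le_iff) auto
qed

lemma bounded_imp_Orlicz_class:
  fixes f :: "'a::euclidean_space \<Rightarrow> 'b::euclidean_space"
  assumes \<Omega>: "\<Omega> \<in> lmeasurable" and f: "f \<in> borel_measurable (lebesgue_on \<Omega>)"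
    and C: "\<And>x. norm (f x) \<le> C"
  shows "f \<in> Orlicz_class G \<Omega>"
proof -
  have "modular G \<Omega> f \<le> (\<integral>\<^sup>+x. ennreal (G C) \<partial>lebesgue_on \<Omega>)"
    unfolding modular_def using C by (intro nn_integral_mono ennreal_leI G_mono) auto
  also have "\<dots> = ennreal (G C) * emeasure lebesgue \<Omega>"
    using \<Omega> by (simp add: fmeasurableD emeasure_restrict_space)
  also have "\<dots> < \<infinity>"
    using \<Omega> by (auto simp: ennreal_mult_less_top fmeasurable_def)
  finally show ?thesis
    using f by (simp add: Orlicz_class_def)
qed

end

section \<open>Almost everywhere equality and approximation by test functions\<close>

lemma modular_cong_AE:
  assumes "AE x in lebesgue_on \<Omega>. f x = f' x"
  shows "modular G \<Omega> f = modular G \<Omega> f'"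
  unfolding modular_def using assms by (intro nn_integral_cong_AE) auto

text \<open>This is completeness of Lebesgue measure, applied to the extensions by 0.\<close>

lemma lebesgue_on_measurable_AE:
  fixes f f' :: "'a::euclidean_space \<Rightarrow> 'b::euclidean_space"
  assumes \<Omega>: "\<Omega> \<in> sets lebesgue" and f: "f \<in> borel_measurable (lebesgue_on \<Omega>)"
    and eq: "AE x in lebesgue_on \<Omega>. f x = f' x"
  shows "f' \<in> borel_measurable (lebesgue_on \<Omega>)"
proof -
  have "(\<lambda>x. if x \<in> \<Omega> then f x else 0) \<in> borel_measurable lebesgue"
    using f \<Omega> by (simp add: borel_measurable_if)
  moreover have "AE x in lebesgue. (if x \<in> \<Omega> then f x else 0) = (if x \<in> \<Omega> then f' x else 0)"
    using eq \<Omega> by (subst (asm) AE_restrict_space_iff) (auto elim: eventually_mono)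
  ultimately have "(\<lambda>x. if x \<in> \<Omega> then f' x else 0) \<in> borel_measurable lebesgue"
    by (rule borel_measurable_AE)
  then show ?thesis
    using \<Omega> by (simp add: borel_measurable_if)
qed

context N_func
begin

lemma test_function_Orlicz_class:
  fixes \<phi> :: "'a::euclidean_space \<Rightarrow> real"
  assumes \<Omega>: "\<Omega> \<in> lmeasurable" and \<phi>: "\<phi> \<in> test_functions \<Omega>"
  shows "\<phi> \<in> Orlicz_class G \<Omega>" "grad \<phi> \<in> Orlicz_class G \<Omega>"
proof -
  obtain C where C: "\<And>x. \<bar>\<phi> x\<bar> \<le> C" "\<And>x. norm (grad \<phi> x) \<le> C"
    using test_function_bounded[OF \<phi>] by metis
  have "\<phi> \<in> borel_measurable lebesgue" "grad \<phi> \<in> borel_measurable lebesgue"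
    by (intro continuous_imp_lebesgue_measurable test_function_continuous[OF \<phi>] test_function_continuous_grad[OF \<phi>])+
  then have "\<phi> \<in> borel_measurable (lebesgue_on \<Omega>)" "grad \<phi> \<in> borel_measurable (lebesgue_on \<Omega>)"
    by (auto intro: measurable_restrict_space1)
  then show "\<phi> \<in> Orlicz_class G \<Omega>" "grad \<phi> \<in> Orlicz_class G \<Omega>"
    using C by (auto intro!: bounded_imp_Orlicz_class[OF \<Omega>, of _ C])
qed

lemma Orlicz_class_cong_AE:
  fixes f f' :: "'a::euclidean_space \<Rightarrow> 'b::euclidean_space"
  assumes "\<Omega> \<in> lmeasurable" "f \<in> Orlicz_class G \<Omega>" "AE x in lebesgue_on \<Omega>. f x = f' x"
  shows "f' \<in> Orlicz_class G \<Omega>"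
  using assms modular_cong_AE[OF assms(3), of G] lebesgue_on_measurable_AE[of \<Omega> f f']
  by (auto simp: Orlicz_class_def fmeasurableD)

lemma Luxemburg_norm_AE_0:
  fixes f :: "'a::euclidean_space \<Rightarrow> 'b::euclidean_space"
  assumes "AE x in lebesgue_on \<Omega>. f x = 0"
  shows "Luxemburg_norm G \<Omega> f = 0"
proof -
  have "modular G \<Omega> (\<lambda>x. f x /\<^sub>R l) = 0" for l
    using modular_cong_AE[where f = "\<lambda>x. f x /\<^sub>R l" and f' = "\<lambda>x. 0" and \<Omega> = \<Omega> and G = G] assms
    by (auto simp: modular_def at_0 elim: eventually_mono)
  then have "{l. 0 < l \<and> modular G \<Omega> (\<lambda>x. f x /\<^sub>R l) \<le> 1} = {0<..}"
    by auto
  then show ?thesis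
    by (simp add: Luxemburg_norm_def)
qed

text \<open>The function approximates itself. The error is the zero function, whose weak gradient
  comes from a choice and therefore vanishes only almost everywhere; that still gives norm
  0.\<close>

lemma test_function_W1_0:
  fixes \<phi> :: "'a::euclidean_space \<Rightarrow> real"
  assumes \<Omega>: "open \<Omega>" "\<Omega> \<in> lmeasurable" and \<phi>: "\<phi> \<in> test_functions \<Omega>"
  shows "\<phi> \<in> W1_0 G \<Omega>"
proof -
  have wg: "is_weak_gradient \<Omega> \<phi> (grad \<phi>)"
    using \<Omega> \<phi> by (intro is_weak_gradient_test_function) (auto simp: fmeasurableD)
  have "AE x in lebesgue_on \<Omega>. grad \<phi> x = weak_gradient \<Omega> \<phi> x"
    using weak_gradient_test_function[OF \<Omega>(1) \<phi>] by (auto elim: eventually_mono)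
  then have "\<phi> \<in> W1 G \<Omega>"
    using test_function_Orlicz_class[OF \<Omega>(2) \<phi>] wg Orlicz_class_cong_AE[OF \<Omega>(2)]
    unfolding W1_def by blast
  moreover have "W1_norm G \<Omega> (\<lambda>x. \<phi> x - \<phi> x) = 0"
  proof -
    have "AE x in lebesgue_on \<Omega>. weak_gradient \<Omega> (\<lambda>x. \<phi> x - \<phi> x) x = 0"
      using weak_gradient_diff_test_function[OF \<Omega>(1) wg \<phi>] by simp
    then show ?thesis
      by (simp add: W1_norm_def Luxemburg_norm_AE_0)
  qed
  ultimately show ?thesis
    unfolding W1_0_def using \<phi> by (auto intro!: bexI[of _ \<phi>])
qed

text \<open>Norm convergence is unpacked into L1 convergence, used for the linear term, and into
  scales \<open>l j\<close> at which the gradient errors have modular at most 1, used for the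
  energy.\<close>

lemma W1_0_approximation:
  fixes u :: "'a::euclidean_space \<Rightarrow> real"
  assumes \<Omega>: "open \<Omega>" "\<Omega> \<in> lmeasurable" and u: "u \<in> W1_0 G \<Omega>"
  obtains \<phi> l where "\<And>j::nat. \<phi> j \<in> test_functions \<Omega>" "\<And>j. l j > 0" "l \<longlonglongrightarrow> 0"
    "\<And>j. integrable (lebesgue_on \<Omega>) (\<lambda>x. \<bar>u x - \<phi> j x\<bar>)"
    "(\<lambda>j. LINT x|lebesgue_on \<Omega>. \<bar>u x - \<phi> j x\<bar>) \<longlonglongrightarrow> 0"
    "\<And>j. integrable (lebesgue_on \<Omega>) (\<lambda>x. norm (weak_gradient \<Omega> u x - grad (\<phi> j) x))"
    "(\<lambda>j. LINT x|lebesgue_on \<Omega>. norm (weak_gradient \<Omega> u x - grad (\<phi> j) x)) \<longlonglongrightarrow> 0"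
    "\<And>j. modular G \<Omega> (\<lambda>x. (weak_gradient \<Omega> u x - grad (\<phi> j) x) /\<^sub>R l j) \<le> 1"
proof -
  define V where "V = weak_gradient \<Omega> u"
  have uW: "u \<in> Orlicz_class G \<Omega>" "V \<in> Orlicz_class G \<Omega>" and wg: "is_weak_gradient \<Omega> u V"
    using u is_weak_gradient_weak_gradient unfolding W1_0_def W1_def V_def by blast+
  define K where "K = measure lebesgue \<Omega> + 1 / g 1"
  define P where "P j \<phi> l m \<longleftrightarrow> \<phi> \<in> test_functions \<Omega> \<and> 0 < l \<and> l < inverse (real (Suc j)) \<and>
      0 < m \<and> m < inverse (real (Suc j)) \<and>
      modular G \<Omega> (\<lambda>x. (u x - \<phi> x) /\<^sub>R m) \<le> 1 \<and> modular G \<Omega> (\<lambda>x. (V x - grad \<phi> x) /\<^sub>R l) \<le> 1"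
    for j \<phi> l m
  have "\<exists>\<phi> l m. P j \<phi> l m" for j
  proof -
    define \<epsilon> where "\<epsilon> = inverse (real (Suc j))"
    have "\<epsilon> > 0"
      by (simp add: \<epsilon>_def)
    then obtain \<phi> where \<phi>: "\<phi> \<in> test_functions \<Omega>" "W1_norm G \<Omega> (\<lambda>x. u x - \<phi> x) < \<epsilon>"
      using u unfolding W1_0_def by blast
    note O = test_function_Orlicz_class[OF \<Omega>(2) \<phi>(1)]
    \<comment> \<open>The norm involves the chosen weak gradient \<open>W\<close> of the difference;
      measurability and modulars are transferred between it and \<open>V\<close> minus the gradient
      of the test function.\<close>
    define W where "W = weak_gradient \<Omega> (\<lambda>x. u x - \<phi> x)"
    have W: "AE x in lebesgue_on \<Omega>. W x = V x - grad \<phi> x"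
      unfolding W_def by (rule weak_gradient_diff_test_function[OF \<Omega>(1) wg \<phi>(1)])
    have meas: "(\<lambda>x. u x - \<phi> x) \<in> borel_measurable (lebesgue_on \<Omega>)" "(\<lambda>x. V x - grad \<phi> x) \<in> borel_measurable (lebesgue_on \<Omega>)"
      using uW O by (auto simp: Orlicz_class_def)
    have Wm: "W \<in> borel_measurable (lebesgue_on \<Omega>)"
    proof (rule lebesgue_on_measurable_AE[OF _ meas(2)])
      show "AE x in lebesgue_on \<Omega>. V x - grad \<phi> x = W x"
        using W by (auto elim: eventually_mono)
    qed (use \<Omega> in \<open>auto simp: fmeasurableD\<close>)
    have eq: "modular G \<Omega> (\<lambda>x. c *\<^sub>R W x) = modular G \<Omega> (\<lambda>x. c *\<^sub>R (V x - grad \<phi> x))" for c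
      using W by (intro modular_cong_AE) (auto elim: eventually_mono)
    have W2: "modular G \<Omega> (\<lambda>x. (1 / 2) *\<^sub>R W x) < \<infinity>"
      unfolding eq by (rule modular_half_diff_finite[OF uW(2) O(2)])
    note L1 = Luxemburg_norm_finite_modular[OF meas(1) _ modular_half_diff_finite[OF uW(1) O(1)]]
    note L2 = Luxemburg_norm_finite_modular[OF Wm _ W2]
    \<comment> \<open>Nonnegativity of both norms lets the bound on their sum bound each of
      them.\<close>
    have "0 \<le> Luxemburg_norm G \<Omega> (\<lambda>x. u x - \<phi> x)" "0 \<le> Luxemburg_norm G \<Omega> W"
      using L1(1) L2(1) by simp_all
    then have less: "Luxemburg_norm G \<Omega> (\<lambda>x. u x - \<phi> x) < \<epsilon>" "Luxemburg_norm G \<Omega> W < \<epsilon>"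
      using \<phi>(2) unfolding W1_norm_def W_def[symmetric] by auto
    obtain m where "0 < m" "m < \<epsilon>" "modular G \<Omega> (\<lambda>x. (u x - \<phi> x) /\<^sub>R m) \<le> 1"
      using L1(2)[OF _ less(1)] by auto
    moreover obtain l where "0 < l" "l < \<epsilon>" "modular G \<Omega> (\<lambda>x. W x /\<^sub>R l) \<le> 1"
      using L2(2)[OF _ less(2)] by auto
    ultimately show ?thesis
      using \<phi>(1) unfolding P_def eq \<epsilon>_def[symmetric] by blast
  qed
  then obtain \<phi> l m where "\<And>j. P j (\<phi> j) (l j) (m j)"
    by metis
  then have A: "\<And>j. \<phi> j \<in> test_functions \<Omega>" "\<And>j. 0 < l j" "\<And>j. l j < inverse (real (Suc j))"
    "\<And>j. 0 < m j" "\<And>j. m j < inverse (real (Suc j))"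
    "\<And>j. modular G \<Omega> (\<lambda>x. (u x - \<phi> j x) /\<^sub>R m j) \<le> 1" "\<And>j. modular G \<Omega> (\<lambda>x. (V x - grad (\<phi> j) x) /\<^sub>R l j) \<le> 1"
    unfolding P_def by blast+
  have lim: "l \<longlonglongrightarrow> 0" "m \<longlonglongrightarrow> 0"
    by (rule tendsto_sandwich[OF _ _ tendsto_const LIMSEQ_inverse_real_of_nat];
        use A in \<open>auto intro!: always_eventually less_imp_le\<close>)+
  have meas: "(\<lambda>x. u x - \<phi> j x) \<in> borel_measurable (lebesgue_on \<Omega>)" "(\<lambda>x. V x - grad (\<phi> j) x) \<in> borel_measurable (lebesgue_on \<Omega>)" for j
    using uW test_function_Orlicz_class[OF \<Omega>(2) A(1)[of j]] by (auto simp: Orlicz_class_def)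
  note U = modular_le_1_imp_L1[OF \<Omega>(2) meas(1) A(4) A(6)]
  note V = modular_le_1_imp_L1[OF \<Omega>(2) meas(2) A(2) A(7)]
  have limU: "(\<lambda>j. LINT x|lebesgue_on \<Omega>. norm (u x - \<phi> j x)) \<longlonglongrightarrow> 0"
  proof (rule tendsto_sandwich[OF _ _ tendsto_const])
    show "(\<lambda>j. m j * K) \<longlonglongrightarrow> 0"
      using tendsto_mult_right[OF lim(2), of K] by simp
  qed (use U(2) in \<open>auto simp: K_def\<close>)
  have limV: "(\<lambda>j. LINT x|lebesgue_on \<Omega>. norm (V x - grad (\<phi> j) x)) \<longlonglongrightarrow> 0"
  proof (rule tendsto_sandwich[OF _ _ tendsto_const])
    show "(\<lambda>j. l j * K) \<longlonglongrightarrow> 0"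
      using tendsto_mult_right[OF lim(1), of K] by simp
  qed (use V(2) in \<open>auto simp: K_def\<close>)
  show thesis
    using that[of \<phi> l] A lim U(1) V(1) limU limV unfolding V_def by simp
qed

end

subsection \<open>Differentiating along dilations\<close>

lemma test_function_measurable:
  assumes "\<phi> \<in> test_functions \<Omega>"
  shows "\<phi> \<in> borel_measurable lebesgue" "grad \<phi> \<in> borel_measurable lebesgue"
  by (intro continuous_imp_lebesgue_measurable test_function_continuous[OF assms] test_function_continuous_grad[OF assms])+

lemma test_function_integrable:
  assumes "\<phi> \<in> test_functions \<Omega>"
  shows "integrable lebesgue \<phi>"
proof -
  obtain S where S: "compact S" "\<And>x. x \<notin> S \<Longrightarrow> \<phi> x = 0"
    using test_function_support[OF assms] by metis
  obtain C where C: "\<And>x. \<bar>\<phi> x\<bar> \<le> C"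
    using test_function_bounded[OF assms] by metis
  show ?thesis
    by (rule integrable_bounded_compact_support[OF test_function_measurable(1)[OF assms] C S])
qed

lemma integrable_bounded_mult:
  fixes f w :: "'a \<Rightarrow> real"
  assumes f: "f \<in> borel_measurable M" "\<And>x. \<bar>f x\<bar> \<le> C" and w: "integrable M w"
  shows "integrable M (\<lambda>x. f x * w x)"
    and "(\<And>x. \<bar>w x\<bar> \<le> w' x) \<Longrightarrow> integrable M w' \<Longrightarrow> \<bar>\<integral>x. f x * w x \<partial>M\<bar> \<le> C * (\<integral>x. w' x \<partial>M)"
proof -
  have C: "C \<ge> 0"
    using f(2) abs_ge_zero order_trans by blast
  show int: "integrable M (\<lambda>x. f x * w x)"
  proof (rule Bochner_Integration.integrable_bound)
    show "integrable M (\<lambda>x. C * w x)"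
      using w by simp
    show "AE x in M. norm (f x * w x) \<le> norm (C * w x)"
      using f(2) C by (intro AE_I2) (auto simp: abs_mult intro!: mult_right_mono)
  qed (use f w in auto)
  assume w': "\<And>x. \<bar>w x\<bar> \<le> w' x" "integrable M w'"
  have "\<bar>\<integral>x. f x * w x \<partial>M\<bar> \<le> (\<integral>x. \<bar>f x * w x\<bar> \<partial>M)"
    using integral_norm_bound[of M "\<lambda>x. f x * w x"] by simp
  also have "\<dots> \<le> (\<integral>x. C * w' x \<partial>M)"
  proof (rule integral_mono)
    show "integrable M (\<lambda>x. \<bar>f x * w x\<bar>)"
      using int by (rule integrable_abs)
    show "integrable M (\<lambda>x. C * w' x)"
      using w' by simp
    show "\<bar>f x * w x\<bar> \<le> C * w' x" for x
      using f(2)[of x] w'(1)[of x] C by (simp add: abs_mult mult_mono)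
  qed
  also have "\<dots> = C * (\<integral>x. w' x \<partial>M)"
    by simp
  finally show "\<bar>\<integral>x. f x * w x \<partial>M\<bar> \<le> C * (\<integral>x. w' x \<partial>M)" .
qed

text \<open>As f vanishes off the unit ball, x is confined to |x| < 1 and the derivative is
  dominated by a constant there, uniformly in t.\<close>

lemma test_function_dilation_derivative:
  fixes f \<phi> :: "'a::euclidean_space \<Rightarrow> real"
  assumes f: "f \<in> borel_measurable lebesgue" "\<And>x. \<bar>f x\<bar> \<le> M" "\<And>x. x \<notin> ball 0 1 \<Longrightarrow> f x = 0"
    and \<phi>: "\<phi> \<in> test_functions \<Omega>" and t: "t \<in> {1/2<..<2}"
  shows "((\<lambda>t. \<integral>x. f x * \<phi> (t *\<^sub>R x) \<partial>lebesgue) has_real_derivative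
          (\<integral>x. f x * (grad \<phi> (t *\<^sub>R x) \<bullet> x) \<partial>lebesgue)) (at t)"
proof -
  obtain C where C: "C \<ge> 0" "\<And>x. norm (grad \<phi> x) \<le> C"
    using test_function_bounded[OF \<phi>] by metis
  have M: "M \<ge> 0"
    using f(2) abs_ge_zero order_trans by blast
  let ?B = "\<lambda>x::'a. indicator (ball 0 1) x * (M * C)"
  show ?thesis
  proof (rule has_derivative_integral_dominated[OF t])
    show "integrable lebesgue ?B"
      using lmeasurable_ball[of "0::'a" 1] unfolding fmeasurable_def infinity_ennreal_def[symmetric]
      by (intro integrable_mult_left integrable_real_indicator) blast+
    fix x :: 'a and s :: real assume s: "s \<in> {1/2<..<2}"
    show "integrable lebesgue (\<lambda>x. f x * \<phi> (s *\<^sub>R x))"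
      using s by (intro integrable_bounded_mult[OF f(1,2)] lebesgue_integral_dilate(1) test_function_integrable[OF \<phi>]) auto
    have "((\<lambda>s. s *\<^sub>R x) has_derivative (\<lambda>h. h *\<^sub>R x)) (at s)"
      by (auto intro!: derivative_eq_intros)
    from has_derivative_compose[OF this test_function_has_derivative[OF \<phi>]]
    have "((\<lambda>s. \<phi> (s *\<^sub>R x)) has_real_derivative grad \<phi> (s *\<^sub>R x) \<bullet> x) (at s)"
      by (simp add: has_field_derivative_def mult_commute_abs)
    then show "((\<lambda>s. f x * \<phi> (s *\<^sub>R x)) has_real_derivative f x * (grad \<phi> (s *\<^sub>R x) \<bullet> x)) (at s)"
      by (rule DERIV_cmult)
    show "\<bar>f x * (grad \<phi> (s *\<^sub>R x) \<bullet> x)\<bar> \<le> ?B x"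
    proof (cases "x \<in> ball 0 1")
      case True
      have "\<bar>grad \<phi> (s *\<^sub>R x) \<bullet> x\<bar> \<le> norm (grad \<phi> (s *\<^sub>R x)) * norm x"
        by (rule Cauchy_Schwarz_ineq2)
      also have "\<dots> \<le> C * 1"
        using C True by (intro mult_mono) auto
      finally have "\<bar>f x\<bar> * \<bar>grad \<phi> (s *\<^sub>R x) \<bullet> x\<bar> \<le> M * C"
        using f(2)[of x] M by (intro mult_mono) auto
      then show ?thesis
        using True by (simp add: abs_mult)
    qed (use f(3) in auto)
  qed
qed

text \<open>As f is bounded, the error is controlled by an L1 distance of dilates, that is, by the
  original L1 distance over t^n.\<close>

lemma dilation_integral_limit:
  fixes f U :: "'a::euclidean_space \<Rightarrow> real"
  assumes f: "f \<in> borel_measurable lebesgue" "\<And>x. \<bar>f x\<bar> \<le> M"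
    and U: "integrable lebesgue U"
    and \<phi>: "\<And>j. \<phi> j \<in> test_functions \<Omega>" "(\<lambda>j. \<integral>x. \<bar>U x - \<phi> j x\<bar> \<partial>lebesgue) \<longlonglongrightarrow> 0" and t: "t > 0"
  shows "(\<lambda>j. \<integral>x. f x * \<phi> j (t *\<^sub>R x) \<partial>lebesgue) \<longlonglongrightarrow> (\<integral>x. f x * U (t *\<^sub>R x) \<partial>lebesgue)"
proof (rule Lim_null[THEN iffD2], rule Lim_null_comparison)
  note int = test_function_integrable[OF \<phi>(1)] U
  show "(\<lambda>j. M / t ^ DIM('a) * (\<integral>x. \<bar>U x - \<phi> j x\<bar> \<partial>lebesgue)) \<longlonglongrightarrow> 0"
    using tendsto_mult_left[OF \<phi>(2), of "M / t ^ DIM('a)"] by simp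
  show "\<forall>\<^sub>F j in sequentially. norm ((\<integral>x. f x * \<phi> j (t *\<^sub>R x) \<partial>lebesgue) - (\<integral>x. f x * U (t *\<^sub>R x) \<partial>lebesgue))
      \<le> M / t ^ DIM('a) * (\<integral>x. \<bar>U x - \<phi> j x\<bar> \<partial>lebesgue)"
  proof (intro always_eventually allI)
    fix j
    have d: "integrable lebesgue (\<lambda>x. \<phi> j (t *\<^sub>R x) - U (t *\<^sub>R x))"
      using int t by (intro Bochner_Integration.integrable_diff lebesgue_integral_dilate(1)) auto
    have a: "integrable lebesgue (\<lambda>x. \<bar>U x - \<phi> j x\<bar>)"
      using int by auto
    have "(\<integral>x. f x * \<phi> j (t *\<^sub>R x) \<partial>lebesgue) - (\<integral>x. f x * U (t *\<^sub>R x) \<partial>lebesgue)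
        = (\<integral>x. f x * (\<phi> j (t *\<^sub>R x) - U (t *\<^sub>R x)) \<partial>lebesgue)"
      using integrable_bounded_mult(1)[OF f lebesgue_integral_dilate(1)[OF int(1) t, of j]]
        integrable_bounded_mult(1)[OF f lebesgue_integral_dilate(1)[OF int(2) t]]
      by (simp add: right_diff_distrib)
    also have "\<bar>\<dots>\<bar> \<le> M * (\<integral>x. \<bar>U (t *\<^sub>R x) - \<phi> j (t *\<^sub>R x)\<bar> \<partial>lebesgue)"
      using d lebesgue_integral_dilate(1)[OF a t] by (intro integrable_bounded_mult(2)[OF f]) auto
    also have "\<dots> = M / t ^ DIM('a) * (\<integral>x. \<bar>U x - \<phi> j x\<bar> \<partial>lebesgue)"
      using lebesgue_integral_dilate(2)[OF a t] by simp
    finally show "norm ((\<integral>x. f x * \<phi> j (t *\<^sub>R x) \<partial>lebesgue) - (\<integral>x. f x * U (t *\<^sub>R x) \<partial>lebesgue))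
      \<le> M / t ^ DIM('a) * (\<integral>x. \<bar>U x - \<phi> j x\<bar> \<partial>lebesgue)"
      by simp
  qed
qed

text \<open>The dilation acts on U, which has an integrable gradient, while the merely bounded f
  stays fixed. The derivatives for the approximants converge uniformly in t near 1, so limit and
  derivative can be interchanged.\<close>

lemma dilation_integral_differentiable:
  fixes f U :: "'a::euclidean_space \<Rightarrow> real" and V :: "'a \<Rightarrow> 'a"
  assumes f: "f \<in> borel_measurable lebesgue" "\<And>x. \<bar>f x\<bar> \<le> M" "\<And>x. x \<notin> ball 0 1 \<Longrightarrow> f x = 0"
    and U: "integrable lebesgue U" and V: "V \<in> borel_measurable lebesgue" "integrable lebesgue (\<lambda>x. norm (V x))"
    and \<phi>: "\<And>j. \<phi> j \<in> test_functions \<Omega>" "(\<lambda>j. \<integral>x. \<bar>U x - \<phi> j x\<bar> \<partial>lebesgue) \<longlonglongrightarrow> 0"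
      "\<And>j. integrable lebesgue (\<lambda>x. norm (V x - grad (\<phi> j) x))"
      "(\<lambda>j. \<integral>x. norm (V x - grad (\<phi> j) x) \<partial>lebesgue) \<longlonglongrightarrow> 0"
  shows "((\<lambda>t. \<integral>x. f x * U (t *\<^sub>R x) \<partial>lebesgue) has_real_derivative
          (\<integral>x. f x * (V x \<bullet> x) \<partial>lebesgue)) (at 1)"
proof -
  let ?S = "{1/2<..<2::real}"
  let ?I = "\<lambda>j t. \<integral>x. f x * \<phi> j (t *\<^sub>R x) \<partial>lebesgue" and ?J = "\<lambda>t. \<integral>x. f x * U (t *\<^sub>R x) \<partial>lebesgue"
  let ?I' = "\<lambda>j t. \<integral>x. f x * (grad (\<phi> j) (t *\<^sub>R x) \<bullet> x) \<partial>lebesgue" and ?J' = "\<lambda>t. \<integral>x. f x * (V (t *\<^sub>R x) \<bullet> x) \<partial>lebesgue"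
  have M: "M \<ge> 0"
    using f(2) abs_ge_zero order_trans by blast
  have meas[measurable]: "V \<in> borel_measurable lebesgue" "f \<in> borel_measurable lebesgue" "grad (\<phi> j) \<in> borel_measurable lebesgue" for j
    using V f test_function_measurable[OF \<phi>(1)] by auto
  have inner_bound: "\<bar>indicator (ball 0 1) x * (v \<bullet> x)\<bar> \<le> norm v" for v x :: 'a
  proof (cases "x \<in> ball 0 1")
    case True
    have "\<bar>v \<bullet> x\<bar> \<le> norm v * norm x"
      by (rule Cauchy_Schwarz_ineq2)
    also have "\<dots> \<le> norm v * 1"
      using True by (intro mult_left_mono) auto
    finally show ?thesis
      using True by simp
  qed simp
  have inner_ball: "f x * (v \<bullet> x) = f x * (indicator (ball 0 1) x * (v \<bullet> x))" for v x
    using f(3)[of x] by (cases "x \<in> ball 0 1") auto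
  have int: "integrable lebesgue (\<lambda>x. indicator (ball 0 1) x * (W (t *\<^sub>R x) \<bullet> x))"
    if W: "W \<in> borel_measurable lebesgue" "integrable lebesgue (\<lambda>x. norm (W x))" and t: "t > 0" for W :: "'a \<Rightarrow> 'a" and t :: real
  proof (rule Bochner_Integration.integrable_bound)
    show "integrable lebesgue (\<lambda>x. norm (W (t *\<^sub>R x)))"
      by (rule lebesgue_integral_dilate(1)[OF W(2) t])
    have [measurable]: "(\<lambda>x. W (t *\<^sub>R x)) \<in> borel_measurable lebesgue"
      by (rule measurable_compose[OF lebesgue_measurable_scaling W(1)])
    have [measurable]: "(\<lambda>x::'a. x) \<in> borel_measurable lebesgue"
      by (intro continuous_imp_lebesgue_measurable continuous_on_id)
    show "(\<lambda>x. indicator (ball 0 1) x * (W (t *\<^sub>R x) \<bullet> x)) \<in> borel_measurable lebesgue"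
      by (intro borel_measurable_times borel_measurable_inner borel_measurable_indicator) auto
    show "AE x in lebesgue. norm (indicator (ball 0 1) x * (W (t *\<^sub>R x) \<bullet> x)) \<le> norm (norm (W (t *\<^sub>R x)))"
      using inner_bound by simp
  qed
  have gint: "integrable lebesgue (\<lambda>x. norm (grad (\<phi> j) x))" for j
  proof (rule Bochner_Integration.integrable_bound[OF Bochner_Integration.integrable_add[OF V(2) \<phi>(3)[of j]]])
    show "AE x in lebesgue. norm (norm (grad (\<phi> j) x)) \<le> norm (norm (V x) + norm (V x - grad (\<phi> j) x))"
    proof (rule AE_I2)
      show "norm (norm (grad (\<phi> j) x)) \<le> norm (norm (V x) + norm (V x - grad (\<phi> j) x))" for x
        using norm_triangle_sub[of "grad (\<phi> j) x" "V x"] by (simp add: norm_minus_commute)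
    qed
  qed simp
  have bound: "\<bar>?I' j t - ?J' t\<bar> \<le> M * 2 ^ DIM('a) * (\<integral>x. norm (V x - grad (\<phi> j) x) \<partial>lebesgue)" if t: "t \<in> ?S" for j t
  proof -
    have t0: "t > 0"
      using t by simp
    have 1: "integrable lebesgue (\<lambda>x. f x * (indicator (ball 0 1) x * (grad (\<phi> j) (t *\<^sub>R x) \<bullet> x)))"
      "integrable lebesgue (\<lambda>x. f x * (indicator (ball 0 1) x * (V (t *\<^sub>R x) \<bullet> x)))"
      by (intro integrable_bounded_mult(1)[OF f(1,2)] int meas gint V t0)+
    have 2: "integrable lebesgue (\<lambda>x. indicator (ball 0 1) x * ((grad (\<phi> j) (t *\<^sub>R x) - V (t *\<^sub>R x)) \<bullet> x))"
      using Bochner_Integration.integrable_diff[OF int[OF meas(3)[of j] gint t0] int[OF V t0]]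
      by (simp add: inner_diff_left right_diff_distrib)
    have "?I' j t - ?J' t = (\<integral>x. f x * (indicator (ball 0 1) x * ((grad (\<phi> j) (t *\<^sub>R x) - V (t *\<^sub>R x)) \<bullet> x)) \<partial>lebesgue)"
      using 1 unfolding inner_ball by (simp add: inner_diff_left right_diff_distrib)
    also have "\<bar>\<dots>\<bar> \<le> M * (\<integral>x. norm (V (t *\<^sub>R x) - grad (\<phi> j) (t *\<^sub>R x)) \<partial>lebesgue)"
    proof (rule integrable_bounded_mult(2)[OF f(1,2) 2])
      show "\<bar>indicator (ball 0 1) x * ((grad (\<phi> j) (t *\<^sub>R x) - V (t *\<^sub>R x)) \<bullet> x)\<bar> \<le> norm (V (t *\<^sub>R x) - grad (\<phi> j) (t *\<^sub>R x))" for x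
        using inner_bound[of x "grad (\<phi> j) (t *\<^sub>R x) - V (t *\<^sub>R x)"] by (simp only: norm_minus_commute)
      show "integrable lebesgue (\<lambda>x. norm (V (t *\<^sub>R x) - grad (\<phi> j) (t *\<^sub>R x)))"
        by (rule lebesgue_integral_dilate(1)[OF \<phi>(3) t0])
    qed
    also have "\<dots> = M * ((1 / t) ^ DIM('a) * (\<integral>x. norm (V x - grad (\<phi> j) x) \<partial>lebesgue))"
      using lebesgue_integral_dilate(2)[OF \<phi>(3)[of j] t0] by (simp add: power_one_over)
    \<comment> \<open>On (1/2, 2) the Jacobian factor 1 / t^n is at most 2^n, which makes the bound
      uniform in t.\<close>
    also have "\<dots> \<le> M * (2 ^ DIM('a) * (\<integral>x. norm (V x - grad (\<phi> j) x) \<partial>lebesgue))"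
      using t M by (intro mult_left_mono mult_right_mono power_mono) (auto simp: field_simps)
    finally show ?thesis
      by (simp add: mult.assoc)
  qed
  have "\<exists>J. \<forall>t\<in>?S. (\<lambda>j. ?I j t) \<longlonglongrightarrow> J t \<and> (J has_derivative (\<lambda>h. ?J' t * h)) (at t within ?S)"
  proof (rule has_derivative_sequence[where f' = "\<lambda>j t h. ?I' j t * h" and ?x0.0 = 1])
    show "(?I j has_derivative (\<lambda>h. ?I' j t * h)) (at t within ?S)" if "t \<in> ?S" for j t
      using test_function_dilation_derivative[OF f \<phi>(1)[of j] that] has_derivative_at_withinI
      unfolding has_field_derivative_def by fast
    show "\<forall>\<^sub>F j in sequentially. \<forall>t\<in>?S. \<forall>h. norm (?I' j t * h - ?J' t * h) \<le> e * norm h" if "e > 0" for e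
    proof -
      have "(\<lambda>j. M * 2 ^ DIM('a) * (\<integral>x. norm (V x - grad (\<phi> j) x) \<partial>lebesgue)) \<longlonglongrightarrow> 0"
        using tendsto_mult_left[OF \<phi>(4), of "M * 2 ^ DIM('a)"] by simp
      then have "\<forall>\<^sub>F j in sequentially. M * 2 ^ DIM('a) * (\<integral>x. norm (V x - grad (\<phi> j) x) \<partial>lebesgue) < e"
        by (rule order_tendstoD(2)) (rule that)
      then show ?thesis
      proof eventually_elim
        case (elim j)
        show ?case
        proof (intro ballI allI)
          fix t h assume "t \<in> ?S"
          then have "\<bar>?I' j t - ?J' t\<bar> \<le> e"
            using bound[of t j] elim by linarith
          then show "norm (?I' j t * h - ?J' t * h) \<le> e * norm h"
            unfolding left_diff_distrib[symmetric] real_norm_def abs_mult by (rule mult_right_mono) simp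
        qed
      qed
    qed
    show "(\<lambda>j. ?I j 1) \<longlonglongrightarrow> ?J 1"
      using dilation_integral_limit[OF f(1,2) U \<phi>(1,2), of 1] by simp
  qed auto
  then obtain J where J: "\<And>t. t \<in> ?S \<Longrightarrow> (\<lambda>j. ?I j t) \<longlonglongrightarrow> J t"
    "\<And>t. t \<in> ?S \<Longrightarrow> (J has_derivative (\<lambda>h. ?J' t * h)) (at t within ?S)"
    by blast
  \<comment> \<open>The theorem on sequences of derivatives only provides some limit function;
    pointwise convergence identifies it.\<close>
  have "J t = ?J t" if "t \<in> ?S" for t
    using J(1)[OF that] dilation_integral_limit[OF f(1,2) U \<phi>(1,2), of t] that LIMSEQ_unique by fastforce
  moreover have "(J has_real_derivative ?J' 1) (at 1)"
    using J(2)[of 1] at_within_open[of 1 ?S] by (simp add: has_field_derivative_def)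
  ultimately have "(?J has_real_derivative ?J' 1) (at 1)"
    by (intro has_field_derivative_transform_within_open[of J "?J' 1" 1 ?S ?J]) auto
  then show ?thesis
    by simp
qed

subsection \<open>The strict Pohozaev inequality\<close>

text \<open>\<open>U\<close> and \<open>V\<close> are the bounded solution and its weak gradient, extended by \<open>0\<close> outside the ball;
  \<open>\<phi>\<close> approximates the solution, and \<open>l\<close> bounds the Luxemburg norms of the gradient errors.\<close>

locale critical_solution = N_func G g + H: N_func H h
  for G g H h :: "real \<Rightarrow> real" +
  fixes \<alpha> p q M :: real and U :: "'a::euclidean_space \<Rightarrow> real" and V :: "'a \<Rightarrow> 'a"
    and \<phi> :: "nat \<Rightarrow> 'a \<Rightarrow> real" and l :: "nat \<Rightarrow> real"
  assumes \<alpha>: "\<alpha> > 0" and p: "p > 1"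
    and G_upper: "\<And>t. t \<ge> 0 \<Longrightarrow> t * g t \<le> p * G t"
    and H_lower: "\<And>t. t \<ge> 0 \<Longrightarrow> q * H t \<le> t * h t"
    and critical: "p * (DIM('a) + \<alpha>) \<le> q * (DIM('a) - p)" and subdim: "p < DIM('a)"
    and U_meas: "U \<in> borel_measurable lebesgue" and U_bounds: "\<And>x. 0 \<le> U x" "\<And>x. U x \<le> M"
    and U_out: "\<And>x. x \<notin> ball 0 1 \<Longrightarrow> U x = 0"
    and U_pos: "AE x in lebesgue. x \<in> ball 0 1 \<longrightarrow> U x > 0"
    and V_meas: "V \<in> borel_measurable lebesgue"
    and V_int: "integrable lebesgue (\<lambda>x. norm (V x))"
    and V_energy: "integrable lebesgue (\<lambda>x. G (norm (V x)))"
    and test: "\<And>j. \<phi> j \<in> test_functions (ball 0 1)"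
    and l_pos: "\<And>j. l j > 0" and l_lim: "l \<longlonglongrightarrow> 0"
    and U_approx: "(\<lambda>j. \<integral>x. \<bar>U x - \<phi> j x\<bar> \<partial>lebesgue) \<longlonglongrightarrow> 0"
    and V_diff: "\<And>j. integrable lebesgue (\<lambda>x. norm (V x - grad (\<phi> j) x))"
    and V_approx: "(\<lambda>j. \<integral>x. norm (V x - grad (\<phi> j) x) \<partial>lebesgue) \<longlonglongrightarrow> 0"
    and modular_int: "\<And>j. integrable lebesgue (\<lambda>x. G (norm ((V x - grad (\<phi> j) x) /\<^sub>R l j)))"
    and modular_le: "\<And>j. (\<integral>x. G (norm ((V x - grad (\<phi> j) x) /\<^sub>R l j)) \<partial>lebesgue) \<le> 1"
    and weak_int: "\<And>\<psi>. \<psi> \<in> test_functions (ball 0 1) \<Longrightarrow> integrable lebesgue (\<lambda>x. G_field g (V x) \<bullet> grad \<psi> x)"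
    and weak: "\<And>\<psi>. \<psi> \<in> test_functions (ball 0 1) \<Longrightarrow>
      (\<integral>x. G_field g (V x) \<bullet> grad \<psi> x \<partial>lebesgue) = (\<integral>x. norm x powr \<alpha> * h (U x) * \<psi> x \<partial>lebesgue)"
    and self_int: "integrable lebesgue (\<lambda>x. G_field g (V x) \<bullet> V x)"
    and self: "(\<integral>x. G_field g (V x) \<bullet> V x \<partial>lebesgue) = (\<integral>x. norm x powr \<alpha> * h (U x) * U x \<partial>lebesgue)"
begin

section \<open>Energies, the linear term and their integrability\<close>

definition f :: "'a \<Rightarrow> real" where "f x = norm x powr \<alpha> * h (U x)"
definition E :: real where "E = (\<integral>x. G (norm (V x)) \<partial>lebesgue)"
definition K :: real where "K = (\<integral>x. norm x powr \<alpha> * H (U x) \<partial>lebesgue)"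
definition J :: "real \<Rightarrow> real" where "J t = (\<integral>x. f x * U (t *\<^sub>R x) \<partial>lebesgue)"
text \<open>The ball of radius 1/2 is a region on which the correction in
  \<open>competitor_inequality\<close> attains its constant height for every t > 1; \<open>F\<close>
  is the gain per unit of that height.\<close>

definition F :: real where "F = (\<integral>x. indicator (cball 0 (1/2)) x * f x \<partial>lebesgue)"

lemma M_nonneg: "M \<ge> 0"
  using U_bounds order_trans by blast

lemma norm_powr_measurable: "(\<lambda>x::'a. norm x powr \<alpha>) \<in> borel_measurable lebesgue"
  using \<alpha> by (intro continuous_imp_lebesgue_measurable continuous_on_powr' continuous_intros) auto

lemma U_composed_measurable:
  "(\<lambda>x. H (U x)) \<in> borel_measurable lebesgue" "(\<lambda>x. h (U x)) \<in> borel_measurable lebesgue"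
  using H.measurable_norm[OF U_meas] H.measurable_density[OF U_meas] U_bounds by simp_all

lemma f_measurable: "f \<in> borel_measurable lebesgue"
  unfolding f_def[abs_def] by (intro borel_measurable_times norm_powr_measurable U_composed_measurable)

lemma f_out: "x \<notin> ball 0 1 \<Longrightarrow> f x = 0"
  by (simp add: f_def U_out H.density_0)

lemma f_nonneg: "f x \<ge> 0"
  by (simp add: f_def H.density_nonneg U_bounds)

lemma norm_powr_le_1: "x \<in> ball 0 1 \<Longrightarrow> norm (x::'a) powr \<alpha> \<le> 1"
  using \<alpha> powr_mono2[of \<alpha> "norm x" 1] by simp

lemma f_bound: "\<bar>f x\<bar> \<le> h M"
proof (cases "x \<in> ball 0 1")
  case True
  then have "norm x powr \<alpha> * h (U x) \<le> 1 * h M"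
    using norm_powr_le_1 U_bounds H.density_mono H.density_nonneg by (intro mult_mono) auto
  then show ?thesis
    using f_nonneg[of x] by (simp add: f_def)
qed (simp add: f_out H.density_nonneg M_nonneg)

lemma integrable_ball_bounded:
  fixes w :: "'a \<Rightarrow> real"
  assumes "w \<in> borel_measurable lebesgue" "\<And>x. \<bar>w x\<bar> \<le> C" "\<And>x. x \<notin> ball 0 1 \<Longrightarrow> w x = 0"
  shows "integrable lebesgue w"
  by (rule integrable_bounded_compact_support[OF assms(1,2), of "cball 0 1"]) (use assms(3) in auto)

lemma f_integrable: "integrable lebesgue f"
  by (rule integrable_ball_bounded[OF f_measurable f_bound f_out])

lemma U_integrable: "integrable lebesgue U"
  by (rule integrable_ball_bounded[OF U_meas _ U_out, of M]) (use U_bounds in auto)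

lemma K_integrable: "integrable lebesgue (\<lambda>x. norm x powr \<alpha> * H (U x))"
proof (rule integrable_ball_bounded[where C = "H M"])
  show "(\<lambda>x. norm x powr \<alpha> * H (U x)) \<in> borel_measurable lebesgue"
    by (intro borel_measurable_times norm_powr_measurable U_composed_measurable)
  show "norm x powr \<alpha> * H (U x) = 0" if "x \<notin> ball 0 1" for x
    using that by (simp add: U_out H.at_0)
  show "\<bar>norm x powr \<alpha> * H (U x)\<bar> \<le> H M" for x
  proof (cases "x \<in> ball 0 1")
    case True
    then have "norm x powr \<alpha> * H (U x) \<le> 1 * H M"
      using norm_powr_le_1 U_bounds H.G_mono H.nonneg by (intro mult_mono) auto
    then show ?thesis
      by (simp add: abs_mult H.nonneg U_bounds)
  qed (simp add: U_out H.at_0 H.nonneg M_nonneg)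
qed

lemma K_nonneg: "K \<ge> 0"
  unfolding K_def by (intro Bochner_Integration.integral_nonneg) (simp add: H.nonneg U_bounds)

text \<open>The integrand is positive almost everywhere on the small ball: U is, and the weight
  vanishes only at the origin.\<close>

lemma F_pos: "F > 0"
proof -
  let ?w = "\<lambda>x. indicator (cball 0 (1/2)) x * f x"
  have meas: "(\<lambda>x. indicator (cball (0::'a) (1/2)) x) \<in> borel_measurable lebesgue"
    by (intro borel_measurable_indicator) auto
  have int: "integrable lebesgue ?w"
    by (rule integrable_bounded_mult(1)[OF meas _ f_integrable, of 1]) (simp add: indicator_def)
  have nn: "AE x in lebesgue. 0 \<le> ?w x"
    by (simp add: f_nonneg)
  have "F \<noteq> 0"
  proof
    assume "F = 0"
    then have "AE x in lebesgue. ?w x = 0"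
      using integral_nonneg_eq_0_iff_AE[OF int nn] by (simp add: F_def)
    moreover have "AE x in lebesgue. (x::'a) \<noteq> 0"
      by (rule AE_not_in[of "{0}", simplified]) (simp add: negligible_iff_null_sets[symmetric])
    ultimately have "AE x in lebesgue. (x::'a) \<notin> cball 0 (1/2)"
      using U_pos
    proof eventually_elim
      case (elim x)
      show ?case
      proof
        assume x: "x \<in> cball 0 (1/2)"
        then have "f x = 0" "U x > 0"
          using elim by auto
        then show False
          using elim(2) H.density_pos[of "U x"] by (simp add: f_def)
      qed
    qed
    then have "cball (0::'a) (1/2) \<in> null_sets lebesgue"
      by (subst (asm) AE_iff_null_sets[symmetric]) auto
    then have "negligible (cball (0::'a) (1/2))"
      by (simp add: negligible_iff_null_sets)
    then show False
      using negligible_subset[OF _ ball_subset_cball] open_not_negligible[of "ball (0::'a) (1/2)"] by auto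
  qed
  moreover have "F \<ge> 0"
    unfolding F_def by (intro Bochner_Integration.integral_nonneg) (simp add: f_nonneg)
  ultimately show ?thesis
    by simp
qed

text \<open>\<open>G_field g\<close> is a subgradient of the convex function G(|.|), by
  \<open>subgradient\<close> and Cauchy-Schwarz. After integration the field is eliminated by
  testing the equation with \<psi> and with the solution itself.\<close>

lemma energy_inequality:
  assumes \<psi>: "\<psi> \<in> test_functions (ball 0 1)"
  shows "E + (\<integral>x. f x * \<psi> x \<partial>lebesgue) - J 1 \<le> (\<integral>x. G (norm (grad \<psi> x)) \<partial>lebesgue)"
proof -
  have pointwise: "G (norm \<xi>) + (G_field g \<xi> \<bullet> \<eta> - G_field g \<xi> \<bullet> \<xi>) \<le> G (norm \<eta>)" for \<xi> \<eta> :: 'a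
  proof -
    have "G_field g \<xi> \<bullet> \<xi> = g (norm \<xi>) * norm \<xi>"
      by (cases "\<xi> = 0") (auto simp: G_field_def dot_square_norm power2_eq_square)
    moreover have "G_field g \<xi> \<bullet> \<eta> \<le> g (norm \<xi>) * norm \<eta>"
    proof (cases "\<xi> = 0")
      case True
      then show ?thesis
        by (simp add: G_field_def density_0)
    next
      case False
      have "G_field g \<xi> \<bullet> \<eta> = g (norm \<xi>) / norm \<xi> * (\<xi> \<bullet> \<eta>)"
        by (simp add: G_field_def)
      also have "\<dots> \<le> g (norm \<xi>) / norm \<xi> * (norm \<xi> * norm \<eta>)"
        by (intro mult_left_mono norm_cauchy_schwarz) (simp add: density_nonneg)
      finally show ?thesis
        using False by simp
    qed
    ultimately show ?thesis
      using subgradient[of "norm \<xi>" "norm \<eta>"] by (simp add: right_diff_distrib)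
  qed
  obtain C where C: "\<And>x. norm (grad \<psi> x) \<le> C"
    using test_function_bounded[OF \<psi>] by metis
  have "integrable lebesgue (\<lambda>x. G (norm (grad \<psi> x)))"
  proof (rule integrable_ball_bounded[where C = "G C"])
    show "\<bar>G (norm (grad \<psi> x))\<bar> \<le> G C" for x
      using G_mono[OF _ C[of x]] nonneg[of "norm (grad \<psi> x)"] by simp
  qed (auto simp: test_function_eq_0[OF \<psi>] at_0 intro!: measurable_norm test_function_measurable[OF \<psi>])
  then have "(\<integral>x. G (norm (V x)) + (G_field g (V x) \<bullet> grad \<psi> x - G_field g (V x) \<bullet> V x) \<partial>lebesgue)
      \<le> (\<integral>x. G (norm (grad \<psi> x)) \<partial>lebesgue)"
    using weak_int[OF \<psi>] self_int V_energy by (intro integral_mono pointwise) auto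
  then show ?thesis
    using weak_int[OF \<psi>] self_int V_energy weak[OF \<psi>] self
    by (simp add: E_def J_def f_def)
qed

lemma K_le_E: "q * K \<le> p * E"
proof -
  have 1: "norm x powr \<alpha> * (q * H (U x)) \<le> norm x powr \<alpha> * (U x * h (U x))" for x
    by (intro mult_left_mono H_lower U_bounds) simp
  have 2: "G_field g \<xi> \<bullet> \<xi> \<le> p * G (norm \<xi>)" for \<xi> :: 'a
  proof -
    have "G_field g \<xi> \<bullet> \<xi> = norm \<xi> * g (norm \<xi>)"
      by (cases "\<xi> = 0") (auto simp: G_field_def dot_square_norm power2_eq_square)
    then show ?thesis
      using G_upper[of "norm \<xi>"] by simp
  qed
  have "q * K = (\<integral>x. norm x powr \<alpha> * (q * H (U x)) \<partial>lebesgue)"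
    unfolding K_def by (subst integral_mult_right_zero[symmetric]) (simp add: algebra_simps)
  also have "\<dots> \<le> (\<integral>x. norm x powr \<alpha> * (U x * h (U x)) \<partial>lebesgue)"
  proof (rule integral_mono[OF _ _ 1])
    show "integrable lebesgue (\<lambda>x. norm x powr \<alpha> * (q * H (U x)))"
      using integrable_mult_right[of q lebesgue "\<lambda>x. norm x powr \<alpha> * H (U x)"] K_integrable by (simp add: algebra_simps)
    show "integrable lebesgue (\<lambda>x. norm x powr \<alpha> * (U x * h (U x)))"
      using integrable_bounded_mult(1)[OF f_measurable f_bound U_integrable] by (simp add: f_def algebra_simps)
  qed
  also have "\<dots> = (\<integral>x. G_field g (V x) \<bullet> V x \<partial>lebesgue)"
    unfolding self by (simp add: algebra_simps)
  also have "\<dots> \<le> (\<integral>x. p * G (norm (V x)) \<partial>lebesgue)"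
    using self_int V_energy by (intro integral_mono 2) auto
  also have "\<dots> = p * E"
    by (simp add: E_def)
  finally show ?thesis .
qed

text \<open>By convexity of \<open>H\<close>, \<open>J t - J 1\<close> lies below a smooth function of \<open>t\<close> that touches it at \<open>t = 1\<close>;
  this replaces the chain rule for \<open>H \<circ> u\<close>.\<close>

lemma J_derivative: "(J has_real_derivative - (DIM('a) + \<alpha>) * K) (at 1)"
proof -
  define D where "D = (\<integral>x. f x * (V x \<bullet> x) \<partial>lebesgue)"
  have D: "(J has_real_derivative D) (at 1)"
    unfolding J_def[abs_def] D_def
    by (rule dilation_integral_differentiable[OF f_measurable f_bound f_out U_integrable V_meas V_int test U_approx V_diff V_approx])
  \<comment> \<open>This holds for t < 1 too, thanks to the extension by 0. Homogeneity of the
    weight and the change of variables scale the integral \<open>K\<close> by exactly t^(- n -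
    \<alpha>).\<close>
  have le: "J t - J 1 \<le> (t powr - (DIM('a) + \<alpha>) - 1) * K" if t: "t > 0" for t
  proof -
    have eq: "norm x powr \<alpha> * H (U (t *\<^sub>R x)) = t powr - \<alpha> * (norm (t *\<^sub>R x) powr \<alpha> * H (U (t *\<^sub>R x)))" for x :: 'a
      using t by (simp add: powr_mult powr_minus)
    have scaled: "integrable lebesgue (\<lambda>x. norm x powr \<alpha> * H (U (t *\<^sub>R x)))"
      "(\<integral>x. norm x powr \<alpha> * H (U (t *\<^sub>R x)) \<partial>lebesgue) = t powr - \<alpha> * (K / t ^ DIM('a))"
      unfolding eq K_def using lebesgue_integral_dilate[OF K_integrable t] by simp_all
    have Ut: "integrable lebesgue (\<lambda>x. f x * U (t *\<^sub>R x))" "integrable lebesgue (\<lambda>x. f x * U (1 *\<^sub>R x))"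
      using t by (intro integrable_bounded_mult(1)[OF f_measurable f_bound] lebesgue_integral_dilate(1) U_integrable; simp)+
    have "J t - J 1 = (\<integral>x. f x * U (t *\<^sub>R x) - f x * U (1 *\<^sub>R x) \<partial>lebesgue)"
      unfolding J_def by (rule Bochner_Integration.integral_diff[OF Ut, symmetric])
    also have "\<dots> \<le> (\<integral>x. norm x powr \<alpha> * H (U (t *\<^sub>R x)) - norm x powr \<alpha> * H (U x) \<partial>lebesgue)"
    proof (rule integral_mono)
      show "f x * U (t *\<^sub>R x) - f x * U (1 *\<^sub>R x) \<le> norm x powr \<alpha> * H (U (t *\<^sub>R x)) - norm x powr \<alpha> * H (U x)" for x
        using mult_left_mono[OF H.subgradient[OF U_bounds(1)[of x] U_bounds(1)[of "t *\<^sub>R x"]], of "norm x powr \<alpha>"]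
        by (simp add: f_def algebra_simps)
    qed (use Ut scaled K_integrable in auto)
    also have "\<dots> = t powr - \<alpha> * (K / t ^ DIM('a)) - K"
      using scaled K_integrable by (simp add: K_def)
    also have "t powr - \<alpha> * (K / t ^ DIM('a)) = t powr - (DIM('a) + \<alpha>) * K"
    proof -
      have "- (DIM('a) + \<alpha>) = - \<alpha> - real DIM('a)"
        by simp
      then have "t powr - (DIM('a) + \<alpha>) = t powr - \<alpha> / t ^ DIM('a)"
        using t by (simp only: powr_diff powr_realpow)
      then show ?thesis
        by simp
    qed
    finally show ?thesis
      by (simp add: algebra_simps)
  qed
  let ?Q = "\<lambda>t. (t powr - (DIM('a) + \<alpha>) - 1) * K - (J t - J 1)"
  have Q: "(?Q has_real_derivative - (DIM('a) + \<alpha>) * K - D) (at 1)"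
    by (rule derivative_eq_intros D refl | simp)+
  \<comment> \<open>By \<open>le\<close> on both sides of 1, the function \<open>?Q\<close> has an
    interior minimum at 1, so its derivative vanishes.\<close>
  have "- (DIM('a) + \<alpha>) * K - D = 0"
    by (rule DERIV_local_min[OF Q, of 1]) (use le in auto)
  then show ?thesis
    using D by simp
qed

text \<open>The dilated solution vanishes on the shell \<open>1 / t \<le> \<bar>x\<bar> < 1\<close>. Adding a function that is constant
  inside and decreases to \<open>0\<close> across the shell with slope at most \<open>2 * \<epsilon>\<close> costs an energy of order
  \<open>G (2 * \<epsilon>) = o(\<epsilon>)\<close> times the width of the shell, but gains \<open>\<epsilon>\<close> times the width: this makes the Pohozaev
  inequality strict, in place of the Hopf boundary lemma.\<close>

lemma competitor_inequality:
  assumes \<psi>: "\<psi> \<in> test_functions (ball 0 1)" and t: "t > 1" and \<epsilon>: "\<epsilon> > 0"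
    and \<sigma>: "\<And>k. C_k k \<sigma>" "\<And>s. s \<le> 1/4 \<Longrightarrow> \<sigma> s = 0" "\<And>s. s \<ge> 3/4 \<Longrightarrow> \<sigma> s = c" "c > 0" "\<And>s. \<sigma> s \<ge> 0"
    and \<sigma>': "\<And>s. (\<sigma> has_real_derivative \<sigma>' s) (at s)" "\<And>s. \<bar>\<sigma>' s\<bar> \<le> 1" "\<And>s. s \<notin> {1/4<..<3/4} \<Longrightarrow> \<sigma>' s = 0"
  shows "E + (\<integral>x. f x * \<psi> (t *\<^sub>R x) \<partial>lebesgue) + \<epsilon> * (1 - 1 / t\<^sup>2) * c * F - J 1
    \<le> (\<integral>x. G (t * norm (grad \<psi> x)) \<partial>lebesgue) / t ^ DIM('a)
       + G (2 * \<epsilon>) * (unit_ball_vol DIM('a) * (1 - 1 / t ^ DIM('a)))"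
proof -
  \<comment> \<open>\<open>\<delta>\<close> is the value of 1 - |x|^2 on the sphere |x| = 1 / t. The
    square is used as it is smooth at the origin.\<close>
  define \<delta> where "\<delta> = 1 - 1 / t\<^sup>2"
  have \<delta>: "\<delta> > 0" "\<delta> < 1"
    using t by (auto simp: \<delta>_def field_simps power2_eq_square less_1_mult)
  \<comment> \<open>The factor \<open>\<delta>\<close> in the height cancels the 1 / \<delta> of the
    chain rule: the slope is at most 2 \<epsilon> for every t, and the height is proportional to
    \<open>\<delta>\<close>.\<close>
  define w :: "'a \<Rightarrow> real" where "w x = \<epsilon> * \<delta> * \<sigma> ((1 - x \<bullet> x) / \<delta>)" for x
  have w_nonneg: "w x \<ge> 0" for x
    using \<epsilon> \<delta> \<sigma>(5) by (simp add: w_def)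
  have grad_w: "(w has_derivative (\<lambda>y. ((- 2 * \<epsilon> * \<sigma>' ((1 - x \<bullet> x) / \<delta>)) *\<^sub>R x) \<bullet> y)) (at x)" for x
  proof -
    have "((\<lambda>x. (1 - x \<bullet> x) / \<delta>) has_derivative (\<lambda>y. - 2 * (x \<bullet> y) / \<delta>)) (at x)"
      using \<delta> by (auto intro!: derivative_eq_intros simp: inner_commute)
    from has_derivative_compose[OF this \<sigma>'(1)[unfolded has_field_derivative_def]]
    have "((\<lambda>x. \<epsilon> * \<delta> * \<sigma> ((1 - x \<bullet> x) / \<delta>)) has_derivative
        (\<lambda>y. \<epsilon> * \<delta> * (\<sigma>' ((1 - x \<bullet> x) / \<delta>) * (- 2 * (x \<bullet> y) / \<delta>)))) (at x)"
      by (rule has_derivative_mult_right)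
    moreover have "(\<lambda>y. \<epsilon> * \<delta> * (\<sigma>' ((1 - x \<bullet> x) / \<delta>) * (- 2 * (x \<bullet> y) / \<delta>))) =
        (\<lambda>y. ((- 2 * \<epsilon> * \<sigma>' ((1 - x \<bullet> x) / \<delta>)) *\<^sub>R x) \<bullet> y)"
      using \<delta> by (simp add: fun_eq_iff)
    ultimately show ?thesis
      unfolding w_def[abs_def] by (rule has_derivative_eq_rhs)
  qed
  have w_test: "w \<in> test_functions (ball 0 1)"
  proof (rule test_functionsI[of _ "cball 0 (sqrt (1 - \<delta> / 4))"])
    \<comment> \<open>The support radius comes from the margin of the step: \<open>w\<close>
      vanishes once 1 - |x|^2 <= \<delta> / 4.\<close>
    show "C_k k w" for k
    proof -
      have "C_k k (\<lambda>x::'a. \<Sum>i\<in>Basis. (x \<bullet> i) * (x \<bullet> i))"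
        by (intro C_k_sum C_k_mult C_k_bounded_linear bounded_linear_inner_left)
      then have "C_k k (\<lambda>x::'a. x \<bullet> x)"
        by (simp add: euclidean_inner[symmetric])
      then have "C_k k (\<lambda>x::'a. (1 - x \<bullet> x) * (1 / \<delta>))"
        by (intro C_k_mult[OF C_k_diff] C_k_const)
      then have "C_k k (\<lambda>x::'a. (1 - x \<bullet> x) / \<delta>)"
        by simp
      then have "C_k k (\<lambda>x::'a. \<sigma> ((1 - x \<bullet> x) / \<delta>))"
        by (rule C_k_compose[OF \<sigma>(1)])
      then show ?thesis
        unfolding w_def[abs_def] by (intro C_k_mult C_k_const)
    qed
    show "cball 0 (sqrt (1 - \<delta> / 4)) \<subseteq> ball (0::'a) 1"
    proof
      fix x :: 'a assume "x \<in> cball 0 (sqrt (1 - \<delta> / 4))"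
      then have "norm x \<le> sqrt (1 - \<delta> / 4)"
        by simp
      also have "\<dots> < 1"
        using \<delta> by simp
      finally show "x \<in> ball 0 1"
        by simp
    qed
    show "w x = 0" if "x \<notin> cball 0 (sqrt (1 - \<delta> / 4))" for x
    proof -
      have "sqrt (1 - \<delta> / 4) < norm x"
        using that by simp
      then have "1 - \<delta> / 4 < (norm x)\<^sup>2"
        using real_sqrt_less_iff[of "1 - \<delta> / 4" "(norm x)\<^sup>2"] by simp
      then have "(1 - x \<bullet> x) / \<delta> \<le> 1/4"
        using \<delta> by (simp add: power2_norm_eq_inner field_simps)
      then show ?thesis
        by (simp add: w_def \<sigma>(2))
    qed
  qed simp
  have gw: "grad w x = (- 2 * \<epsilon> * \<sigma>' ((1 - x \<bullet> x) / \<delta>)) *\<^sub>R x" for x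
    by (rule grad_eqI[OF grad_w])
  have gw_bound: "norm (grad w x) \<le> 2 * \<epsilon>" for x
  proof (cases "x \<in> ball 0 1")
    case True
    have "norm (grad w x) = 2 * \<epsilon> * (\<bar>\<sigma>' ((1 - x \<bullet> x) / \<delta>)\<bar> * norm x)"
      using \<epsilon> by (simp add: gw abs_mult)
    also have "\<dots> \<le> 2 * \<epsilon> * (1 * 1)"
      using \<epsilon> \<sigma>'(2) True by (intro mult_left_mono mult_mono) auto
    finally show ?thesis
      by simp
  qed (use test_function_eq_0(2)[OF w_test] \<epsilon> in simp)
  have gw_inner: "grad w x = 0" if "norm x < 1 / t" for x
  proof -
    have "(norm x)\<^sup>2 \<le> (1 / t)\<^sup>2"
      using that by (intro power_mono) auto
    then have "\<delta> \<le> 1 - x \<bullet> x"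
      by (simp add: \<delta>_def power2_norm_eq_inner power_divide)
    then have "(1 - x \<bullet> x) / \<delta> \<ge> 1"
      using \<delta> by (simp add: field_simps)
    moreover have "\<sigma>' s = 0" if "s \<ge> 1" for s
      using that by (intro \<sigma>'(3)) simp
    ultimately have "\<sigma>' ((1 - x \<bullet> x) / \<delta>) = 0"
      by blast
    then show ?thesis
      by (simp add: gw)
  qed
  define \<Psi> where "\<Psi> x = \<psi> (t *\<^sub>R x)" for x
  have \<Psi>: "\<Psi> \<in> test_functions (ball 0 1)"
    unfolding \<Psi>_def[abs_def] using test_functions_dilate[OF \<psi>] t by simp
  have g\<Psi>: "grad \<Psi> x = t *\<^sub>R grad \<psi> (t *\<^sub>R x)" for x
    unfolding \<Psi>_def[abs_def] by (rule grad_dilate[OF test_function_differentiable[OF \<psi>]])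
  have g\<Psi>_outer: "grad \<Psi> x = 0" if "norm x \<ge> 1 / t" for x
  proof -
    have "t *\<^sub>R x \<notin> ball 0 1"
      using that t by (simp add: field_simps)
    then show ?thesis
      by (simp add: g\<Psi> test_function_eq_0(2)[OF \<psi>])
  qed
  let ?S = "ball 0 1 - ball 0 (1 / t) :: 'a set"
  have S: "?S \<in> lmeasurable"
    by (intro fmeasurable_Diff lmeasurable_ball) auto
  have "1 / t \<le> 1"
    using t by simp
  then have sub: "ball 0 (1 / t) \<subseteq> ball (0::'a) 1"
    by (rule subset_ball)
  have "measure lebesgue ?S = measure lebesgue (ball (0::'a) 1) - measure lebesgue (ball (0::'a) (1 / t))"
    using sub by (intro measurable_measure_Diff lmeasurable_ball) (auto simp: fmeasurableD)
  also have "\<dots> = unit_ball_vol DIM('a) * (1 - 1 / t ^ DIM('a))"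
    using t content_ball[of 1 "0::'a"] content_ball[of "1 / t" "0::'a"]
    by (simp add: measure_completion power_one_over right_diff_distrib)
  finally have mS: "measure lebesgue ?S = unit_ball_vol DIM('a) * (1 - 1 / t ^ DIM('a))" .
  have G\<psi>: "integrable lebesgue (\<lambda>x. G (t * norm (grad \<psi> x)))"
  proof -
    obtain C where C: "\<And>x. norm (grad \<psi> x) \<le> C"
      using test_function_bounded[OF \<psi>] by metis
    have [measurable]: "(\<lambda>x. t *\<^sub>R grad \<psi> x) \<in> borel_measurable lebesgue"
      using test_function_measurable(2)[OF \<psi>] by simp
    show ?thesis
    proof (rule integrable_ball_bounded[where C = "G (t * C)"])
      show "(\<lambda>x. G (t * norm (grad \<psi> x))) \<in> borel_measurable lebesgue"
        using measurable_norm[of "\<lambda>x. t *\<^sub>R grad \<psi> x" lebesgue] t by simp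
      show "\<bar>G (t * norm (grad \<psi> x))\<bar> \<le> G (t * C)" for x
        using G_mono[of "t * norm (grad \<psi> x)" "t * C"] nonneg[of "t * norm (grad \<psi> x)"] C[of x] t by simp
    qed (simp add: test_function_eq_0[OF \<psi>] at_0)
  qed
  have "E + (\<integral>x. f x * (\<Psi> x + w x) \<partial>lebesgue) - J 1 \<le> (\<integral>x. G (norm (grad (\<lambda>x. \<Psi> x + w x) x)) \<partial>lebesgue)"
    by (rule energy_inequality[OF test_functions_add[OF \<Psi> w_test]])
  also have "\<dots> \<le> (\<integral>x. G (t * norm (grad \<psi> (t *\<^sub>R x))) + G (2 * \<epsilon>) * indicator ?S x \<partial>lebesgue)"
  proof (rule integral_mono')
    show "integrable lebesgue (\<lambda>x. G (t * norm (grad \<psi> (t *\<^sub>R x))) + G (2 * \<epsilon>) * indicator ?S x)"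
      using lebesgue_integral_dilate(1)[OF G\<psi>, of t] S t
      by (intro Bochner_Integration.integrable_add integrable_mult_right integrable_real_indicator)
        (auto simp: fmeasurable_def)
    fix x :: 'a
    have grad: "grad (\<lambda>x. \<Psi> x + w x) x = grad \<Psi> x + grad w x"
      by (intro grad_add test_function_differentiable[OF \<Psi>] test_function_differentiable[OF w_test])
    \<comment> \<open>The gradients of the dilate and of \<open>w\<close> live on disjoint sets, so
      at each point at most one of the two is charged and no cross term arises.\<close>
    consider "norm x < 1 / t" | "norm x \<ge> 1 / t" "x \<in> ball 0 1" | "norm x \<ge> 1 / t" "x \<notin> ball 0 1"
      by linarith
    then show "G (norm (grad (\<lambda>x. \<Psi> x + w x) x)) \<le> G (t * norm (grad \<psi> (t *\<^sub>R x))) + G (2 * \<epsilon>) * indicator ?S x"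
    proof cases
      case 1
      then show ?thesis
        using t \<epsilon> by (simp add: grad gw_inner g\<Psi> nonneg)
    next
      case 2
      then show ?thesis
        using t \<epsilon> G_mono[OF norm_ge_zero gw_bound[of x]] nonneg[of "t * norm (grad \<psi> (t *\<^sub>R x))"]
        by (simp add: grad g\<Psi>_outer)
    next
      case 3
      then show ?thesis
        using t \<epsilon> by (simp add: grad g\<Psi>_outer test_function_eq_0(2)[OF w_test] at_0 nonneg)
    qed
    show "0 \<le> G (t * norm (grad \<psi> (t *\<^sub>R x))) + G (2 * \<epsilon>) * indicator ?S x"
      using t \<epsilon> by (intro add_nonneg_nonneg mult_nonneg_nonneg nonneg) auto
  qed
  also have "\<dots> = (\<integral>x. G (t * norm (grad \<psi> x)) \<partial>lebesgue) / t ^ DIM('a) + G (2 * \<epsilon>) * measure lebesgue ?S"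
  proof -
    have "integrable lebesgue (indicator ?S :: 'a \<Rightarrow> real)"
      using S by (intro integrable_real_indicator) (auto simp: fmeasurable_def)
    then show ?thesis
      using lebesgue_integral_dilate[OF G\<psi>, of t] t S by (simp add: fmeasurableD)
  qed
  finally have main: "E + (\<integral>x. f x * (\<Psi> x + w x) \<partial>lebesgue) - J 1 \<le>
      (\<integral>x. G (t * norm (grad \<psi> x)) \<partial>lebesgue) / t ^ DIM('a)
       + G (2 * \<epsilon>) * (unit_ball_vol DIM('a) * (1 - 1 / t ^ DIM('a)))"
    unfolding mS .
  have fint: "integrable lebesgue (\<lambda>x. f x * \<Psi> x)" "integrable lebesgue (\<lambda>x. f x * w x)"
    by (intro integrable_bounded_mult(1)[OF f_measurable f_bound] test_function_integrable[OF \<Psi>] test_function_integrable[OF w_test])+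
  have "\<epsilon> * \<delta> * c * F = (\<integral>x. \<epsilon> * \<delta> * c * (indicator (cball 0 (1/2)) x * f x) \<partial>lebesgue)"
    by (simp add: F_def)
  also have "\<dots> \<le> (\<integral>x. f x * w x \<partial>lebesgue)"
  proof (rule integral_mono'[OF fint(2)])
    fix x :: 'a
    show "0 \<le> f x * w x"
      by (intro mult_nonneg_nonneg f_nonneg w_nonneg)
    show "\<epsilon> * \<delta> * c * (indicator (cball 0 (1/2)) x * f x) \<le> f x * w x"
    proof (cases "x \<in> cball 0 (1/2)")
      case True
      then have "(norm x)\<^sup>2 \<le> (1/2)\<^sup>2"
        by (intro power_mono) auto
      then have "x \<bullet> x \<le> 1/4"
        by (simp add: power2_norm_eq_inner power_divide)
      \<comment> \<open>Since \<delta> < 1, the quotient is at least 3/4, the upper margin of the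
        step, whatever t > 1 is.\<close>
      then have "(1 - x \<bullet> x) / \<delta> \<ge> 3/4"
        using \<delta> by (simp add: field_simps)
      then have "w x = \<epsilon> * \<delta> * c"
        by (simp add: w_def \<sigma>(3))
      then show ?thesis
        using True by simp
    qed (use f_nonneg w_nonneg in simp)
  qed
  finally have "\<epsilon> * \<delta> * c * F \<le> (\<integral>x. f x * w x \<partial>lebesgue)" .
  moreover have "(\<integral>x. f x * (\<Psi> x + w x) \<partial>lebesgue) = (\<integral>x. f x * \<Psi> x \<partial>lebesgue) + (\<integral>x. f x * w x \<partial>lebesgue)"
    using fint by (simp add: distrib_left)
  ultimately show ?thesis
    using main unfolding \<Psi>_def \<delta>_def by linarith
qed

text \<open>t |grad \<phi>| is at most the convex combination, with weights 1 - t l and t l, of |V|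
  / r and |V - grad \<phi>| / l; matching the coefficient of |V| forces r = 1 / t - l.
  \<open>dilate_le\<close> handles the first part, and the second has modular at most 1, which
  leaves the error t l.\<close>

lemma approximate_energy:
  assumes t: "t > 1" and \<theta>: "t * l j < 1" and c: "1 - p * (1 - (1 / t - l j)) > 0"
  shows "(\<integral>x. G (t * norm (grad (\<phi> j) x)) \<partial>lebesgue) \<le> E / (1 - p * (1 - (1 / t - l j))) + t * l j"
proof -
  define r where "r = 1 / t - l j"
  define c where "c = 1 - p * (1 - r)"
  have "1 / t < 1"
    using t by simp
  then have "r \<le> 1"
    using l_pos[of j] unfolding r_def by linarith
  moreover have "0 < r" "(1 - t * l j) / r = t"
    using t \<theta> by (auto simp: r_def field_simps)
  ultimately have r: "0 < r" "r \<le> 1" "(1 - t * l j) / r = t"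
    by blast+
  have c0: "c > 0"
    using c by (simp add: c_def r_def)
  let ?d = "\<lambda>x. G (norm ((V x - grad (\<phi> j) x) /\<^sub>R l j))"
  have pointwise: "G (t * norm (grad (\<phi> j) x)) \<le> G (norm (V x)) / c + t * l j * ?d x" for x
  proof -
    define a where "a = norm (V x) / r"
    define b where "b = norm ((V x - grad (\<phi> j) x) /\<^sub>R l j)"
    have ab: "a \<ge> 0" "b \<ge> 0"
      using r by (auto simp: a_def b_def)
    have "norm (grad (\<phi> j) x) \<le> norm (V x) + norm (V x - grad (\<phi> j) x)"
      using norm_triangle_sub[of "grad (\<phi> j) x" "V x"] by (simp add: norm_minus_commute)
    then have "t * norm (grad (\<phi> j) x) \<le> t * (norm (V x) + norm (V x - grad (\<phi> j) x))"
      using t by (intro mult_left_mono) auto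
    also have "\<dots> = t * norm (V x) + t * norm (V x - grad (\<phi> j) x)"
      by (rule distrib_left)
    also have "t * norm (V x) = (1 - t * l j) / r * norm (V x)"
      by (simp only: r(3))
    also have "\<dots> = (1 - t * l j) * a"
      by (simp add: a_def)
    also have "t * norm (V x - grad (\<phi> j) x) = t * l j * b"
      using l_pos[of j] by (simp add: b_def)
    finally have "G (t * norm (grad (\<phi> j) x)) \<le> G ((1 - t * l j) * a + t * l j * b)"
      using t by (intro G_mono) auto
    also have "\<dots> \<le> (1 - t * l j) * G a + t * l j * G b"
      using ab t \<theta> l_pos[of j] by (intro convex) auto
    also have "(1 - t * l j) * G a \<le> 1 * G a"
      using ab t l_pos[of j] nonneg[of a] by (intro mult_right_mono) auto
    also have "1 * G a \<le> G (norm (V x)) / c"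
    proof -
      have "r * a = norm (V x)"
        using r(1) by (simp add: a_def)
      then have "c * G a \<le> G (norm (V x))"
        using dilate_le[OF G_upper[OF ab(1)] ab(1), of r] r by (simp add: c_def)
      then show ?thesis
        using c0 by (simp add: pos_le_divide_eq mult.commute)
    qed
    finally show ?thesis
      by (simp add: b_def)
  qed
  have "(\<integral>x. G (t * norm (grad (\<phi> j) x)) \<partial>lebesgue) \<le> (\<integral>x. G (norm (V x)) / c + t * l j * ?d x \<partial>lebesgue)"
    using V_energy modular_int[of j] pointwise t l_pos[of j] nonneg c0
    by (intro integral_mono') (auto simp del: norm_scaleR intro!: add_nonneg_nonneg mult_nonneg_nonneg simp: less_imp_le)
  also have "\<dots> = E / c + t * l j * (\<integral>x. ?d x \<partial>lebesgue)"
    using V_energy modular_int[of j] by (simp add: E_def del: norm_scaleR)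
  also have "\<dots> \<le> E / c + t * l j * 1"
    using modular_le[of j] t l_pos[of j] by (intro add_left_mono mult_left_mono) auto
  finally show ?thesis
    by (simp add: c_def r_def)
qed

text \<open>The limit over the approximants at fixed t, after which no test function is left in the
  inequality. Positivity of the denominator restricts t to a neighbourhood of 1.\<close>

lemma strict_inequality:
  assumes t: "t > 1" "1 - p * (1 - 1 / t) > 0" and \<epsilon>: "\<epsilon> > 0"
    and \<sigma>: "\<And>k. C_k k \<sigma>" "\<And>s. s \<le> 1/4 \<Longrightarrow> \<sigma> s = 0" "\<And>s. s \<ge> 3/4 \<Longrightarrow> \<sigma> s = c" "c > 0" "\<And>s. \<sigma> s \<ge> 0"
    and \<sigma>': "\<And>s. (\<sigma> has_real_derivative \<sigma>' s) (at s)" "\<And>s. \<bar>\<sigma>' s\<bar> \<le> 1" "\<And>s. s \<notin> {1/4<..<3/4} \<Longrightarrow> \<sigma>' s = 0"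
  shows "E + J t + \<epsilon> * (1 - 1 / t\<^sup>2) * c * F - J 1
    \<le> E / (1 - p * (1 - 1 / t)) / t ^ DIM('a) + G (2 * \<epsilon>) * (unit_ball_vol DIM('a) * (1 - 1 / t ^ DIM('a)))"
proof -
  let ?L = "\<lambda>j. E + (\<integral>x. f x * \<phi> j (t *\<^sub>R x) \<partial>lebesgue) + \<epsilon> * (1 - 1 / t\<^sup>2) * c * F - J 1"
  let ?R = "\<lambda>j. (E / (1 - p * (1 - (1 / t - l j))) + t * l j) / t ^ DIM('a) + G (2 * \<epsilon>) * (unit_ball_vol DIM('a) * (1 - 1 / t ^ DIM('a)))"
  have "(\<lambda>j. \<integral>x. f x * \<phi> j (t *\<^sub>R x) \<partial>lebesgue) \<longlonglongrightarrow> J t"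
    unfolding J_def using t by (intro dilation_integral_limit[OF f_measurable f_bound U_integrable test U_approx]) auto
  then have L: "?L \<longlonglongrightarrow> E + J t + \<epsilon> * (1 - 1 / t\<^sup>2) * c * F - J 1"
    by (intro tendsto_intros)
  have c_lim: "(\<lambda>j. 1 - p * (1 - (1 / t - l j))) \<longlonglongrightarrow> 1 - p * (1 - (1 / t - 0))"
    by (intro tendsto_intros l_lim)
  have "?R \<longlonglongrightarrow> (E / (1 - p * (1 - (1 / t - 0))) + t * 0) / t ^ DIM('a)
      + G (2 * \<epsilon>) * (unit_ball_vol DIM('a) * (1 - 1 / t ^ DIM('a)))"
    using t by (intro tendsto_add tendsto_divide tendsto_mult tendsto_const l_lim c_lim) auto
  then have R: "?R \<longlonglongrightarrow> E / (1 - p * (1 - 1 / t)) / t ^ DIM('a)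
      + G (2 * \<epsilon>) * (unit_ball_vol DIM('a) * (1 - 1 / t ^ DIM('a)))"
    by simp
  have "\<forall>\<^sub>F j in sequentially. 1 - p * (1 - (1 / t - l j)) > 0"
    using c_lim t(2) by (intro order_tendstoD(1)[OF c_lim]) simp
  moreover have "(\<lambda>j. t * l j) \<longlonglongrightarrow> t * 0"
    by (intro tendsto_intros l_lim)
  then have "\<forall>\<^sub>F j in sequentially. t * l j < 1"
    by (rule order_tendstoD(2)) simp
  ultimately have "\<forall>\<^sub>F j in sequentially. ?L j \<le> ?R j"
  proof eventually_elim
    case (elim j)
    have "?L j \<le> (\<integral>x. G (t * norm (grad (\<phi> j) x)) \<partial>lebesgue) / t ^ DIM('a)
        + G (2 * \<epsilon>) * (unit_ball_vol DIM('a) * (1 - 1 / t ^ DIM('a)))"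
      by (rule competitor_inequality[OF test t(1) \<epsilon> \<sigma> \<sigma>'])
    also have "\<dots> \<le> ?R j"
      using t approximate_energy[OF t(1) elim(2,1)] by (intro add_right_mono divide_right_mono) auto
    finally show ?case .
  qed
  then show ?thesis
    by (rule tendsto_le[OF trivial_limit_sequentially R L])
qed

text \<open>The two sides of \<open>strict_inequality\<close> agree at t = 1, so the derivative of
  their difference there is nonnegative. By \<open>K_le_E\<close> and \<open>critical\<close> its
  terms in \<open>E\<close> and \<open>K\<close> add up to at most 0, and only the cost and the gain
  of the correction remain.\<close>

lemma shell_energy_lower_bound:
  assumes \<epsilon>: "\<epsilon> > 0"
    and \<sigma>: "\<And>k. C_k k \<sigma>" "\<And>s. s \<le> 1/4 \<Longrightarrow> \<sigma> s = 0" "\<And>s. s \<ge> 3/4 \<Longrightarrow> \<sigma> s = c" "c > 0" "\<And>s. \<sigma> s \<ge> 0"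
    and \<sigma>': "\<And>s. (\<sigma> has_real_derivative \<sigma>' s) (at s)" "\<And>s. \<bar>\<sigma>' s\<bar> \<le> 1" "\<And>s. s \<notin> {1/4<..<3/4} \<Longrightarrow> \<sigma>' s = 0"
  shows "2 * \<epsilon> * c * F \<le> G (2 * \<epsilon>) * (unit_ball_vol DIM('a) * DIM('a))"
proof -
  let ?n = "DIM('a)"
  let ?w = "unit_ball_vol ?n"
  define P where "P t = E / (1 - p * (1 - 1 / t)) / t ^ ?n + G (2 * \<epsilon>) * (?w * (1 - 1 / t ^ ?n))
      - (E + J t + \<epsilon> * (1 - 1 / t\<^sup>2) * c * F - J 1)" for t
  have P: "(P has_real_derivative (p - ?n) * E + G (2 * \<epsilon>) * (?w * ?n) + (?n + \<alpha>) * K - 2 * \<epsilon> * c * F) (at 1)"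
    unfolding P_def[abs_def]
    by (rule derivative_eq_intros J_derivative refl | simp add: algebra_simps)+
  have "\<not> (p - ?n) * E + G (2 * \<epsilon>) * (?w * ?n) + (?n + \<alpha>) * K - 2 * \<epsilon> * c * F < 0"
  proof
    assume neg: "(p - ?n) * E + G (2 * \<epsilon>) * (?w * ?n) + (?n + \<alpha>) * K - 2 * \<epsilon> * c * F < 0"
    obtain d where d: "d > 0" "\<And>s. 0 < s \<Longrightarrow> s < d \<Longrightarrow> P (1 + s) < P 1"
      using DERIV_neg_dec_right[OF P neg] by blast
    \<comment> \<open>At t = 1 + s the denominator 1 - p (1 - 1 / t) equals (1 - s (p - 1)) / (1 +
      s), which is positive for s (p - 1) < 1.\<close>
    define s where "s = min (d / 2) (1 / (2 * (p - 1)))"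
    have s: "0 < s" "s < d" "s \<le> 1 / (2 * (p - 1))"
      using d(1) p by (auto simp: s_def)
    then have "s * (p - 1) < 1"
      using p by (simp add: field_simps)
    then have "1 - p * (1 - 1 / (1 + s)) > 0"
      using s(1) by (simp add: field_simps)
    then have "P (1 + s) \<ge> 0"
      using strict_inequality[OF _ _ \<epsilon> \<sigma> \<sigma>', of "1 + s"] s(1) by (simp add: P_def)
    moreover have "P 1 = 0"
      by (simp add: P_def)
    ultimately show False
      using d(2)[OF s(1,2)] by simp
  qed
  moreover have "(?n + \<alpha>) * K \<le> (?n - p) * E"
  proof -
    have "p * ((?n + \<alpha>) * K) \<le> q * (?n - p) * K"
      using mult_right_mono[OF critical K_nonneg] by (simp only: mult.assoc)
    also have "\<dots> = (?n - p) * (q * K)"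
      by simp
    also have "\<dots> \<le> (?n - p) * (p * E)"
      using subdim by (intro mult_left_mono K_le_E) simp
    finally have "p * ((?n + \<alpha>) * K) \<le> p * ((?n - p) * E)"
      by (simp add: algebra_simps)
    then show ?thesis
      using p by simp
  qed
  ultimately show ?thesis
    by (simp add: algebra_simps)
qed

text \<open>Dividing the shell bound by the slope \<tau> = 2 \<epsilon> leaves a fixed positive
  lower bound for g(\<tau>), whereas g tends to 0 at 0. The constant \<open>k\<close> is the surface
  area of the unit sphere.\<close>

lemma contradiction: False
proof -
  obtain \<sigma> \<sigma>' :: "real \<Rightarrow> real" and c where
    \<sigma>: "\<And>k. C_k k \<sigma>" "\<And>s. s \<le> 1/4 \<Longrightarrow> \<sigma> s = 0" "\<And>s. s \<ge> 3/4 \<Longrightarrow> \<sigma> s = c" "c > 0" "\<And>s. \<sigma> s \<ge> 0"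
    and \<sigma>': "\<And>s. (\<sigma> has_real_derivative \<sigma>' s) (at s)" "\<And>s. \<bar>\<sigma>' s\<bar> \<le> 1" "\<And>s. s \<notin> {1/4<..<3/4} \<Longrightarrow> \<sigma>' s = 0"
    by (rule smooth_step_exists) (rule that)
  define k where "k = unit_ball_vol DIM('a) * DIM('a)"
  have k: "k > 0"
    by (simp add: k_def)
  have "c * F / k \<le> g \<tau>" if "\<tau> > 0" for \<tau>
  proof -
    have "\<tau> * (c * F) \<le> G \<tau> * k"
      using shell_energy_lower_bound[OF _ \<sigma> \<sigma>', of "\<tau> / 2"] that by (simp add: k_def mult.assoc)
    also have "\<dots> \<le> (\<tau> * g \<tau>) * k"
      using k that by (intro mult_right_mono le_mult_density) auto
    finally have "c * F \<le> g \<tau> * k"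
      using that by (simp add: mult.assoc)
    then show ?thesis
      using k by (simp add: field_simps)
  qed
  then have "c * F / k \<le> 0"
    by (intro tendsto_lowerbound[OF density_tendsto_0])
      (auto intro!: eventually_mono[OF eventually_at_right_less])
  then show False
    using divide_pos_pos[OF mult_pos_pos[OF \<sigma>(4) F_pos] k] by simp
qed

end

section \<open>From a weak solution on the ball to its extension by zero\<close>

lemma (in N_func) modular_le_imp_integrable:
  fixes f :: "'a::euclidean_space \<Rightarrow> 'b::euclidean_space"
  assumes f: "f \<in> borel_measurable (lebesgue_on \<Omega>)" and c: "modular G \<Omega> f \<le> ennreal c" "c \<ge> 0"
  shows "integrable (lebesgue_on \<Omega>) (\<lambda>x. G (norm (f x)))" "(LINT x|lebesgue_on \<Omega>. G (norm (f x))) \<le> c"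
proof -
  show int: "integrable (lebesgue_on \<Omega>) (\<lambda>x. G (norm (f x)))"
  proof (rule integrableI_bounded[OF measurable_norm[OF f]])
    have "(\<integral>\<^sup>+x. ennreal (norm (G (norm (f x)))) \<partial>lebesgue_on \<Omega>) = modular G \<Omega> f"
      by (simp add: modular_def nonneg)
    also have "\<dots> < \<infinity>"
      using c(1) by (simp add: le_less_trans[OF _ ennreal_less_top])
    finally show "(\<integral>\<^sup>+x. ennreal (norm (G (norm (f x)))) \<partial>lebesgue_on \<Omega>) < \<infinity>" .
  qed
  have "ennreal (LINT x|lebesgue_on \<Omega>. G (norm (f x))) = modular G \<Omega> f"
    unfolding modular_def by (rule nn_integral_eq_integral[symmetric, OF int]) (simp add: nonneg)
  then show "(LINT x|lebesgue_on \<Omega>. G (norm (f x))) \<le> c"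
    using c by (metis ennreal_le_iff)
qed

lemma lint_lebesgue_on_AE:
  fixes f f' :: "'a::euclidean_space \<Rightarrow> real"
  assumes \<Omega>: "\<Omega> \<in> sets lebesgue" and f: "integrable (lebesgue_on \<Omega>) f"
    and eq: "AE x in lebesgue_on \<Omega>. f x = f' x" and out: "\<And>x. x \<notin> \<Omega> \<Longrightarrow> f' x = 0"
  shows "integrable lebesgue f'" "(LINT x|lebesgue. f' x) = (LINT x|lebesgue_on \<Omega>. f x)"
proof -
  have meas: "f' \<in> borel_measurable (lebesgue_on \<Omega>)"
    by (rule lebesgue_on_measurable_AE[OF \<Omega> _ eq]) (use f in auto)
  have "integrable (lebesgue_on \<Omega>) f'"
    by (rule integrable_cong_AE_imp[OF f meas eq])
  then show "integrable lebesgue f'"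
    using lint_lebesgue_on(2)[of \<Omega> f', OF \<Omega> out] by simp
  have "(LINT x|lebesgue_on \<Omega>. f x) = (LINT x|lebesgue_on \<Omega>. f' x)"
    by (rule integral_cong_AE[OF _ meas eq]) (use f in auto)
  then show "(LINT x|lebesgue. f' x) = (LINT x|lebesgue_on \<Omega>. f x)"
    using lint_lebesgue_on(1)[OF \<Omega> out] by simp
qed

theorem theorem1p4:
  fixes \<alpha> pm pp qm qp :: real and G g H h :: "real \<Rightarrow> real"
  assumes "CARD('n::finite) \<ge> 2"
    and "\<alpha> > 0"
    and "N_function G g" and "N_function H h"
    and "pm \<in> {1<..<real CARD('n)}" and "pp \<in> {1<..<real CARD('n)}"
    and "qm \<in> {1<..<real CARD('n)}" and "qp \<in> {1<..<real CARD('n)}"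
    and "\<And>t. t \<ge> 0 \<Longrightarrow> pm * G t \<le> t * g t \<and> t * g t \<le> pp * G t"
    and "\<And>t. t \<ge> 0 \<Longrightarrow> qm * H t \<le> t * h t \<and> t * h t \<le> qp * H t"
    and "qm \<ge> critical_exponent (real CARD('n)) \<alpha> pp"
  shows "\<not> (\<exists>u :: real ^ 'n \<Rightarrow> real.
    u \<in> L_infty (ball 0 1) \<inter> W1_0 G (ball 0 1) \<and> weak_solution G g h \<alpha> (ball 0 1) u)"
proof
  let ?B = "ball (0 :: real ^ 'n) 1"
  assume "\<exists>u :: real ^ 'n \<Rightarrow> real. u \<in> L_infty ?B \<inter> W1_0 G ?B \<and> weak_solution G g h \<alpha> ?B u"
  then obtain u :: "real ^ 'n \<Rightarrow> real" where u: "u \<in> L_infty ?B" "u \<in> W1_0 G ?B" and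
    sol: "AE x in lebesgue_on ?B. 0 < u x"
      "\<And>v. v \<in> W1_0 G ?B \<Longrightarrow> integrable (lebesgue_on ?B) (\<lambda>x. G_field g (weak_gradient ?B u x) \<bullet> weak_gradient ?B v x)"
      "\<And>v. v \<in> W1_0 G ?B \<Longrightarrow> integrable (lebesgue_on ?B) (\<lambda>x. norm x powr \<alpha> * h (max (u x) 0) * v x)"
      "\<And>v. v \<in> W1_0 G ?B \<Longrightarrow> (LINT x|lebesgue_on ?B. G_field g (weak_gradient ?B u x) \<bullet> weak_gradient ?B v x) =
        (LINT x|lebesgue_on ?B. norm x powr \<alpha> * h (max (u x) 0) * v x)"
    unfolding weak_solution_def by blast
  interpret N_func G g
    by standard (rule assms(3))
  interpret H: N_func H h
    by standard (rule assms(4))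
  have B: "open ?B" "?B \<in> lmeasurable" "?B \<in> sets lebesgue"
    by auto
  define DU where "DU = weak_gradient ?B u"
  obtain M0 where M0: "AE x in lebesgue_on ?B. \<bar>u x\<bar> \<le> M0" and u_meas: "u \<in> borel_measurable (lebesgue_on ?B)"
    using u(1) unfolding L_infty_def by blast
  \<comment> \<open>Clipping to [0, M] changes u only on a null set and makes the bounds hold at
    every point; the maximum with 0 keeps the clipped values nonnegative.\<close>
  define M where "M = max M0 0"
  define U where "U x = (if x \<in> ?B then min (max (u x) 0) M else 0)" for x
  define V where "V x = (if x \<in> ?B then DU x else 0)" for x
  obtain \<phi> l where \<phi>: "\<And>j::nat. \<phi> j \<in> test_functions ?B" and l: "\<And>j. l j > 0" "l \<longlonglongrightarrow> 0"
    and U_diff: "\<And>j. integrable (lebesgue_on ?B) (\<lambda>x. \<bar>u x - \<phi> j x\<bar>)"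
      "(\<lambda>j. LINT x|lebesgue_on ?B. \<bar>u x - \<phi> j x\<bar>) \<longlonglongrightarrow> 0"
    and V_diff: "\<And>j. integrable (lebesgue_on ?B) (\<lambda>x. norm (DU x - grad (\<phi> j) x))"
      "(\<lambda>j. LINT x|lebesgue_on ?B. norm (DU x - grad (\<phi> j) x)) \<longlonglongrightarrow> 0"
    and modular: "\<And>j. modular G ?B (\<lambda>x. (DU x - grad (\<phi> j) x) /\<^sub>R l j) \<le> 1"
    using W1_0_approximation[OF B(1,2) u(2)] unfolding DU_def[symmetric] by blast
  have DU_meas: "DU \<in> borel_measurable (lebesgue_on ?B)" and DU_modular: "modular G ?B DU < \<infinity>"
    using u(2) by (auto simp: W1_0_def W1_def Orlicz_class_def DU_def)
  have in_B: "AE x in lebesgue_on ?B. x \<in> ?B"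
    by (rule AE_I2) (simp add: space_restrict_space)
  have U_eq: "AE x in lebesgue_on ?B. u x = U x"
    using M0 sol(1) in_B by eventually_elim (auto simp: U_def M_def)
  have V_eq: "AE x in lebesgue_on ?B. DU x = V x"
    using in_B by eventually_elim (simp add: V_def)
  have out: "U x = 0" "V x = 0" if "x \<notin> ?B" for x
    using that by (auto simp: U_def V_def)
  have grad_eq: "AE x in lebesgue_on ?B. weak_gradient ?B \<psi> x = grad \<psi> x" if "\<psi> \<in> test_functions ?B" for \<psi>
    by (rule weak_gradient_test_function[OF B(1) that])
  have energy: "integrable lebesgue (\<lambda>x. G (norm (V x)))"
  proof (rule lint_lebesgue_on_AE(1)[OF B(3)])
    obtain c where "modular G ?B DU = ennreal c" "c \<ge> 0"
      using DU_modular by (cases "modular G ?B DU") auto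
    then show "integrable (lebesgue_on ?B) (\<lambda>x. G (norm (DU x)))"
      using modular_le_imp_integrable(1)[OF DU_meas, of c] by simp
    show "AE x in lebesgue_on ?B. G (norm (DU x)) = G (norm (V x))"
      using V_eq by eventually_elim simp
  qed (simp add: out at_0)
  have meas_diff: "(\<lambda>x. (DU x - grad (\<phi> j) x) /\<^sub>R l j) \<in> borel_measurable (lebesgue_on ?B)" for j
    using DU_meas measurable_restrict_space1[OF test_function_measurable(2)[OF \<phi>[of j]]] by simp
  note mod = modular_le_imp_integrable[OF meas_diff, of _ 1, unfolded ennreal_1, OF modular zero_le_one]
  have mod_eq: "AE x in lebesgue_on ?B. G (norm ((DU x - grad (\<phi> j) x) /\<^sub>R l j)) = G (norm ((V x - grad (\<phi> j) x) /\<^sub>R l j))" for j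
    using V_eq by eventually_elim simp
  have mod_out: "G (norm ((V x - grad (\<phi> j) x) /\<^sub>R l j)) = 0" if "x \<notin> ?B" for x j
    using out(2)[OF that] test_function_eq_0(2)[OF \<phi> that] by (simp add: at_0)
  have U_diff_eq: "AE x in lebesgue_on ?B. \<bar>u x - \<phi> j x\<bar> = \<bar>U x - \<phi> j x\<bar>" for j
    using U_eq by eventually_elim simp
  have U_diff_out: "\<bar>U x - \<phi> j x\<bar> = 0" if "x \<notin> ?B" for x j
    using out(1)[OF that] test_function_eq_0(1)[OF \<phi> that] by simp
  have V_diff_eq: "AE x in lebesgue_on ?B. norm (DU x - grad (\<phi> j) x) = norm (V x - grad (\<phi> j) x)" for j
    using V_eq by eventually_elim simp
  have V_diff_out: "norm (V x - grad (\<phi> j) x) = 0" if "x \<notin> ?B" for x j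
    using out(2)[OF that] test_function_eq_0(2)[OF \<phi> that] by simp
  note V_diff' = lint_lebesgue_on_AE[OF B(3) V_diff(1) V_diff_eq V_diff_out]
  have V_meas: "V \<in> borel_measurable lebesgue"
    unfolding V_def[abs_def] borel_measurable_if[OF B(3)] by (rule DU_meas)
  have U_meas: "U \<in> borel_measurable lebesgue"
    unfolding U_def[abs_def] borel_measurable_if[OF B(3)] using u_meas by simp
  \<comment> \<open>Formulated for representatives \<open>w\<close> and \<open>W\<close> of v and
    its weak gradient, so that it serves both the solution itself, with \<open>U\<close> and
    \<open>V\<close>, and test functions with their classical gradients.\<close>
  have weak: "integrable lebesgue (\<lambda>x. G_field g (V x) \<bullet> W x)"
    "(\<integral>x. G_field g (V x) \<bullet> W x \<partial>lebesgue) = (\<integral>x. norm x powr \<alpha> * h (U x) * w x \<partial>lebesgue)"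
    if v: "v \<in> W1_0 G ?B" and W: "AE x in lebesgue_on ?B. weak_gradient ?B v x = W x"
      and w: "AE x in lebesgue_on ?B. v x = w x" for v w W
  proof -
    have 1: "AE x in lebesgue_on ?B. G_field g (weak_gradient ?B u x) \<bullet> weak_gradient ?B v x = G_field g (V x) \<bullet> W x"
      using W V_eq unfolding DU_def by eventually_elim simp
    have 2: "AE x in lebesgue_on ?B. norm x powr \<alpha> * h (max (u x) 0) * v x = norm x powr \<alpha> * h (U x) * w x"
      using w U_eq sol(1) by eventually_elim (simp add: max_def)
    show "integrable lebesgue (\<lambda>x. G_field g (V x) \<bullet> W x)"
      by (rule lint_lebesgue_on_AE(1)[OF B(3) sol(2)[OF v] 1]) (simp add: out G_field_def)
    have "(\<integral>x. G_field g (V x) \<bullet> W x \<partial>lebesgue) =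
        (LINT x|lebesgue_on ?B. G_field g (weak_gradient ?B u x) \<bullet> weak_gradient ?B v x)"
      by (rule lint_lebesgue_on_AE(2)[OF B(3) sol(2)[OF v] 1]) (simp add: out G_field_def)
    also have "\<dots> = (LINT x|lebesgue_on ?B. norm x powr \<alpha> * h (max (u x) 0) * v x)"
      by (rule sol(4)[OF v])
    also have "\<dots> = (\<integral>x. norm x powr \<alpha> * h (U x) * w x \<partial>lebesgue)"
      by (rule lint_lebesgue_on_AE(2)[OF B(3) sol(3)[OF v] 2, symmetric]) (simp add: out H.density_0)
    finally show "(\<integral>x. G_field g (V x) \<bullet> W x \<partial>lebesgue) = (\<integral>x. norm x powr \<alpha> * h (U x) * w x \<partial>lebesgue)" .
  qed
  have "critical_solution G g H h \<alpha> pp qm M U V \<phi> l"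
  proof
    show "\<alpha> > 0" "1 < pp" "pp < DIM(real ^ 'n)"
      using assms(2,6) by simp_all
    show "t * g t \<le> pp * G t" "qm * H t \<le> t * h t" if "t \<ge> 0" for t
      using assms(9,10) that by blast+
    show "pp * (DIM(real ^ 'n) + \<alpha>) \<le> qm * (DIM(real ^ 'n) - pp)"
    proof -
      have "real CARD('n) - pp > 0"
        using assms(6) by simp
      moreover have "(pp * (real CARD('n) + \<alpha>)) / (real CARD('n) - pp) \<le> qm"
        using assms(11) by (simp add: critical_exponent_def add_divide_distrib[symmetric] algebra_simps)
      ultimately show ?thesis
        by (simp add: pos_divide_le_eq)
    qed
    show "0 \<le> U x" "U x \<le> M" for x
      by (auto simp: U_def M_def)
    show "AE x in lebesgue. x \<in> ?B \<longrightarrow> U x > 0"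
    proof -
      have "AE x in lebesgue_on ?B. U x > 0"
        using U_eq sol(1) by eventually_elim simp
      then show ?thesis
        using B(3) by (simp add: AE_restrict_space_iff)
    qed
    \<comment> \<open>A single approximant suffices: its distance to \<open>V\<close> is integrable,
      and its gradient is bounded with compact support.\<close>
    show "integrable lebesgue (\<lambda>x. norm (V x))"
    proof (rule Bochner_Integration.integrable_bound)
      have "grad (\<phi> 0) \<in> borel_measurable lebesgue"
        by (rule test_function_measurable[OF \<phi>])
      obtain C where "C \<ge> 0" "\<And>x. norm (grad (\<phi> 0) x) \<le> C"
        using test_function_bounded[OF \<phi>] by metis
      then have "integrable lebesgue (\<lambda>x. norm (grad (\<phi> 0) x))"
        using test_function_measurable(2)[OF \<phi>] test_function_eq_0(2)[OF \<phi>]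
        by (intro integrable_bounded_compact_support[of _ C "cball 0 1"]) auto
      then show "integrable lebesgue (\<lambda>x. norm (V x - grad (\<phi> 0) x) + norm (grad (\<phi> 0) x))"
        using V_diff'(1) by (rule Bochner_Integration.integrable_add[rotated])
      show "AE x in lebesgue. norm (norm (V x)) \<le> norm (norm (V x - grad (\<phi> 0) x) + norm (grad (\<phi> 0) x))"
        using norm_triangle_sub[of "V _" "grad (\<phi> 0) _"] by (intro AE_I2) (simp add: add.commute)
    qed (use V_meas in simp)
    show "(\<lambda>j. \<integral>x. \<bar>U x - \<phi> j x\<bar> \<partial>lebesgue) \<longlonglongrightarrow> 0"
      using U_diff(2) lint_lebesgue_on_AE(2)[OF B(3) U_diff(1) U_diff_eq U_diff_out] by simp
    show "integrable lebesgue (\<lambda>x. norm (V x - grad (\<phi> j) x))" for j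
      by (rule V_diff'(1))
    show "(\<lambda>j. \<integral>x. norm (V x - grad (\<phi> j) x) \<partial>lebesgue) \<longlonglongrightarrow> 0"
      using V_diff(2) V_diff'(2) by simp
    show "integrable lebesgue (\<lambda>x. G (norm ((V x - grad (\<phi> j) x) /\<^sub>R l j)))" for j
      by (rule lint_lebesgue_on_AE(1)[OF B(3) mod(1) mod_eq mod_out])
    show "(\<integral>x. G (norm ((V x - grad (\<phi> j) x) /\<^sub>R l j)) \<partial>lebesgue) \<le> 1" for j
      by (rule order_trans[OF eq_refl[OF lint_lebesgue_on_AE(2)[OF B(3) mod(1) mod_eq mod_out]] mod(2)])
    show "integrable lebesgue (\<lambda>x. G_field g (V x) \<bullet> V x)"
      "(\<integral>x. G_field g (V x) \<bullet> V x \<partial>lebesgue) = (\<integral>x. norm x powr \<alpha> * h (U x) * U x \<partial>lebesgue)"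
      by (intro weak[OF u(2) V_eq[unfolded DU_def] U_eq])+
    fix \<psi> assume \<psi>: "\<psi> \<in> test_functions ?B"
    show "integrable lebesgue (\<lambda>x. G_field g (V x) \<bullet> grad \<psi> x)"
      "(\<integral>x. G_field g (V x) \<bullet> grad \<psi> x \<partial>lebesgue) = (\<integral>x. norm x powr \<alpha> * h (U x) * \<psi> x \<partial>lebesgue)"
      using weak[OF test_function_W1_0[OF B(1,2) \<psi>] grad_eq[OF \<psi>], of \<psi>] by simp_all
  qed (use out energy V_meas U_meas \<phi> l in auto)
  then show False
    by (rule critical_solution.contradiction)
qed

end
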